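(* There exists a constant $\beta > 0$ such that for every sufficiently large integer $k$ the following holds: every simple Eulerian digraph with minimum in-degree (and out-degree) at least $100k$ immerses a simple digraph with at most $\beta k$ vertices and at least $k^2/2$ edges.
   Context: A simple digraph has no loops and at most one copy of the edge $xy$ for each ordered pair $(x,y)$ (both $xy$ and $yx$ may be present). A digraph is Eulerian if every vertex has in-degree equal to out-degree. A digraph $G$ immerses $H$ if there is an injective $f:V(H)\to V(G)$ and pairwise edge-disjoint directed paths $P_e$ in $G$, one per edge $e=uv$ of $H$, from $f(u)$ to $f(v)$. *)

theory Defs
  imports Complex_Main "Graph_Theory.Graph_Theory"
begin

text \<open>
  A finite simple digraph is an instance of the locale \<^locale>\<open>digraph\<close>: finite, without loops
  and without parallel arcs; antiparallel arcs are allowed.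
\<close>

text \<open>Connectedness is not required.\<close>

definition eulerian :: "('a, 'b) pre_digraph \<Rightarrow> bool" where
  "eulerian G \<longleftrightarrow> (\<forall>v\<in>verts G. in_degree G v = out_degree G v)"

text \<open>
  The paths are simple (no repeated vertex) and pairwise arc-disjoint. They may share vertices
  with one another and may pass through images of vertices of \<open>H\<close>.
\<close>

definition immerses :: "('a, 'b) pre_digraph \<Rightarrow> ('c, 'd) pre_digraph \<Rightarrow> bool" where
  "immerses G H \<longleftrightarrow>
     (\<exists>(f :: 'c \<Rightarrow> 'a) (P :: 'd \<Rightarrow> 'b awalk).
        inj_on f (verts H) \<and> f ` verts H \<subseteq> verts G \<and>
        (\<forall>e\<in>arcs H. pre_digraph.apath G (f (tail H e)) (P e) (f (head H e))) \<and>
        (\<forall>e1\<in>arcs H. \<forall>e2\<in>arcs H. e1 \<noteq> e2 \<longrightarrow> set (P e1) \<inter> set (P e2) = {}))"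

end

theory Submission
  imports Defs
begin

text \<open>
  Suppose that no such digraph is immersed. Splicing off excess degree, we obtain a simple
  \<open>100k\<close>-regular family of arc-disjoint links. Now eliminate the vertices one by one: pair the links entering
  the vertex with those leaving it, join the pairs, and drop loops. A join parallel to an existing link is set
  aside as pending. By assumption the simple links are locally sparse (any \<open>200k\<close> vertices span at most
  \<open>k\<^sup>2/2\<close> of them), so an average pairing creates few pending links. On the other hand a pending link is
  spliced again, and then usually becomes simple, as soon as either of its two ends is eliminated. With \<open>n\<close>
  vertices left this happens at rate \<open>2/n\<close>, whereas the number of vertices decreases at rate \<open>1/n\<close> only.
  Hence a potential that counts pending links and missing degrees stays below \<open>3k/25\<close> per vertex. When
  \<open>200k\<close> vertices are left, they span almost \<open>100k\<close> simple links per vertex, a contradiction.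
\<close>

section \<open>Pairing two sets at average cost\<close>

text \<open>A pending link cannot always be turned into a simple one: joining a link from
  \<open>a\<close> to \<open>v\<close> with a simple link from \<open>v\<close> to \<open>b\<close>
  is blocked if \<open>(a, b)\<close> is already present, and the blocking \<open>b\<close> are
  common out-neighbours of \<open>a\<close> and \<open>v\<close>. Hence a pending link weighs 1 plus
  its codegree over \<open>3 * d\<close>. The factor 3 makes the books balance: in the sum over all
  vertices, blocking costs codegree over \<open>d\<close>, and the codegree term is refunded three
  times, once at each end and once in pieces as the common neighbours are eliminated. This averaging
  needs all degrees equal to \<open>d\<close> and at most \<open>k\<close> pending links at each
  vertex. In every other situation a suitably extreme vertex lowers the potential by
  \<open>3 * k / 25\<close> on its own. The average case is tight: if the potential is at its bound,
  the expected drop exceeds the required one by \<open>164 / 1000 * 3 * k / 25\<close>, which must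
  cover the overhead \<open>k / 120\<close> of blocked simple joins and \<open>k / 100\<close> of
  raised codegrees.\<close>

lemma exists_le_average:
  fixes g :: "'i \<Rightarrow> real"
  assumes "finite A" "A \<noteq> {}"
  shows "\<exists>x\<in>A. real (card A) * g x \<le> (\<Sum>y\<in>A. g y)"
proof (rule ccontr)
  assume "\<not> ?thesis"
  then have "(\<Sum>y\<in>A. g y) < real (card A) * g x" if "x \<in> A" for x
    using that by force
  then have "(\<Sum>x\<in>A. \<Sum>y\<in>A. g y) < (\<Sum>x\<in>A. real (card A) * g x)"
    using assms by (intro sum_strict_mono) auto
  then show False
    by (simp add: sum_distrib_left)
qed

text \<open>The cyclic shifts of one fixed bijection use every pair from \<open>I\<close> and
  \<open>J\<close> exactly once, so their costs add up to the double sum and one of them is at most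
  average.\<close>

lemma exists_bij_le_average:
  fixes h :: "'i \<Rightarrow> 'j \<Rightarrow> real"
  assumes I: "finite I" and J: "finite J" and card_eq: "card I = card J" and ne: "I \<noteq> {}"
  shows "\<exists>\<sigma>. bij_betw \<sigma> I J \<and> real (card I) * (\<Sum>i\<in>I. h i (\<sigma> i)) \<le> (\<Sum>i\<in>I. \<Sum>j\<in>J. h i j)"
proof -
  define n where "n = card I"
  have n: "n > 0" using I ne by (simp add: n_def card_gt_0_iff)
  obtain e where e: "bij_betw e I {0..<n}"
    using ex_bij_betw_finite_nat[OF I] by (auto simp: n_def)
  obtain g where g: "bij_betw g {0..<n} J"
    using ex_bij_betw_nat_finite[OF J] card_eq by (auto simp: n_def)
  define \<rho> where "\<rho> r i = g ((e i + r) mod n)" for r i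
  have shift: "bij_betw (\<lambda>s. (s + r) mod n) {0..<n} {0..<n}" for r
  proof -
    have "inj_on (\<lambda>s. (s + r) mod n) {0..<n}"
    proof (rule inj_onI)
      have key: "s = t" if "s \<le> t" "t < n" "(s + r) mod n = (t + r) mod n" for s t
      proof -
        have "n dvd (t + r) - (s + r)"
          using that mod_eq_dvd_iff_nat[of "s + r" "t + r" n] by simp
        then show ?thesis using that by (auto dest: dvd_imp_le)
      qed
      fix s t assume "s \<in> {0..<n}" "t \<in> {0..<n}" "(s + r) mod n = (t + r) mod n"
      then show "s = t" using key[of s t] key[of t s] by (cases "s \<le> t") auto
    qed
    moreover have "(\<lambda>s. (s + r) mod n) ` {0..<n} \<subseteq> {0..<n}" using n by auto
    ultimately show ?thesis
      by (simp add: bij_betw_def card_image card_subset_eq)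
  qed
  have \<rho>: "bij_betw (\<rho> r) I J" for r
    using bij_betw_trans[OF bij_betw_trans[OF e shift[of r]] g]
    by (simp add: \<rho>_def[abs_def] comp_def)
  have "(\<Sum>r\<in>{0..<n}. \<Sum>i\<in>I. h i (\<rho> r i)) = (\<Sum>i\<in>I. \<Sum>r\<in>{0..<n}. h i (\<rho> r i))"
    by (rule sum.swap)
  also have "\<dots> = (\<Sum>i\<in>I. \<Sum>j\<in>J. h i j)"
  proof (rule sum.cong[OF refl])
    fix i
    have "(\<Sum>r\<in>{0..<n}. h i (\<rho> r i)) = (\<Sum>r\<in>{0..<n}. h i (g ((r + e i) mod n)))"
      by (simp add: \<rho>_def add.commute)
    also have "\<dots> = (\<Sum>r\<in>{0..<n}. h i (g r))"
      by (rule sum.reindex_bij_betw[OF shift])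
    also have "\<dots> = (\<Sum>j\<in>J. h i j)"
      by (rule sum.reindex_bij_betw[OF g])
    finally show "(\<Sum>r\<in>{0..<n}. h i (\<rho> r i)) = (\<Sum>j\<in>J. h i j)" .
  qed
  finally have tot: "(\<Sum>r\<in>{0..<n}. \<Sum>i\<in>I. h i (\<rho> r i)) = (\<Sum>i\<in>I. \<Sum>j\<in>J. h i j)" .
  obtain r where "real n * (\<Sum>i\<in>I. h i (\<rho> r i)) \<le> (\<Sum>i\<in>I. \<Sum>j\<in>J. h i j)"
    using exists_le_average[of "{0..<n}" "\<lambda>r. \<Sum>i\<in>I. h i (\<rho> r i)"] n tot by auto
  then show ?thesis using \<rho> n_def by blast
qed

definition loops :: "('i \<Rightarrow> 'v) \<Rightarrow> ('j \<Rightarrow> 'v) \<Rightarrow> 'i set \<Rightarrow> ('i \<Rightarrow> 'j) \<Rightarrow> 'i set" where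
  "loops src dst I \<sigma> = {i\<in>I. src i = dst (\<sigma> i)}"

context
  fixes src :: "'i \<Rightarrow> 'v" and dst :: "'j \<Rightarrow> 'v" and h :: "'i \<Rightarrow> 'j \<Rightarrow> real"
  fixes I :: "'i set" and J :: "'j set"
  assumes finI: "finite I"
begin

text \<open>The local move behind both pairing lemmas below: exchanging the partners of a loop
  \<open>i\<close> and of some \<open>i'\<close> destroys the loop and, by the two inequalities,
  creates none.\<close>

lemma swap_bij:
  assumes \<sigma>: "bij_betw \<sigma> I J" and i: "i \<in> I" "i' \<in> I" "i \<noteq> i'"
    and nl: "src i \<noteq> dst (\<sigma> i')" "src i' \<noteq> dst (\<sigma> i)" and loop: "src i = dst (\<sigma> i)"
  defines "\<sigma>' \<equiv> \<sigma>(i := \<sigma> i', i' := \<sigma> i)"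
  shows "bij_betw \<sigma>' I J" "card (loops src dst I \<sigma>') < card (loops src dst I \<sigma>)"
    "(\<Sum>l\<in>I. h l (\<sigma>' l)) = (\<Sum>l\<in>I. h l (\<sigma> l)) - h i (\<sigma> i) - h i' (\<sigma> i') + h i (\<sigma> i') + h i' (\<sigma> i)"
proof -
  have inj: "inj_on \<sigma> I" and im: "\<sigma> ` I = J" using \<sigma> by (auto simp: bij_betw_def)
  have "inj_on \<sigma>' I" using inj i unfolding inj_on_def \<sigma>'_def by (auto simp: fun_upd_def)
  moreover have "\<sigma>' ` I = J"
  proof
    show "\<sigma>' ` I \<subseteq> J" using im i by (auto simp: \<sigma>'_def)
    show "J \<subseteq> \<sigma>' ` I"
    proof
      fix j assume "j \<in> J"
      then obtain l where l: "l \<in> I" "j = \<sigma> l" using im by auto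
      have "j = \<sigma>' (if l = i then i' else if l = i' then i else l)" using l i by (auto simp: \<sigma>'_def)
      then show "j \<in> \<sigma>' ` I" using l i by auto
    qed
  qed
  ultimately show "bij_betw \<sigma>' I J" by (simp add: bij_betw_def)
  have "loops src dst I \<sigma>' \<subset> loops src dst I \<sigma>"
    using i nl loop unfolding loops_def \<sigma>'_def by (auto split: if_splits)
  then show "card (loops src dst I \<sigma>') < card (loops src dst I \<sigma>)"
    using finI by (intro psubset_card_mono) (auto simp: loops_def)
  have split: "(\<Sum>l\<in>I. F l) = F i + F i' + (\<Sum>l\<in>I - {i, i'}. F l)" for F :: "'i \<Rightarrow> real"
    using sum.subset_diff[of "{i, i'}" I F] finI i by simp
  have "(\<Sum>l\<in>I - {i, i'}. h l (\<sigma>' l)) = (\<Sum>l\<in>I - {i, i'}. h l (\<sigma> l))"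
    by (rule sum.cong) (auto simp: \<sigma>'_def)
  moreover have "\<sigma>' i = \<sigma> i'" "\<sigma>' i' = \<sigma> i" using i by (auto simp: \<sigma>'_def)
  ultimately show "(\<Sum>l\<in>I. h l (\<sigma>' l)) = (\<Sum>l\<in>I. h l (\<sigma> l)) - h i (\<sigma> i) - h i' (\<sigma> i') + h i (\<sigma> i') + h i' (\<sigma> i)"
    using split[of "\<lambda>l. h l (\<sigma>' l)"] split[of "\<lambda>l. h l (\<sigma> l)"] by simp
qed

lemma exists_min_loops:
  assumes "bij_betw \<sigma>\<^sub>0 I J"
  obtains \<sigma> where "bij_betw \<sigma> I J" "(\<Sum>l\<in>I. h l (\<sigma> l)) \<le> (\<Sum>l\<in>I. h l (\<sigma>\<^sub>0 l))"
    "\<And>\<tau>. bij_betw \<tau> I J \<Longrightarrow> (\<Sum>l\<in>I. h l (\<tau> l)) \<le> (\<Sum>l\<in>I. h l (\<sigma>\<^sub>0 l)) \<Longrightarrow> card (loops src dst I \<sigma>) \<le> card (loops src dst I \<tau>)"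
  using ex_has_least_nat[of "\<lambda>\<sigma>. bij_betw \<sigma> I J \<and> (\<Sum>l\<in>I. h l (\<sigma> l)) \<le> (\<Sum>l\<in>I. h l (\<sigma>\<^sub>0 l))"
      \<sigma>\<^sub>0 "\<lambda>\<sigma>. card (loops src dst I \<sigma>)"] assms that by auto

text \<open>Two loops at different vertices could exchange partners and become two non-loops, at no
  higher cost since \<open>M\<close> separates the two kinds of cost. So a pairing with fewest loops
  has them all at one vertex.\<close>

lemma loops_at_one_vertex:
  assumes \<sigma>\<^sub>0: "bij_betw \<sigma>\<^sub>0 I J"
    and le: "\<And>i j. i \<in> I \<Longrightarrow> j \<in> J \<Longrightarrow> src i \<noteq> dst j \<Longrightarrow> h i j \<le> M"
    and ge: "\<And>i j. i \<in> I \<Longrightarrow> j \<in> J \<Longrightarrow> src i = dst j \<Longrightarrow> M \<le> h i j"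
  shows "\<exists>\<sigma>. bij_betw \<sigma> I J \<and> (\<Sum>l\<in>I. h l (\<sigma> l)) \<le> (\<Sum>l\<in>I. h l (\<sigma>\<^sub>0 l)) \<and>
    (\<forall>i\<in>loops src dst I \<sigma>. \<forall>i'\<in>loops src dst I \<sigma>. src i = src i')"
proof -
  obtain \<sigma> where \<sigma>: "bij_betw \<sigma> I J" "(\<Sum>l\<in>I. h l (\<sigma> l)) \<le> (\<Sum>l\<in>I. h l (\<sigma>\<^sub>0 l))"
    and min: "\<And>\<tau>. bij_betw \<tau> I J \<Longrightarrow> (\<Sum>l\<in>I. h l (\<tau> l)) \<le> (\<Sum>l\<in>I. h l (\<sigma>\<^sub>0 l)) \<Longrightarrow> card (loops src dst I \<sigma>) \<le> card (loops src dst I \<tau>)"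
    using exists_min_loops[OF \<sigma>\<^sub>0] by metis
  have "src i = src i'" if "i \<in> loops src dst I \<sigma>" "i' \<in> loops src dst I \<sigma>" for i i'
  proof (rule ccontr)
    assume ne: "src i \<noteq> src i'"
    have i: "i \<in> I" "i' \<in> I" "i \<noteq> i'" "src i = dst (\<sigma> i)" "src i' = dst (\<sigma> i')"
      using that ne by (auto simp: loops_def)
    have J: "\<sigma> i \<in> J" "\<sigma> i' \<in> J" using \<sigma>(1) i by (auto simp: bij_betw_def)
    have nl: "src i \<noteq> dst (\<sigma> i')" "src i' \<noteq> dst (\<sigma> i)" using i ne by auto
    note sw = swap_bij[OF \<sigma>(1) i(1-3) nl i(4)]
    have "h i (\<sigma> i') \<le> M" "h i' (\<sigma> i) \<le> M" "M \<le> h i (\<sigma> i)" "M \<le> h i' (\<sigma> i')"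
      using le ge i J nl by auto
    then have "card (loops src dst I \<sigma>) \<le> card (loops src dst I (\<sigma>(i := \<sigma> i', i' := \<sigma> i)))"
      using sw(3) \<sigma>(2) by (intro min sw(1)) linarith
    with sw(2) show False by linarith
  qed
  with \<sigma> show ?thesis by blast
qed

text \<open>At a price of \<open>2 * M\<close> a single loop pays for both joins that a swap
  creates, whatever the swapped partner costs. The assumption \<open>few\<close> supplies an index
  that avoids the loop vertex on both sides.\<close>

lemma loop_free_pairing:
  assumes \<sigma>\<^sub>0: "bij_betw \<sigma>\<^sub>0 I J" and finJ: "finite J"
    and bd: "\<And>i j. i \<in> I \<Longrightarrow> j \<in> J \<Longrightarrow> src i \<noteq> dst j \<Longrightarrow> h i j \<le> M"
    and nn: "\<And>i j. i \<in> I \<Longrightarrow> j \<in> J \<Longrightarrow> 0 \<le> h i j"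
    and ge: "\<And>i j. i \<in> I \<Longrightarrow> j \<in> J \<Longrightarrow> src i = dst j \<Longrightarrow> 2 * M \<le> h i j"
    and few: "\<And>a. card {i\<in>I. src i = a} + card {j\<in>J. dst j = a} \<le> card I"
  shows "\<exists>\<sigma>. bij_betw \<sigma> I J \<and> (\<Sum>l\<in>I. h l (\<sigma> l)) \<le> (\<Sum>l\<in>I. h l (\<sigma>\<^sub>0 l)) \<and> loops src dst I \<sigma> = {}"
proof -
  obtain \<sigma> where \<sigma>: "bij_betw \<sigma> I J" "(\<Sum>l\<in>I. h l (\<sigma> l)) \<le> (\<Sum>l\<in>I. h l (\<sigma>\<^sub>0 l))"
    and min: "\<And>\<tau>. bij_betw \<tau> I J \<Longrightarrow> (\<Sum>l\<in>I. h l (\<tau> l)) \<le> (\<Sum>l\<in>I. h l (\<sigma>\<^sub>0 l)) \<Longrightarrow> card (loops src dst I \<sigma>) \<le> card (loops src dst I \<tau>)"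
    using exists_min_loops[OF \<sigma>\<^sub>0] by metis
  have "loops src dst I \<sigma> = {}"
  proof (rule ccontr)
    assume "loops src dst I \<sigma> \<noteq> {}"
    then obtain i where i: "i \<in> I" "src i = dst (\<sigma> i)" by (auto simp: loops_def)
    define a where "a = src i"
    let ?A = "{l\<in>I. src l = a}" and ?B = "{l\<in>I. dst (\<sigma> l) = a}"
    have "bij_betw \<sigma> ?B {j\<in>J. dst j = a}"
      using \<sigma>(1) by (auto simp: bij_betw_def inj_on_def)
    then have "card ?B = card {j\<in>J. dst j = a}" by (rule bij_betw_same_card)
    then have "card ?A + card ?B \<le> card I" using few[of a] by simp
    \<comment> \<open>The loop itself lies in both sets, so the union misses an index even if
      \<open>few\<close> is an equality.\<close>
    moreover have "i \<in> ?A \<inter> ?B" using i by (simp add: a_def)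
    then have "card (?A \<inter> ?B) > 0" using finI by (auto simp: card_gt_0_iff)
    moreover have "card (?A \<union> ?B) + card (?A \<inter> ?B) = card ?A + card ?B"
      using finI card_Un_Int[of ?A ?B] by simp
    ultimately have "card (?A \<union> ?B) < card I" by linarith
    then have "?A \<union> ?B \<noteq> I" by auto
    then obtain i' where i': "i' \<in> I" "src i' \<noteq> a" "dst (\<sigma> i') \<noteq> a" by auto
    have nl: "src i \<noteq> dst (\<sigma> i')" "src i' \<noteq> dst (\<sigma> i)" "i \<noteq> i'" using i i' by (auto simp: a_def)
    have J: "\<sigma> i \<in> J" "\<sigma> i' \<in> J" using \<sigma>(1) i i' by (auto simp: bij_betw_def)
    note sw = swap_bij[OF \<sigma>(1) i(1) i'(1) nl(3) nl(1,2) i(2)]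
    have "h i (\<sigma> i') \<le> M" "h i' (\<sigma> i) \<le> M" "2 * M \<le> h i (\<sigma> i)" "0 \<le> h i' (\<sigma> i')"
      using bd nn ge i i' J nl by auto
    then have "card (loops src dst I \<sigma>) \<le> card (loops src dst I (\<sigma>(i := \<sigma> i', i' := \<sigma> i)))"
      using sw(3) \<sigma>(2) by (intro min sw(1)) linarith
    with sw(2) show False by linarith
  qed
  with \<sigma> show ?thesis by blast
qed

end

section \<open>Codegrees in locally sparse relations\<close>

lemma sum_card_swap:
  assumes "finite A" "finite B"
  shows "(\<Sum>x\<in>A. card {y\<in>B. R x y}) = (\<Sum>y\<in>B. card {x\<in>A. R x y})"
proof -
  have "(\<Sum>x\<in>A. card {y\<in>B. R x y}) = (\<Sum>x\<in>A. \<Sum>y\<in>B. if R x y then 1 else 0)"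
    using assms by (simp add: sum.If_cases Int_def)
  also have "\<dots> = (\<Sum>y\<in>B. \<Sum>x\<in>A. if R x y then 1 else 0)"
    by (rule sum.swap)
  also have "\<dots> = (\<Sum>y\<in>B. card {x\<in>A. R x y})"
    using assms by (simp add: sum.If_cases Int_def)
  finally show ?thesis .
qed

lemma sum_card_fibers:
  assumes "finite A" "finite B"
  shows "(\<Sum>x\<in>A. card {y\<in>B. f y = x}) = card {y\<in>B. f y \<in> A}"
proof -
  have "(\<Sum>x\<in>A. card {y\<in>B. f y = x}) = (\<Sum>y\<in>B. card {x\<in>A. f y = x})"
    by (rule sum_card_swap[OF assms])
  also have "\<dots> = (\<Sum>y\<in>B. if f y \<in> A then 1 else 0)"
  proof (rule sum.cong[OF refl])
    fix y
    have "{x\<in>A. f y = x} = (if f y \<in> A then {f y} else {})" by auto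
    then show "card {x\<in>A. f y = x} = (if f y \<in> A then 1 else 0)" by simp
  qed
  also have "\<dots> = card {y\<in>B. f y \<in> A}"
    using assms by (simp add: sum.If_cases Int_def)
  finally show ?thesis .
qed

definition common_out :: "('a \<times> 'a) set \<Rightarrow> 'a \<Rightarrow> 'a \<Rightarrow> nat" where
  "common_out E a b = card (E `` {a} \<inter> E `` {b})"

definition codegree :: "('a \<times> 'a) set \<Rightarrow> 'a \<Rightarrow> 'a \<Rightarrow> nat" where
  "codegree E a b = common_out E a b + common_out (E\<inverse>) a b"

definition half_bump :: "('l \<Rightarrow> 'a) \<Rightarrow> ('l \<Rightarrow> 'a) \<Rightarrow> ('a \<times> 'a) set \<Rightarrow> 'l set \<Rightarrow> 'a \<Rightarrow> 'a \<Rightarrow> nat" where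
  "half_bump s t E P a b = card {q\<in>P. s q = b \<and> (a, t q) \<in> E} + card {q\<in>P. t q = b \<and> (a, s q) \<in> E}"

text \<open>
  The bump of a pair bounds by how much the codegrees of the pairs in \<^term>\<open>P\<close> grow, in total,
  when the pair is inserted into the relation.
\<close>

definition bump :: "('l \<Rightarrow> 'a) \<Rightarrow> ('l \<Rightarrow> 'a) \<Rightarrow> ('a \<times> 'a) set \<Rightarrow> 'l set \<Rightarrow> 'a \<Rightarrow> 'a \<Rightarrow> nat" where
  "bump s t E P a b = half_bump s t E P a b + half_bump s t (E\<inverse>) P b a"

lemma finite_Image_finite: "finite E \<Longrightarrow> finite (E `` {a})"
  by (rule finite_subset[of _ "snd ` E"]) force+

text \<open>A new common out-neighbour is the head of an inserted pair that leaves \<open>a\<close>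
  or \<open>b\<close>, and in the enlarged relation the other vertex reaches it too.\<close>

lemma common_out_insert_le:
  fixes s t :: "'l \<Rightarrow> 'a"
  assumes "finite E" "finite F"
  defines "E' \<equiv> E \<union> (\<lambda>e. (s e, t e)) ` F"
  shows "common_out E' a b \<le> common_out E a b + card {e\<in>F. a = s e \<and> (b, t e) \<in> E'} + card {e\<in>F. b = s e \<and> (a, t e) \<in> E'}"
proof -
  let ?X = "{e\<in>F. a = s e \<and> (b, t e) \<in> E'}" and ?Y = "{e\<in>F. b = s e \<and> (a, t e) \<in> E'}"
  have fin: "finite (E `` {a} \<inter> E `` {b})" using finite_Image_finite[OF assms(1)] by blast
  have "E' `` {a} \<inter> E' `` {b} \<subseteq> (E `` {a} \<inter> E `` {b}) \<union> t ` ?X \<union> t ` ?Y"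
    unfolding E'_def by auto
  then have "card (E' `` {a} \<inter> E' `` {b}) \<le> card ((E `` {a} \<inter> E `` {b}) \<union> t ` ?X \<union> t ` ?Y)"
    using assms(2) fin by (intro card_mono) auto
  also have "\<dots> \<le> card (E `` {a} \<inter> E `` {b}) + card (t ` ?X) + card (t ` ?Y)"
    by (meson card_Un_le add_le_mono le_refl order_trans)
  also have "\<dots> \<le> card (E `` {a} \<inter> E `` {b}) + card ?X + card ?Y"
    using assms(2) by (intro add_mono card_image_le) auto
  finally show ?thesis by (simp add: common_out_def)
qed

text \<open>Double counting: each new common neighbour is charged to an inserted pair, and the four
  ways of sharing an end with it make up \<open>bump\<close>. The bump is taken in \<open>E'\<close>
  because two inserted pairs may create a common neighbour together.\<close>

lemma sum_codegree_insert_le: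
  fixes s t :: "'l \<Rightarrow> 'a"
  assumes "finite E" "finite F" "finite P"
  defines "E' \<equiv> E \<union> (\<lambda>e. (s e, t e)) ` F"
  shows "(\<Sum>q\<in>P. codegree E' (s q) (t q)) \<le> (\<Sum>q\<in>P. codegree E (s q) (t q)) + (\<Sum>e\<in>F. bump s t E' P (s e) (t e))"
proof -
  have conv: "E'\<inverse> = E\<inverse> \<union> (\<lambda>e. (t e, s e)) ` F" unfolding E'_def by auto
  let ?A = "\<lambda>q. {e\<in>F. s q = s e \<and> (t q, t e) \<in> E'}"
  let ?B = "\<lambda>q. {e\<in>F. t q = s e \<and> (s q, t e) \<in> E'}"
  let ?C = "\<lambda>q. {e\<in>F. s q = t e \<and> (s e, t q) \<in> E'}"
  let ?D = "\<lambda>q. {e\<in>F. t q = t e \<and> (s e, s q) \<in> E'}"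
  have one: "codegree E' (s q) (t q) \<le> codegree E (s q) (t q) + (card (?A q) + card (?B q) + card (?C q) + card (?D q))" for q
    using common_out_insert_le[OF assms(1,2), of s t "s q" "t q"]
      common_out_insert_le[of "E\<inverse>" F t s "s q" "t q"] assms(1,2)
    unfolding codegree_def E'_def[symmetric] conv[symmetric] by simp
  have "(\<Sum>q\<in>P. codegree E' (s q) (t q)) \<le>
    (\<Sum>q\<in>P. codegree E (s q) (t q) + (card (?A q) + card (?B q) + card (?C q) + card (?D q)))"
    by (rule sum_mono) (rule one)
  also have "\<dots> = (\<Sum>q\<in>P. codegree E (s q) (t q)) +
      (\<Sum>e\<in>F. card {q\<in>P. s q = s e \<and> (t q, t e) \<in> E'} + card {q\<in>P. t q = s e \<and> (s q, t e) \<in> E'}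
        + card {q\<in>P. s q = t e \<and> (s e, t q) \<in> E'} + card {q\<in>P. t q = t e \<and> (s e, s q) \<in> E'})"
    unfolding sum.distrib
    using sum_card_swap[OF assms(3,2), of "\<lambda>q e. s q = s e \<and> (t q, t e) \<in> E'"]
      sum_card_swap[OF assms(3,2), of "\<lambda>q e. t q = s e \<and> (s q, t e) \<in> E'"]
      sum_card_swap[OF assms(3,2), of "\<lambda>q e. s q = t e \<and> (s e, t q) \<in> E'"]
      sum_card_swap[OF assms(3,2), of "\<lambda>q e. t q = t e \<and> (s e, s q) \<in> E'"] by simp
  also have "\<dots> = (\<Sum>q\<in>P. codegree E (s q) (t q)) + (\<Sum>e\<in>F. bump s t E' P (s e) (t e))"
    by (intro arg_cong2[where f = "(+)", OF refl] sum.cong refl)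
      (simp add: bump_def half_bump_def add_ac)
  finally show ?thesis .
qed

locale sparse_rel =
  fixes E :: "('a \<times> 'a) set" and k d :: nat
  assumes d: "d = 100 * k" and k: "k > 0"
    and finite_E: "finite E"
    and out_le: "card (E `` {a}) \<le> d" and in_le: "card (E\<inverse> `` {a}) \<le> d"
    and sparse: "\<And>S. finite S \<Longrightarrow> card S \<le> 200 * k \<Longrightarrow> real (card (E \<inter> S \<times> S)) \<le> (real k)\<^sup>2 / 2"
begin

lemma sparse_converse: "sparse_rel (E\<inverse>) k d"
proof
  fix S :: "'a set" assume S: "finite S" "card S \<le> 200 * k"
  have "E\<inverse> \<inter> S \<times> S = (E \<inter> S \<times> S)\<inverse>" by auto
  then show "real (card (E\<inverse> \<inter> S \<times> S)) \<le> (real k)\<^sup>2 / 2"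
    using sparse[OF S] by simp
qed (use d k finite_E out_le in_le in auto)

text \<open>The reason for the bound \<open>200 * k\<close>, that is \<open>2 * d\<close>, in the
  sparsity assumption: it covers two neighbourhoods at once.\<close>

lemma sparse_bip:
  assumes "finite A" "finite B" "card A \<le> d" "card B \<le> d"
  shows "real (card (E \<inter> A \<times> B)) \<le> (real k)\<^sup>2 / 2"
proof -
  have "card (A \<union> B) \<le> 200 * k" using card_Un_le[of A B] assms d by simp
  then have "real (card (E \<inter> (A \<union> B) \<times> (A \<union> B))) \<le> (real k)\<^sup>2 / 2" using sparse assms by simp
  moreover have "card (E \<inter> A \<times> B) \<le> card (E \<inter> (A \<union> B) \<times> (A \<union> B))"
    using finite_E by (intro card_mono) auto
  ultimately show ?thesis by linarith
qed

lemma card_rel_eq_sum: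
  assumes "finite A" "finite B"
  shows "card (E \<inter> A \<times> B) = (\<Sum>b\<in>B. card (E\<inverse> `` {b} \<inter> A))"
proof -
  have "E \<inter> A \<times> B = prod.swap ` (SIGMA b:B. E\<inverse> `` {b} \<inter> A)" by force
  then have "card (E \<inter> A \<times> B) = card (SIGMA b:B. E\<inverse> `` {b} \<inter> A)"
    by (simp add: card_image)
  then show ?thesis using assms by simp
qed

text \<open>The sum counts the pairs from \<open>B\<close> into the out-neighbourhood of
  \<open>a\<close>, two sets of at most \<open>d\<close> elements.\<close>

lemma sum_common_out_le:
  assumes "finite B" "card B \<le> d"
  shows "real (\<Sum>b\<in>B. common_out E a b) \<le> (real k)\<^sup>2 / 2"
proof -
  have "E \<inter> B \<times> E `` {a} = (SIGMA b:B. E `` {a} \<inter> E `` {b})" by auto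
  then have "card (E \<inter> B \<times> E `` {a}) = (\<Sum>b\<in>B. common_out E a b)"
    using assms finite_Image_finite[OF finite_E] by (simp add: common_out_def)
  then show ?thesis
    using sparse_bip[of B "E `` {a}"] assms out_le finite_Image_finite[OF finite_E] by simp
qed

lemma sum_codegree_le:
  assumes "finite B" "card B \<le> d"
  shows "real (\<Sum>b\<in>B. codegree E a b) \<le> (real k)\<^sup>2"
  using sum_common_out_le[OF assms, of a] sparse_rel.sum_common_out_le[OF sparse_converse assms, of a]
  by (simp add: codegree_def sum.distrib)

lemma codegree_le: "codegree E a b \<le> 2 * d"
proof -
  have "common_out E a b \<le> card (E `` {a})" "common_out (E\<inverse>) a b \<le> card (E\<inverse> `` {a})"
    unfolding common_out_def using finite_E by (auto intro!: card_mono finite_Image_finite)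
  then show ?thesis using out_le[of a] in_le[of a] by (simp add: codegree_def)
qed

text \<open>Each heavy element receives at least \<open>k\<close> pairs from \<open>A\<close>,
  whereas \<open>A\<close> and any \<open>d\<close> elements span at most
  \<open>k^2 / 2\<close>.\<close>

lemma card_heavy:
  assumes "finite A" "card A \<le> d"
  shows "finite {z. k \<le> card (E\<inverse> `` {z} \<inter> A)}" "2 * card {z. k \<le> card (E\<inverse> `` {z} \<inter> A)} \<le> k"
proof -
  let ?Z = "{z. k \<le> card (E\<inverse> `` {z} \<inter> A)}"
  have "z \<in> snd ` E" if "z \<in> ?Z" for z
  proof -
    have "card (E\<inverse> `` {z} \<inter> A) \<noteq> 0" using that k by auto
    then have "E\<inverse> `` {z} \<noteq> {}" by auto
    then show ?thesis by force
  qed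
  then show fin: "finite ?Z" using finite_E by (meson finite_imageI finite_subset subsetI)
  have sub: "2 * card Z \<le> k" if Z: "Z \<subseteq> ?Z" "card Z \<le> d" for Z
  proof -
    have fZ: "finite Z" using Z fin finite_subset by auto
    have "card Z * k \<le> (\<Sum>b\<in>Z. card (E\<inverse> `` {b} \<inter> A))"
      using sum_bounded_below[of Z k "\<lambda>b. card (E\<inverse> `` {b} \<inter> A)"] Z by auto
    also have "\<dots> = card (E \<inter> A \<times> Z)" using card_rel_eq_sum[OF assms(1) fZ] by simp
    finally have "real (card Z * k) \<le> real (card (E \<inter> A \<times> Z))" by (simp only: of_nat_le_iff)
    also have "\<dots> \<le> (real k)\<^sup>2 / 2" using sparse_bip[OF assms(1) fZ assms(2) Z(2)] .
    finally have "real k * (2 * real (card Z)) \<le> real k * real k"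
      by (simp add: power2_eq_square field_simps)
    then have "2 * real (card Z) \<le> real k" using k by simp
    then show ?thesis by linarith
  qed
  show "2 * card ?Z \<le> k"
  proof (cases "card ?Z \<le> d")
    case True then show ?thesis using sub by blast
  next
    case False
    \<comment> \<open>Already \<open>d\<close> heavy elements would be too many, so the size
      restriction of the sparsity bound does no harm.\<close>
    then obtain Z where "Z \<subseteq> ?Z" "card Z = d" by (meson nle_le obtain_subset_with_card_n)
    then show ?thesis using sub[of Z] d k by auto
  qed
qed

text \<open>Grouped by \<open>q\<close>, the sum counts in-neighbours of \<open>t q\<close> in
  \<open>A\<close>: fewer than \<open>k\<close>, unless \<open>t q\<close> is heavy, in which case
  \<open>T\<close> is the only bound.\<close>

lemma sum_stub_le:
  assumes A: "finite A" "card A \<le> T" and B: "finite B" "card B \<le> T" and T: "T \<le> d" and P: "finite P"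
  defines "Z \<equiv> {z. k \<le> card (E\<inverse> `` {z} \<inter> A)}"
  shows "(\<Sum>a\<in>A. \<Sum>b\<in>B. card {q\<in>P. s q = b \<and> (a, t q) \<in> E})
    \<le> k * card {q\<in>P. s q \<in> B} + T * card {q\<in>P. t q \<in> Z}"
proof -
  let ?B = "{q\<in>P. s q \<in> B}"
  have "(\<Sum>b\<in>B. card {q\<in>P. s q = b \<and> (a, t q) \<in> E}) = card {q\<in>?B. (a, t q) \<in> E}" for a
    using sum_card_fibers[of B "{q\<in>P. (a, t q) \<in> E}" s] B P
    by (simp add: conj_ac)
  then have "(\<Sum>a\<in>A. \<Sum>b\<in>B. card {q\<in>P. s q = b \<and> (a, t q) \<in> E}) = (\<Sum>a\<in>A. card {q\<in>?B. (a, t q) \<in> E})"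
    by simp
  also have "\<dots> = (\<Sum>q\<in>?B. card {a\<in>A. (a, t q) \<in> E})"
    using A P by (intro sum_card_swap) auto
  also have "\<dots> \<le> (\<Sum>q\<in>?B. k + (if t q \<in> Z then T else 0))"
  proof (rule sum_mono)
    fix q
    have eq: "{a\<in>A. (a, t q) \<in> E} = E\<inverse> `` {t q} \<inter> A" by auto
    have "card {a\<in>A. (a, t q) \<in> E} \<le> card A" using A by (intro card_mono) auto
    then show "card {a\<in>A. (a, t q) \<in> E} \<le> k + (if t q \<in> Z then T else 0)"
      using A(2) unfolding eq Z_def by auto
  qed
  also have "\<dots> = k * card ?B + T * card {q\<in>?B. t q \<in> Z}"
    using P by (simp add: sum.distrib sum.If_cases Int_def)
  also have "\<dots> \<le> k * card ?B + T * card {q\<in>P. t q \<in> Z}"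
    using P by (intro add_mono mult_le_mono card_mono) auto
  finally show ?thesis .
qed

text \<open>The stubs at \<open>B\<close> contribute \<open>k * xm * T\<close>. There are at most
  \<open>k / 2\<close> heavy elements, so the stubs there contribute at most half as much.\<close>

lemma sum_half_bump_le:
  assumes A: "finite A" "card A \<le> T" and B: "finite B" "card B \<le> T" and T: "T \<le> d" and P: "finite P"
    and xm: "\<And>a. card {q\<in>P. s q = a} + card {q\<in>P. t q = a} \<le> xm"
  shows "2 * (\<Sum>a\<in>A. \<Sum>b\<in>B. half_bump s t E P a b) \<le> 3 * k * xm * T"
proof -
  define Z where "Z = {z. k \<le> card (E\<inverse> `` {z} \<inter> A)}"
  have Z: "finite Z" "2 * card Z \<le> k" using card_heavy[of A] A T unfolding Z_def by auto
  have stubs: "card {q\<in>P. s q \<in> S} + card {q\<in>P. t q \<in> S} \<le> xm * card S" if "finite S" for S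
  proof -
    have "card {q\<in>P. s q \<in> S} + card {q\<in>P. t q \<in> S} = (\<Sum>a\<in>S. card {q\<in>P. s q = a} + card {q\<in>P. t q = a})"
      using sum_card_fibers[OF that P, of s] sum_card_fibers[OF that P, of t] by (simp add: sum.distrib)
    also have "\<dots> \<le> (\<Sum>a\<in>S. xm)" by (intro sum_mono xm)
    finally show ?thesis by (simp add: mult.commute)
  qed
  have "(\<Sum>a\<in>A. \<Sum>b\<in>B. half_bump s t E P a b) \<le>
      k * (card {q\<in>P. s q \<in> B} + card {q\<in>P. t q \<in> B}) + T * (card {q\<in>P. s q \<in> Z} + card {q\<in>P. t q \<in> Z})"
    unfolding half_bump_def sum.distrib
    using sum_stub_le[OF A B T P, of s t] sum_stub_le[OF A B T P, of t s] unfolding Z_def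
    by (simp add: algebra_simps)
  also have "\<dots> \<le> k * (xm * T) + T * (xm * card Z)"
    using stubs[OF B(1)] stubs[OF Z(1)] B(2)
    by (intro add_mono mult_le_mono order_refl) (auto intro: order_trans)
  finally have "2 * (\<Sum>a\<in>A. \<Sum>b\<in>B. half_bump s t E P a b) \<le> 2 * (k * (xm * T)) + T * xm * (2 * card Z)"
    by simp
  also have "\<dots> \<le> 2 * (k * (xm * T)) + T * xm * k"
    using Z(2) by (intro add_mono mult_le_mono order_refl)
  finally show ?thesis by (simp add: algebra_simps)
qed

lemma sum_bump_le:
  assumes A: "finite A" "card A \<le> T" and B: "finite B" "card B \<le> T" and T: "T \<le> d" and P: "finite P"
    and xm: "\<And>a. card {q\<in>P. s q = a} + card {q\<in>P. t q = a} \<le> xm"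
  shows "(\<Sum>a\<in>A. \<Sum>b\<in>B. bump s t E P a b) \<le> 3 * k * xm * T"
proof -
  interpret C: sparse_rel "E\<inverse>" k d by (rule sparse_converse)
  have "(\<Sum>a\<in>A. \<Sum>b\<in>B. half_bump s t (E\<inverse>) P b a) = (\<Sum>b\<in>B. \<Sum>a\<in>A. half_bump s t (E\<inverse>) P b a)"
    by (rule sum.swap)
  then show ?thesis
    using sum_half_bump_le[OF A B T P xm] C.sum_half_bump_le[OF B A T P xm]
    unfolding bump_def sum.distrib by linarith
qed

end

section \<open>Link families and splicing at a vertex\<close>

definition codegree_via :: "('a \<times> 'a) set \<Rightarrow> 'a \<Rightarrow> 'a \<Rightarrow> 'a \<Rightarrow> nat" where
  "codegree_via E v a b = of_bool ((a, v) \<in> E \<and> (b, v) \<in> E) + of_bool ((v, a) \<in> E \<and> (v, b) \<in> E)"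

lemma common_out_delete:
  assumes "finite E" "a \<noteq> v" "b \<noteq> v" and E1: "E1 = {p\<in>E. fst p \<noteq> v \<and> snd p \<noteq> v}"
  shows "common_out E a b = common_out E1 a b + of_bool ((a, v) \<in> E \<and> (b, v) \<in> E)"
proof -
  have "E1 `` {a} \<inter> E1 `` {b} = (E `` {a} \<inter> E `` {b}) - {v}" using assms(2,3) unfolding E1 by auto
  moreover have "v \<in> E `` {a} \<inter> E `` {b} \<longleftrightarrow> (a, v) \<in> E \<and> (b, v) \<in> E" by auto
  moreover have "finite (E `` {a} \<inter> E `` {b})" using finite_Image_finite[OF assms(1), of a] by simp
  ultimately show ?thesis unfolding common_out_def using card.remove[of "E `` {a} \<inter> E `` {b}" v]
    by (cases "v \<in> E `` {a} \<inter> E `` {b}") simp_all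
qed

lemma codegree_delete:
  assumes "finite E" "a \<noteq> v" "b \<noteq> v" and E1: "E1 = {p\<in>E. fst p \<noteq> v \<and> snd p \<noteq> v}"
  shows "codegree E a b = codegree E1 a b + codegree_via E v a b"
proof -
  have "E1\<inverse> = {p\<in>E\<inverse>. fst p \<noteq> v \<and> snd p \<noteq> v}" using E1 by auto
  from common_out_delete[OF _ assms(2,3) this] show ?thesis
    using common_out_delete[OF assms] assms(1) by (simp add: codegree_def codegree_via_def)
qed

lemma codegree_mono: "finite E \<Longrightarrow> E1 \<subseteq> E \<Longrightarrow> codegree E1 a b \<le> codegree E a b"
  unfolding codegree_def common_out_def using finite_Image_finite[of E a] finite_Image_finite[of "E\<inverse>" a]
  by (intro add_mono card_mono) auto

text \<open>
  \<^term>\<open>Adm\<close> abstracts from families of pairwise arc-disjoint walks in the digraph; the last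
  assumption says that the digraph does not immerse a small dense simple digraph.
\<close>

locale links =
  fixes src dst :: "'l \<Rightarrow> 'a" and Adm :: "'l set \<Rightarrow> bool" and k d :: nat
  assumes d: "d = 100 * k" and k: "k > 0"
    and Adm_finite: "Adm Q \<Longrightarrow> finite Q"
    and Adm_mono: "Adm Q \<Longrightarrow> Q' \<subseteq> Q \<Longrightarrow> Adm Q'"
    and Adm_splice: "Adm Q \<Longrightarrow> I \<subseteq> Q \<Longrightarrow> J \<subseteq> Q \<Longrightarrow> I \<inter> J = {} \<Longrightarrow> bij_betw \<sigma> I J \<Longrightarrow>
      (\<And>i. i \<in> I \<Longrightarrow> dst i = src (\<sigma> i)) \<Longrightarrow>
      \<exists>f. inj_on f I \<and> f ` I \<inter> (Q - I - J) = {} \<and> Adm ((Q - I - J) \<union> f ` I) \<and>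
        (\<forall>i\<in>I. src (f i) = src i \<and> dst (f i) = dst (\<sigma> i))"
    and Adm_sparse: "Adm Q \<Longrightarrow> inj_on (\<lambda>q. (src q, dst q)) Q \<Longrightarrow> (\<And>q. q \<in> Q \<Longrightarrow> src q \<noteq> dst q) \<Longrightarrow>
      finite S \<Longrightarrow> card S \<le> 200 * k \<Longrightarrow>
      real (card ((\<lambda>q. (src q, dst q)) ` Q \<inter> S \<times> S)) \<le> (real k)\<^sup>2 / 2"
begin

text \<open>
  In a state, \<^term>\<open>EL\<close> holds the links that form a simple digraph, and \<^term>\<open>PL\<close> the pending
  ones, which run parallel to other links. A pending link is the more expensive the more common
  neighbours its ends have, because it can replace a simple link only after a splice that is
  not blocked by an existing link.
\<close>

definition pr :: "'l \<Rightarrow> 'a \<times> 'a" where "pr q = (src q, dst q)"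
definition ins :: "'l set \<Rightarrow> 'a \<Rightarrow> 'l set" where "ins Q v = {q\<in>Q. dst q = v}"
definition outs :: "'l set \<Rightarrow> 'a \<Rightarrow> 'l set" where "outs Q v = {q\<in>Q. src q = v}"
definition weight :: "('a \<times> 'a) set \<Rightarrow> 'a \<Rightarrow> 'a \<Rightarrow> real" where
  "weight E a b = 1 + real (codegree E a b) / (3 * real d)"
definition pending_weight :: "('a \<times> 'a) set \<Rightarrow> 'l set \<Rightarrow> real" where
  "pending_weight E P = (\<Sum>q\<in>P. weight E (src q) (dst q))"
text \<open>Besides its missing degree, a deficient vertex carries a surcharge \<open>k / 5\<close>.
  It is collected when that vertex is eliminated and, as the loops can be gathered at one vertex,
  incurred at most once per elimination.\<close>

definition defect :: "'a set \<Rightarrow> 'l set \<Rightarrow> real" where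
  "defect V Q = (\<Sum>u\<in>V. real d - real (card (outs Q u))) + real k / 5 * real (card {u\<in>V. card (outs Q u) < d})"
definition potential :: "'a set \<Rightarrow> 'l set \<Rightarrow> 'l set \<Rightarrow> real" where
  "potential V EL PL = pending_weight (pr ` EL) PL + defect V (EL \<union> PL)"
definition state :: "'a set \<Rightarrow> 'l set \<Rightarrow> 'l set \<Rightarrow> bool" where
  "state V EL PL \<longleftrightarrow> finite V \<and> Adm (EL \<union> PL) \<and> EL \<inter> PL = {} \<and> inj_on pr EL \<and>
    (\<forall>q\<in>EL \<union> PL. src q \<in> V \<and> dst q \<in> V \<and> src q \<noteq> dst q) \<and>
    (\<forall>v\<in>V. card (ins (EL \<union> PL) v) = card (outs (EL \<union> PL) v) \<and> card (outs (EL \<union> PL) v) \<le> d)"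

lemma d_pos: "d > 0" using d k by simp

lemma weight_ge_1: "1 \<le> weight E a b" by (simp add: weight_def)

text \<open>The promoted links give up their own weight; the price is the growth of the codegrees of
  the links that stay pending, which the bumps bound.\<close>

lemma promote:
  assumes w: "state V EL PL" and F: "F \<subseteq> PL" and inj: "inj_on pr (EL \<union> F)"
  shows "state V (EL \<union> F) (PL - F)"
    and "potential V (EL \<union> F) (PL - F) \<le> potential V EL PL +
      (\<Sum>e\<in>F. real (bump src dst (pr ` (EL \<union> F)) (PL - F) (src e) (dst e)) / (3 * real d) - weight (pr ` EL) (src e) (dst e))"
proof -
  have un: "(EL \<union> F) \<union> (PL - F) = EL \<union> PL" using F by auto
  show "state V (EL \<union> F) (PL - F)"
    using w F inj unfolding state_def un by auto
  have fin: "finite EL" "finite PL" "finite F"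
    using w F Adm_finite[of "EL \<union> PL"] finite_subset unfolding state_def by auto
  let ?E = "pr ` EL" and ?E' = "pr ` (EL \<union> F)"
  have E': "?E' = ?E \<union> (\<lambda>e. (src e, dst e)) ` F" by (auto simp: pr_def)
  have "(\<Sum>q\<in>PL - F. real (codegree ?E' (src q) (dst q))) \<le>
      (\<Sum>q\<in>PL - F. real (codegree ?E (src q) (dst q))) + (\<Sum>e\<in>F. real (bump src dst ?E' (PL - F) (src e) (dst e)))"
    using sum_codegree_insert_le[of ?E F "PL - F" src dst] fin unfolding E'
    by (simp flip: of_nat_sum of_nat_add)
  then have "(\<Sum>q\<in>PL - F. real (codegree ?E' (src q) (dst q))) / (3 * real d) \<le>
      ((\<Sum>q\<in>PL - F. real (codegree ?E (src q) (dst q))) + (\<Sum>e\<in>F. real (bump src dst ?E' (PL - F) (src e) (dst e)))) / (3 * real d)"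
    by (rule divide_right_mono) simp
  then have "pending_weight ?E' (PL - F) \<le> pending_weight ?E (PL - F) +
      (\<Sum>e\<in>F. real (bump src dst ?E' (PL - F) (src e) (dst e)) / (3 * real d))"
    unfolding pending_weight_def weight_def by (simp add: sum.distrib sum_divide_distrib add_divide_distrib)
  moreover have "pending_weight ?E PL = pending_weight ?E (PL - F) + (\<Sum>e\<in>F. weight ?E (src e) (dst e))"
    unfolding pending_weight_def using sum.subset_diff[OF F fin(2)] by simp
  ultimately show "potential V (EL \<union> F) (PL - F) \<le> potential V EL PL +
      (\<Sum>e\<in>F. real (bump src dst ?E' (PL - F) (src e) (dst e)) / (3 * real d) - weight (pr ` EL) (src e) (dst e))"
    unfolding potential_def un by (simp add: sum_subtractf)
qed

end

section \<open>Splicing all links at one vertex: degrees, defect and pending weight\<close>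

locale elimination = links src dst Adm k d
  for src dst :: "'l \<Rightarrow> 'a" and Adm k d +
  fixes V :: "'a set" and EL PL :: "'l set" and v :: 'a
  assumes w: "state V EL PL" and v: "v \<in> V"
begin

abbreviation "Q \<equiv> EL \<union> PL"
abbreviation "I \<equiv> ins Q v"
abbreviation "J \<equiv> outs Q v"
abbreviation "E \<equiv> pr ` EL"

lemma fin: "finite V" "finite EL" "finite PL" "finite Q" "finite I" "finite J" "finite E"
proof -
  show "finite V" using w by (simp add: state_def)
  show Q: "finite Q" by (rule Adm_finite) (use w in \<open>simp add: state_def\<close>)
  then show "finite EL" "finite PL" by auto
  then show "finite I" "finite J" "finite E" by (auto simp: ins_def outs_def)
qed

lemma ends: "q \<in> Q \<Longrightarrow> src q \<in> V" "q \<in> Q \<Longrightarrow> dst q \<in> V" "q \<in> Q \<Longrightarrow> src q \<noteq> dst q"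
  using w unfolding state_def by auto

lemma card_I_J: "card I = card J" "card J \<le> d"
  using w v unfolding state_def by auto

lemma IJ: "I \<inter> J = {}" "I \<subseteq> Q" "J \<subseteq> Q" "i \<in> I \<Longrightarrow> dst i = v" "j \<in> J \<Longrightarrow> src j = v"
  "i \<in> I \<Longrightarrow> src i \<noteq> v" "j \<in> J \<Longrightarrow> dst j \<noteq> v"
  using ends(3) not_sym[OF ends(3)] by (auto simp: ins_def outs_def)

lemma inj_pr: "q \<in> EL \<Longrightarrow> q' \<in> EL \<Longrightarrow> src q = src q' \<Longrightarrow> dst q = dst q' \<Longrightarrow> q = q'"
  using w unfolding state_def inj_on_def pr_def by auto

lemma card_fiber_swap:
  assumes \<sigma>: "bij_betw \<sigma> I J"
  shows "card {j\<in>J. dst j = u} = card {i\<in>I. dst (\<sigma> i) = u}"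
proof -
  have "bij_betw \<sigma> {i\<in>I. dst (\<sigma> i) = u} {j\<in>J. dst j = u}"
  proof (rule bij_betw_imageI)
    show "inj_on \<sigma> {i\<in>I. dst (\<sigma> i) = u}"
      by (rule inj_on_subset[OF bij_betw_imp_inj_on[OF \<sigma>]]) blast
    have "\<sigma> ` {i\<in>I. dst (\<sigma> i) = u} = {j\<in>\<sigma> ` I. dst j = u}" by auto
    then show "\<sigma> ` {i\<in>I. dst (\<sigma> i) = u} = {j\<in>J. dst j = u}"
      unfolding bij_betw_imp_surj_on[OF \<sigma>] .
  qed
  then show ?thesis by (rule bij_betw_same_card[symmetric])
qed

definition "N \<sigma> = {i\<in>I. src i \<noteq> dst (\<sigma> i)}"

lemma E_delete: "pr ` (EL - I - J) = {p\<in>E. fst p \<noteq> v \<and> snd p \<noteq> v}"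
  by (auto simp: pr_def ins_def outs_def)

text \<open>At this stage every join that is not a loop is pending, even one that could be simple.
  Promotion is a separate step, so that its price is always given by \<open>promote\<close>.\<close>

definition spliced :: "('l \<Rightarrow> 'l) \<Rightarrow> ('l \<Rightarrow> 'l) \<Rightarrow> bool" where
  "spliced \<sigma> f \<longleftrightarrow> inj_on f I \<and> f ` I \<inter> (Q - I - J) = {} \<and>
     (\<forall>i\<in>I. src (f i) = src i \<and> dst (f i) = dst (\<sigma> i)) \<and>
     state (V - {v}) (EL - I - J) ((PL - I - J) \<union> f ` N \<sigma>)"

text \<open>A join keeps the tail of its first link, so \<open>u\<close> loses out-links only
  through dropped loops.\<close>

lemma card_outs_new:
  assumes f: "inj_on f I" "f ` I \<inter> (Q - I - J) = {}"
    and st: "\<And>i. i \<in> I \<Longrightarrow> src (f i) = src i \<and> dst (f i) = dst (\<sigma> i)" and u: "u \<noteq> v"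
  defines "Q1 \<equiv> (EL - I - J) \<union> ((PL - I - J) \<union> f ` N \<sigma>)"
  shows "card (outs Q u) = card (outs Q1 u) + card {i\<in>I. src i = u \<and> dst (\<sigma> i) = u}"
proof -
  have NI: "N \<sigma> \<subseteq> I" by (auto simp: N_def)
  have 1: "outs Q u = outs (Q - I - J) u \<union> {i\<in>I. src i = u}"
    using u by (auto simp: outs_def ins_def)
  have 2: "outs Q1 u = outs (Q - I - J) u \<union> f ` {i\<in>N \<sigma>. src i = u}"
  proof -
    have "outs (f ` N \<sigma>) u = f ` {i\<in>N \<sigma>. src i = u}" using st NI by (auto simp: outs_def)
    moreover have "Q1 = (Q - I - J) \<union> f ` N \<sigma>" by (auto simp: Q1_def)
    moreover have "outs (A \<union> B) u = outs A u \<union> outs B u" for A B by (auto simp: outs_def)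
    ultimately show ?thesis by simp
  qed
  have 3: "{i\<in>I. src i = u} = {i\<in>N \<sigma>. src i = u} \<union> {i\<in>I. src i = u \<and> dst (\<sigma> i) = u}"
    by (auto simp: N_def)
  have "card (outs Q u) = card (outs (Q - I - J) u) + card {i\<in>I. src i = u}"
    unfolding 1 using fin by (intro card_Un_disjoint) (auto simp: outs_def)
  also have "card {i\<in>I. src i = u} = card {i\<in>N \<sigma>. src i = u} + card {i\<in>I. src i = u \<and> dst (\<sigma> i) = u}"
    using fin(5) NI finite_subset[OF NI] by (subst 3, intro card_Un_disjoint) (auto simp: N_def)
  also have "card {i\<in>N \<sigma>. src i = u} = card (f ` {i\<in>N \<sigma>. src i = u})"
    using f(1) NI by (subst card_image) (auto intro: inj_on_subset)
  finally have "card (outs Q u) = card (outs (Q - I - J) u) + card (f ` {i\<in>N \<sigma>. src i = u}) +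
    card {i\<in>I. src i = u \<and> dst (\<sigma> i) = u}" by simp
  moreover have "card (outs Q1 u) = card (outs (Q - I - J) u) + card (f ` {i\<in>N \<sigma>. src i = u})"
    unfolding 2 using fin finite_subset[OF NI] f(2) NI by (intro card_Un_disjoint) (auto simp: outs_def)
  ultimately show ?thesis by simp
qed

text \<open>The loss is the same number of loops as for the out-links, which keeps \<open>u\<close>
  balanced.\<close>

lemma card_ins_new:
  assumes \<sigma>: "bij_betw \<sigma> I J" and f: "inj_on f I" "f ` I \<inter> (Q - I - J) = {}"
    and st: "\<And>i. i \<in> I \<Longrightarrow> src (f i) = src i \<and> dst (f i) = dst (\<sigma> i)" and u: "u \<noteq> v"
  defines "Q1 \<equiv> (EL - I - J) \<union> ((PL - I - J) \<union> f ` N \<sigma>)"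
  shows "card (ins Q u) = card (ins Q1 u) + card {i\<in>I. src i = u \<and> dst (\<sigma> i) = u}"
proof -
  have NI: "N \<sigma> \<subseteq> I" by (auto simp: N_def)
  have 1: "ins Q u = ins (Q - I - J) u \<union> {j\<in>J. dst j = u}"
    using u by (auto simp: outs_def ins_def)
  have 2: "ins Q1 u = ins (Q - I - J) u \<union> f ` {i\<in>N \<sigma>. dst (\<sigma> i) = u}"
  proof -
    have "ins (f ` N \<sigma>) u = f ` {i\<in>N \<sigma>. dst (\<sigma> i) = u}" using st NI by (auto simp: ins_def)
    moreover have "Q1 = (Q - I - J) \<union> f ` N \<sigma>" by (auto simp: Q1_def)
    moreover have "ins (A \<union> B) u = ins A u \<union> ins B u" for A B by (auto simp: ins_def)
    ultimately show ?thesis by simp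
  qed
  have 3: "{i\<in>I. dst (\<sigma> i) = u} = {i\<in>N \<sigma>. dst (\<sigma> i) = u} \<union> {i\<in>I. src i = u \<and> dst (\<sigma> i) = u}"
    by (auto simp: N_def)
  have "card (ins Q u) = card (ins (Q - I - J) u) + card {j\<in>J. dst j = u}"
    unfolding 1 using fin by (intro card_Un_disjoint) (auto simp: ins_def)
  also have "card {j\<in>J. dst j = u} = card {i\<in>N \<sigma>. dst (\<sigma> i) = u} + card {i\<in>I. src i = u \<and> dst (\<sigma> i) = u}"
    unfolding card_fiber_swap[OF \<sigma>]
    using fin(5) NI finite_subset[OF NI] by (subst 3, intro card_Un_disjoint) (auto simp: N_def)
  also have "card {i\<in>N \<sigma>. dst (\<sigma> i) = u} = card (f ` {i\<in>N \<sigma>. dst (\<sigma> i) = u})"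
    using f(1) NI by (subst card_image) (auto intro: inj_on_subset)
  finally have "card (ins Q u) = card (ins (Q - I - J) u) + card (f ` {i\<in>N \<sigma>. dst (\<sigma> i) = u}) +
    card {i\<in>I. src i = u \<and> dst (\<sigma> i) = u}" by simp
  moreover have "card (ins Q1 u) = card (ins (Q - I - J) u) + card (f ` {i\<in>N \<sigma>. dst (\<sigma> i) = u})"
    unfolding 2 using fin finite_subset[OF NI] f(2) NI by (intro card_Un_disjoint) (auto simp: ins_def)
  ultimately show ?thesis by simp
qed

lemma exists_spliced:
  assumes \<sigma>: "bij_betw \<sigma> I J"
  shows "\<exists>f. spliced \<sigma> f"
proof -
  have A: "Adm Q" using w by (simp add: state_def)
  have "\<And>i. i \<in> I \<Longrightarrow> dst i = src (\<sigma> i)" using IJ(4,5) \<sigma> by (metis bij_betwE)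
  from Adm_splice[OF A IJ(2,3,1) \<sigma> this] obtain f where
    f: "inj_on f I" "f ` I \<inter> (Q - I - J) = {}" "Adm ((Q - I - J) \<union> f ` I)"
    and st: "\<And>i. i \<in> I \<Longrightarrow> src (f i) = src i \<and> dst (f i) = dst (\<sigma> i)" by blast
  have NI: "N \<sigma> \<subseteq> I" by (auto simp: N_def)
  let ?Q1 = "(EL - I - J) \<union> ((PL - I - J) \<union> f ` N \<sigma>)"
  have "Adm ?Q1" using f(3) by (rule Adm_mono) (use NI in auto)
  moreover have "(EL - I - J) \<inter> ((PL - I - J) \<union> f ` N \<sigma>) = {}"
    using w f(2) NI unfolding state_def by blast
  moreover have "inj_on pr (EL - I - J)"
    using w unfolding state_def by (auto intro: inj_on_subset)
  moreover have "src q \<in> V - {v} \<and> dst q \<in> V - {v} \<and> src q \<noteq> dst q" if "q \<in> ?Q1" for q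
  proof (cases "q \<in> f ` N \<sigma>")
    case True
    then obtain i where i: "q = f i" "i \<in> I" "src i \<noteq> dst (\<sigma> i)" by (auto simp: N_def)
    then have J: "\<sigma> i \<in> J" using \<sigma> by (auto simp: bij_betw_def)
    have "i \<in> Q" "\<sigma> i \<in> Q" using i J IJ(2,3) by auto
    then show ?thesis using st[OF i(2)] i J IJ(6)[of i] IJ(7)[of "\<sigma> i"] ends by auto
  next
    case False
    then have "q \<in> Q - I - J" using that by auto
    then show ?thesis using ends[of q] by (auto simp: ins_def outs_def)
  qed
  moreover have "card (ins ?Q1 u) = card (outs ?Q1 u) \<and> card (outs ?Q1 u) \<le> d" if "u \<in> V - {v}" for u
  proof -
    have "card (ins Q u) = card (outs Q u)" "card (outs Q u) \<le> d" using w that by (auto simp: state_def)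
    then show ?thesis
      using card_ins_new[OF \<sigma> f(1,2) st, of u] card_outs_new[OF f(1,2) st, of u] that by auto
  qed
  ultimately have "state (V - {v}) (EL - I - J) ((PL - I - J) \<union> f ` N \<sigma>)"
    using fin(1) unfolding state_def by blast
  then show ?thesis using f st unfolding spliced_def by blast
qed

text \<open>The defect of \<open>v\<close> disappears with \<open>v\<close>. Each loop costs one
  degree, and a vertex that becomes deficient must carry a loop, so the surcharge counts loop
  vertices and not loops.\<close>

lemma defect_spliced:
  assumes f: "spliced \<sigma> f"
  shows "defect (V - {v}) ((EL - I - J) \<union> ((PL - I - J) \<union> f ` N \<sigma>)) \<le>
    defect V Q - (real d - real (card J)) - real k / 5 * of_bool (card J < d)
    + real (card (I - N \<sigma>)) + real k / 5 * real (card (src ` (I - N \<sigma>)))"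
proof -
  let ?Q1 = "(EL - I - J) \<union> ((PL - I - J) \<union> f ` N \<sigma>)"
  let ?l = "\<lambda>u. card {i\<in>I. src i = u \<and> dst (\<sigma> i) = u}"
  have f': "inj_on f I" "f ` I \<inter> (Q - I - J) = {}" "\<And>i. i \<in> I \<Longrightarrow> src (f i) = src i \<and> dst (f i) = dst (\<sigma> i)"
    using f unfolding spliced_def by auto
  have co: "card (outs Q u) = card (outs ?Q1 u) + ?l u" if "u \<in> V - {v}" for u
    using card_outs_new[OF f', of u] that by auto
  have finIN: "finite (I - N \<sigma>)" using fin by auto
  have "(\<Sum>u\<in>V - {v}. ?l u) = (\<Sum>u\<in>V - {v}. card {i\<in>I - N \<sigma>. src i = u})"
    by (intro sum.cong refl arg_cong[where f = card]) (auto simp: N_def)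
  also have "\<dots> = card {i\<in>I - N \<sigma>. src i \<in> V - {v}}"
    using sum_card_fibers[OF _ finIN] fin by blast
  also have "\<dots> \<le> card (I - N \<sigma>)" using finIN by (intro card_mono) auto
  finally have l: "real (\<Sum>u\<in>V - {v}. ?l u) \<le> real (card (I - N \<sigma>))" by (simp only: of_nat_le_iff)
  have "(\<Sum>u\<in>V - {v}. real d - real (card (outs ?Q1 u))) =
      (\<Sum>u\<in>V - {v}. (real d - real (card (outs Q u))) + real (?l u))"
    by (rule sum.cong[OF refl]) (use co in auto)
  also have "\<dots> = (\<Sum>u\<in>V - {v}. real d - real (card (outs Q u))) + real (\<Sum>u\<in>V - {v}. ?l u)"
    by (simp add: sum.distrib)
  also have "(\<Sum>u\<in>V - {v}. real d - real (card (outs Q u))) =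
      (\<Sum>u\<in>V. real d - real (card (outs Q u))) - (real d - real (card J))"
    using sum_diff1[OF fin(1), of "\<lambda>u. real d - real (card (outs Q u))" v] v by simp
  finally have s: "(\<Sum>u\<in>V - {v}. real d - real (card (outs ?Q1 u))) \<le>
      (\<Sum>u\<in>V. real d - real (card (outs Q u))) - (real d - real (card J)) + real (card (I - N \<sigma>))"
    using l by linarith
  have "{u\<in>V - {v}. card (outs ?Q1 u) < d} \<subseteq> {u\<in>V - {v}. card (outs Q u) < d} \<union> src ` (I - N \<sigma>)"
  proof
    fix u assume u: "u \<in> {u\<in>V - {v}. card (outs ?Q1 u) < d}"
    show "u \<in> {u\<in>V - {v}. card (outs Q u) < d} \<union> src ` (I - N \<sigma>)"
    proof (cases "?l u = 0")
      case True then show ?thesis using co[of u] u by auto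
    next
      case False
      then have "{i\<in>I. src i = u \<and> dst (\<sigma> i) = u} \<noteq> {}" by (metis card.empty)
      then obtain x where "x \<in> I" "src x = u" "dst (\<sigma> x) = u" by blast
      then have "x \<in> I - N \<sigma>" "u = src x" by (simp_all add: N_def)
      then show ?thesis by blast
    qed
  qed
  then have "card {u\<in>V - {v}. card (outs ?Q1 u) < d} \<le> card ({u\<in>V - {v}. card (outs Q u) < d} \<union> src ` (I - N \<sigma>))"
    using fin by (intro card_mono) auto
  also have "\<dots> \<le> card {u\<in>V - {v}. card (outs Q u) < d} + card (src ` (I - N \<sigma>))"
    by (rule card_Un_le)
  finally have "card {u\<in>V - {v}. card (outs ?Q1 u) < d} + of_bool (card J < d) \<le>
      card {u\<in>V - {v}. card (outs Q u) < d} + of_bool (card J < d) + card (src ` (I - N \<sigma>))" by simp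
  also have "card {u\<in>V - {v}. card (outs Q u) < d} + of_bool (card J < d) = card {u\<in>V. card (outs Q u) < d}"
  proof (cases "card J < d")
    case True
    then have "{u\<in>V. card (outs Q u) < d} = insert v {u\<in>V - {v}. card (outs Q u) < d}" using v by auto
    then show ?thesis using fin True by simp
  next
    case False
    then have "{u\<in>V. card (outs Q u) < d} = {u\<in>V - {v}. card (outs Q u) < d}" by auto
    then show ?thesis using False by simp
  qed
  finally have "real (card {u\<in>V - {v}. card (outs ?Q1 u) < d} + of_bool (card J < d)) \<le>
      real (card {u\<in>V. card (outs Q u) < d} + card (src ` (I - N \<sigma>)))" by (simp only: of_nat_le_iff)
  then have "real k / 5 * (real (card {u\<in>V - {v}. card (outs ?Q1 u) < d}) + of_bool (card J < d)) \<le>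
      real k / 5 * (real (card {u\<in>V. card (outs Q u) < d}) + real (card (src ` (I - N \<sigma>))))"
    by (intro mult_left_mono) (auto simp: of_nat_of_bool)
  then show ?thesis using s unfolding defect_def by (simp add: algebra_simps)
qed

lemma pending_weight_spliced:
  assumes \<sigma>: "bij_betw \<sigma> I J" and f: "spliced \<sigma> f"
  defines "E1 \<equiv> pr ` (EL - I - J)"
  shows "pending_weight E1 ((PL - I - J) \<union> f ` N \<sigma>) =
    pending_weight E PL - (\<Sum>q\<in>PL \<inter> I. weight E (src q) (dst q)) - (\<Sum>q\<in>PL \<inter> J. weight E (src q) (dst q))
    - (\<Sum>q\<in>PL. real (codegree_via E v (src q) (dst q))) / (3 * real d) + (\<Sum>i\<in>N \<sigma>. weight E1 (src i) (dst (\<sigma> i)))"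
proof -
  have NI: "N \<sigma> \<subseteq> I" by (auto simp: N_def)
  have f': "inj_on f I" "f ` I \<inter> (Q - I - J) = {}" "\<And>i. i \<in> I \<Longrightarrow> src (f i) = src i \<and> dst (f i) = dst (\<sigma> i)"
    using f unfolding spliced_def by auto
  have vv: "(v, v) \<notin> E" using ends(3) by (auto simp: pr_def)
  have PL: "PL = (PL - I - J) \<union> (PL \<inter> I) \<union> (PL \<inter> J)" by auto
  have split: "(\<Sum>q\<in>PL. g q) = (\<Sum>q\<in>PL - I - J. g q) + (\<Sum>q\<in>PL \<inter> I. g q) + (\<Sum>q\<in>PL \<inter> J. g q)" for g :: "'l \<Rightarrow> real"
  proof -
    have "sum g ((PL - I - J) \<union> (PL \<inter> I) \<union> (PL \<inter> J)) = sum g ((PL - I - J) \<union> (PL \<inter> I)) + sum g (PL \<inter> J)"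
      by (rule sum.union_disjoint) (use fin IJ(1) in blast)+
    moreover have "sum g ((PL - I - J) \<union> (PL \<inter> I)) = sum g (PL - I - J) + sum g (PL \<inter> I)"
      by (rule sum.union_disjoint) (use fin in blast)+
    ultimately show ?thesis using arg_cong[OF PL, of "sum g"] by linarith
  qed
  \<comment> \<open>Such a link has \<open>v\<close> as an end, and \<open>(v, v)\<close> is not in
    \<open>E\<close>. Hence the refund may be summed over all of \<open>PL\<close>, the form
    required when summing over \<open>v\<close> later.\<close>
  have "codegree_via E v (src q) (dst q) = 0" if "q \<in> I \<or> q \<in> J" for q
    using that IJ(4,5) vv by (auto simp: codegree_via_def)
  then have codegree_via: "(\<Sum>q\<in>PL. real (codegree_via E v (src q) (dst q))) = (\<Sum>q\<in>PL - I - J. real (codegree_via E v (src q) (dst q)))"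
    unfolding split[of "\<lambda>q. real (codegree_via E v (src q) (dst q))"] by simp
  have "weight E1 (src q) (dst q) = weight E (src q) (dst q) - real (codegree_via E v (src q) (dst q)) / (3 * real d)"
    if "q \<in> PL - I - J" for q
    using codegree_delete[OF fin(7) _ _ E_delete, of "src q" "dst q"] that
    unfolding weight_def E1_def by (auto simp: ins_def outs_def add_divide_distrib)
  then have "pending_weight E1 (PL - I - J) = (\<Sum>q\<in>PL - I - J. weight E (src q) (dst q) - real (codegree_via E v (src q) (dst q)) / (3 * real d))"
    unfolding pending_weight_def by (intro sum.cong) auto
  also have "\<dots> = (\<Sum>q\<in>PL - I - J. weight E (src q) (dst q)) - (\<Sum>q\<in>PL. real (codegree_via E v (src q) (dst q))) / (3 * real d)"
    unfolding codegree_via by (simp add: sum_subtractf sum_divide_distrib)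
  finally have 1: "pending_weight E1 (PL - I - J) = (\<Sum>q\<in>PL - I - J. weight E (src q) (dst q)) - (\<Sum>q\<in>PL. real (codegree_via E v (src q) (dst q))) / (3 * real d)" .
  have "pending_weight E1 (f ` N \<sigma>) = (\<Sum>i\<in>N \<sigma>. weight E1 (src (f i)) (dst (f i)))"
    unfolding pending_weight_def using f'(1) NI by (subst sum.reindex) (auto intro: inj_on_subset)
  also have "\<dots> = (\<Sum>i\<in>N \<sigma>. weight E1 (src i) (dst (\<sigma> i)))"
    using f'(3) NI by (intro sum.cong) auto
  finally have 2: "pending_weight E1 (f ` N \<sigma>) = (\<Sum>i\<in>N \<sigma>. weight E1 (src i) (dst (\<sigma> i)))" .
  have "pending_weight E1 ((PL - I - J) \<union> f ` N \<sigma>) = pending_weight E1 (PL - I - J) + pending_weight E1 (f ` N \<sigma>)"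
    unfolding pending_weight_def using fin f'(2) NI finite_subset[OF NI] by (intro sum.union_disjoint) auto
  then show ?thesis
    using 1 2 split[of "\<lambda>q. weight E (src q) (dst q)"] unfolding pending_weight_def by simp
qed

end

section \<open>Promoting pending links\<close>

lemma sum_fibers_le:
  assumes "finite N" "finite I" "inj_on g N"
  shows "(\<Sum>i\<in>N. card {i'\<in>I. s i' = g i}) \<le> card I"
proof -
  have "(\<Sum>i\<in>N. card {i'\<in>I. s i' = g i}) = (\<Sum>a\<in>g ` N. card {i'\<in>I. s i' = a})"
    using assms(3) by (simp add: sum.reindex)
  also have "\<dots> = card {i'\<in>I. s i' \<in> g ` N}"
    using assms by (intro sum_card_fibers) auto
  also have "\<dots> \<le> card I" using assms by (intro card_mono) auto
  finally show ?thesis .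
qed

lemma disjoint_imageI: "(\<And>x. x \<in> X \<Longrightarrow> g (f x) \<notin> S) \<Longrightarrow> S \<inter> g ` f ` X = {}"
  by auto

lemma card_le_cover:
  assumes "finite A" "finite B" "finite C"
    and "\<And>q. q \<in> S \<Longrightarrow> q \<in> A \<or> (\<exists>i\<in>B. q = f i) \<or> (\<exists>i\<in>C. q = f i)"
  shows "card S \<le> card A + card B + card C"
proof -
  have "card S \<le> card (A \<union> f ` B \<union> f ` C)"
    using assms by (intro card_mono) blast+
  also have "\<dots> \<le> card A + card (f ` B) + card (f ` C)"
    by (meson card_Un_le add_le_mono le_refl order_trans)
  also have "\<dots> \<le> card A + card B + card C"
    using assms by (intro add_mono card_image_le le_refl)
  finally show ?thesis .
qed

lemma half_bump_le_stubs:
  assumes "finite P"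
  shows "half_bump s t E P a b \<le> card {q\<in>P. s q = b} + card {q\<in>P. t q = b}"
  unfolding half_bump_def using assms by (intro add_mono card_mono) auto

lemma bump_le_stubs:
  assumes "finite P"
  shows "bump s t E P a b \<le> card {q\<in>P. s q = a} + card {q\<in>P. t q = a} + (card {q\<in>P. s q = b} + card {q\<in>P. t q = b})"
  using half_bump_le_stubs[OF assms, of s t E a b] half_bump_le_stubs[OF assms, of s t "E\<inverse>" b a] by (simp add: bump_def)

lemma half_bump_le_split:
  assumes "finite P" "finite I"
    and s: "\<And>q. q \<in> P' \<Longrightarrow> s q = b \<Longrightarrow> (a, t q) \<in> E' \<Longrightarrow> q \<in> P \<and> (a, t q) \<in> E \<or> (\<exists>i\<in>I. q = f i \<and> s' i = b)"
    and t: "\<And>q. q \<in> P' \<Longrightarrow> t q = b \<Longrightarrow> (a, s q) \<in> E' \<Longrightarrow> q \<in> P \<and> (a, s q) \<in> E \<or> (\<exists>i\<in>I. q = f i \<and> t' i = b)"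
  shows "half_bump s t E' P' a b \<le> half_bump s t E P a b + card {i\<in>I. s' i = b} + card {i\<in>I. t' i = b}"
proof -
  have aux: "card X \<le> card Y + card {i\<in>I. r i = b}" if "X \<subseteq> Y \<union> f ` {i\<in>I. r i = b}" "finite Y" for X Y r
  proof -
    have "card X \<le> card (Y \<union> f ` {i\<in>I. r i = b})"
      using that assms(2) by (intro card_mono) auto
    also have "\<dots> \<le> card Y + card (f ` {i\<in>I. r i = b})" by (rule card_Un_le)
    also have "card (f ` {i\<in>I. r i = b}) \<le> card {i\<in>I. r i = b}"
      using assms(2) by (intro card_image_le) auto
    finally show ?thesis by simp
  qed
  have "{q\<in>P'. s q = b \<and> (a, t q) \<in> E'} \<subseteq> {q\<in>P. s q = b \<and> (a, t q) \<in> E} \<union> f ` {i\<in>I. s' i = b}"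
    using s by blast
  moreover have "{q\<in>P'. t q = b \<and> (a, s q) \<in> E'} \<subseteq> {q\<in>P. t q = b \<and> (a, s q) \<in> E} \<union> f ` {i\<in>I. t' i = b}"
    using t by blast
  ultimately have "card {q\<in>P'. s q = b \<and> (a, t q) \<in> E'} \<le> card {q\<in>P. s q = b \<and> (a, t q) \<in> E} + card {i\<in>I. s' i = b}"
    "card {q\<in>P'. t q = b \<and> (a, s q) \<in> E'} \<le> card {q\<in>P. t q = b \<and> (a, s q) \<in> E} + card {i\<in>I. t' i = b}"
    using assms(1) by (auto intro!: aux)
  then show ?thesis unfolding half_bump_def by linarith
qed

context elimination
begin

definition pending :: "'a \<Rightarrow> nat" where
  "pending u = card {q\<in>PL. src q = u} + card {q\<in>PL. dst q = u}"

text \<open>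
  The cost of joining \<^term>\<open>i\<close> to \<^term>\<open>j\<close>: a loop is dropped and lowers a degree; a join of two
  simple links is pending exactly if it is blocked, and otherwise raises codegrees by its bump; any
  other join stays pending unless it is promoted to a simple link.
\<close>

definition cost :: "('l \<Rightarrow> 'l \<Rightarrow> bool) \<Rightarrow> real \<Rightarrow> 'l \<Rightarrow> 'l \<Rightarrow> real" where
  "cost prom lam i j = (if src i = dst j then 1
     else if i \<in> EL \<and> j \<in> EL then
       (if (src i, dst j) \<in> E then weight E (src i) (dst j) else real (bump src dst E PL (src i) (dst j)) / (3 * real d))
     else weight E (src i) (dst j) - (if prom i j then lam else 0))"

text \<open>Promoted joins of one kind are told apart by their simple constituent; the last clause
  tells the two kinds apart by their tails. So no two promoted joins are parallel.\<close>

definition admissible :: "('l \<Rightarrow> 'l \<Rightarrow> bool) \<Rightarrow> bool" where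
  "admissible prom \<longleftrightarrow>
     (\<forall>i j. prom i j \<longrightarrow> src i \<noteq> dst j \<and> (src i, dst j) \<notin> E \<and>
        (i \<in> PL \<and> j \<in> EL \<or> i \<in> EL \<and> j \<in> PL)) \<and>
     (\<forall>i j i' j'. prom i j \<and> i \<in> PL \<and> prom i' j' \<and> i' \<in> EL \<longrightarrow> src i \<noteq> src i')"

lemma EL_PL: "EL \<inter> PL = {}" using w by (simp add: state_def)

text \<open>
  The two sets are promoted one after the other. The links in the first have distinct tails
  and distinct heads, so they do not contribute to one another's bumps; the bumps of those in the
  second can only be bounded by the number of pending links at their ends.
\<close>

definition "N1 \<sigma> = {i\<in>I. src i \<noteq> dst (\<sigma> i) \<and> i \<in> EL \<and> \<sigma> i \<in> EL \<and> (src i, dst (\<sigma> i)) \<notin> E}"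
definition "N2 prom \<sigma> = {i\<in>I. prom i (\<sigma> i)}"

definition "EL1 = EL - I - J"
definition "PL1 \<sigma> f = (PL - I - J) \<union> f ` N \<sigma>"

context
  fixes \<sigma> f
  assumes \<sigma>: "bij_betw \<sigma> I J" and f: "spliced \<sigma> f"
begin


abbreviation "P1 \<equiv> PL1 \<sigma> f"

lemma f_facts: "inj_on f I" "f ` I \<inter> (Q - I - J) = {}"
  "i \<in> I \<Longrightarrow> src (f i) = src i" "i \<in> I \<Longrightarrow> dst (f i) = dst (\<sigma> i)"
  "state (V - {v}) EL1 P1"
  using f unfolding spliced_def EL1_def PL1_def by auto

lemma \<sigma>_J: "i \<in> I \<Longrightarrow> \<sigma> i \<in> J"
  using \<sigma> by (rule bij_betwE[rule_format])

lemma \<sigma>_inj: "i \<in> I \<Longrightarrow> i' \<in> I \<Longrightarrow> \<sigma> i = \<sigma> i' \<Longrightarrow> i = i'"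
  using bij_betw_imp_inj_on[OF \<sigma>] by (rule inj_onD)

lemma EL_I_inj: "i \<in> I \<Longrightarrow> i' \<in> I \<Longrightarrow> i \<in> EL \<Longrightarrow> i' \<in> EL \<Longrightarrow> src i = src i' \<Longrightarrow> i = i'"
  using inj_pr[of i i'] IJ(4) by metis

lemma EL_J_inj:
  assumes "i \<in> I" "i' \<in> I" "\<sigma> i \<in> EL" "\<sigma> i' \<in> EL" "dst (\<sigma> i) = dst (\<sigma> i')"
  shows "i = i'"
proof -
  have "\<sigma> i = \<sigma> i'" using inj_pr[of "\<sigma> i" "\<sigma> i'"] IJ(5)[OF \<sigma>_J] assms by simp
  then show ?thesis using \<sigma>_inj assms by blast
qed

lemma N1_props: "i \<in> N1 \<sigma> \<Longrightarrow> i \<in> I \<and> src i \<noteq> dst (\<sigma> i) \<and> i \<in> EL \<and> \<sigma> i \<in> EL \<and> (src i, dst (\<sigma> i)) \<notin> E"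
  by (simp add: N1_def)

lemma fN1_PL1: "f ` N1 \<sigma> \<subseteq> P1"
  by (auto simp: PL1_def N1_def N_def)

lemma pr_f: "i \<in> I \<Longrightarrow> pr (f i) = (src i, dst (\<sigma> i))"
  by (simp add: pr_def f_facts)

text \<open>The links of \<open>EL\<close> that enter \<open>v\<close> have distinct tails, hence so
  have their joins; and an unblocked join is not parallel to an old simple link.\<close>

lemma inj_promote1: "inj_on pr (EL1 \<union> f ` N1 \<sigma>)"
proof -
  have "inj_on pr EL1" using f_facts(5) by (simp add: state_def)
  moreover have "inj_on pr (f ` N1 \<sigma>)"
  proof (rule inj_onI)
    fix x y assume "x \<in> f ` N1 \<sigma>" "y \<in> f ` N1 \<sigma>" "pr x = pr y"
    then obtain i i' where "x = f i" "y = f i'" "i \<in> N1 \<sigma>" "i' \<in> N1 \<sigma>" "src i = src i'"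
      using N1_props pr_f by auto
    then show "x = y" using EL_I_inj[of i i'] N1_props by metis
  qed
  moreover have "pr ` EL1 \<inter> pr ` (f ` N1 \<sigma>) = {}"
  proof -
    have "pr (f i) \<notin> pr ` EL1" if "i \<in> N1 \<sigma>" for i
      using N1_props[OF that] pr_f[of i] by (auto simp: EL1_def)
    then show ?thesis by (rule disjoint_imageI)
  qed
  ultimately show ?thesis unfolding inj_on_Un by blast
qed

text \<open>As promoted joins have distinct tails and distinct heads, the only new pair with tail
  \<open>src i\<close> or with head \<open>dst (\<sigma> i)\<close> is the promoted one, which could
  count only for a pending loop. So the bump grows only through pending links created by the
  splice.\<close>

lemma bump_promote1:
  assumes i: "i \<in> N1 \<sigma>"
  shows "bump src dst (pr ` (EL1 \<union> f ` N1 \<sigma>)) (P1 - f ` N1 \<sigma>) (src i) (dst (\<sigma> i)) \<le>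
    bump src dst E PL (src i) (dst (\<sigma> i))
    + (card {i'\<in>I. src i' = src i} + card {i'\<in>I. dst (\<sigma> i') = src i})
    + (card {i'\<in>I. src i' = dst (\<sigma> i)} + card {i'\<in>I. dst (\<sigma> i') = dst (\<sigma> i)})"
proof -
  let ?E = "pr ` (EL1 \<union> f ` N1 \<sigma>)" and ?P = "P1 - f ` N1 \<sigma>"
  let ?a = "src i" and ?b = "dst (\<sigma> i)"
  note ip = N1_props[OF i]
  have out: "(?a, x) \<in> ?E \<Longrightarrow> x = ?b \<or> (?a, x) \<in> E" for x
  proof -
    assume "(?a, x) \<in> ?E"
    then consider "(?a, x) \<in> E" | i' where "i' \<in> N1 \<sigma>" "(?a, x) = pr (f i')" by (auto simp: EL1_def)
    then show ?thesis
    proof cases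
      case 2
      then have "i' \<in> N1 \<sigma>" "src i = src i'" "x = dst (\<sigma> i')" using pr_f[of i'] N1_props[of i'] by auto
      then show ?thesis using EL_I_inj[of i i'] ip N1_props[of i'] by blast
    qed simp
  qed
  have inn: "(x, ?b) \<in> ?E \<Longrightarrow> x = ?a \<or> (x, ?b) \<in> E" for x
  proof -
    assume "(x, ?b) \<in> ?E"
    then consider "(x, ?b) \<in> E" | i' where "i' \<in> N1 \<sigma>" "(x, ?b) = pr (f i')" by (auto simp: EL1_def)
    then show ?thesis
    proof cases
      case 2
      then have "i' \<in> N1 \<sigma>" "dst (\<sigma> i) = dst (\<sigma> i')" "x = src i'" using pr_f[of i'] N1_props[of i'] by auto
      then show ?thesis using EL_J_inj[of i i'] ip N1_props[of i'] by blast
    qed simp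
  qed
  have nl: "q \<in> ?P \<Longrightarrow> src q \<noteq> dst q" for q using f_facts(5) by (auto simp: state_def)
  have old: "q \<in> ?P \<Longrightarrow> q \<in> PL \<or> (\<exists>i\<in>I. q = f i \<and> src q = src i \<and> dst q = dst (\<sigma> i))" for q
    using f_facts(3,4) by (auto simp: PL1_def N_def)
  have "half_bump src dst ?E ?P ?a ?b \<le> half_bump src dst E PL ?a ?b + card {i'\<in>I. src i' = ?b} + card {i'\<in>I. dst (\<sigma> i') = ?b}"
  proof (rule half_bump_le_split[where f = f])
    fix q assume q: "q \<in> ?P"
    show "q \<in> PL \<and> (?a, dst q) \<in> E \<or> (\<exists>i'\<in>I. q = f i' \<and> src i' = ?b)" if "src q = ?b" "(?a, dst q) \<in> ?E"
      using out[OF that(2)] nl[OF q] old[OF q] that(1) by metis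
    show "q \<in> PL \<and> (?a, src q) \<in> E \<or> (\<exists>i'\<in>I. q = f i' \<and> dst (\<sigma> i') = ?b)" if "dst q = ?b" "(?a, src q) \<in> ?E"
      using out[OF that(2)] nl[OF q] old[OF q] that(1) by metis
  qed (rule fin)+
  moreover have "half_bump src dst (?E\<inverse>) ?P ?b ?a \<le> half_bump src dst (E\<inverse>) PL ?b ?a + card {i'\<in>I. src i' = ?a} + card {i'\<in>I. dst (\<sigma> i') = ?a}"
  proof (rule half_bump_le_split[where f = f])
    fix q assume q: "q \<in> ?P"
    show "q \<in> PL \<and> (?b, dst q) \<in> E\<inverse> \<or> (\<exists>i'\<in>I. q = f i' \<and> src i' = ?a)" if "src q = ?a" "(?b, dst q) \<in> ?E\<inverse>"
      using inn[OF that(2)[unfolded converse_iff]] nl[OF q] old[OF q] that(1) by (metis converse_iff)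
    show "q \<in> PL \<and> (?b, src q) \<in> E\<inverse> \<or> (\<exists>i'\<in>I. q = f i' \<and> dst (\<sigma> i') = ?a)" if "dst q = ?a" "(?b, src q) \<in> ?E\<inverse>"
      using inn[OF that(2)[unfolded converse_iff]] nl[OF q] old[OF q] that(1) by (metis converse_iff)
  qed (rule fin)+
  ultimately show ?thesis by (simp add: bump_def)
qed

text \<open>With distinct tails and distinct heads, each of the four sums counts an index of
  \<open>I\<close> at most once. Divided by \<open>3 * d\<close>, this is the term
  \<open>4 / 3\<close> in \<open>eliminate\<close>.\<close>

lemma sum_new_stubs:
  "(\<Sum>i\<in>N1 \<sigma>. (card {i'\<in>I. src i' = src i} + card {i'\<in>I. dst (\<sigma> i') = src i})
    + (card {i'\<in>I. src i' = dst (\<sigma> i)} + card {i'\<in>I. dst (\<sigma> i') = dst (\<sigma> i)})) \<le> 4 * card I"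
proof -
  have sub: "N1 \<sigma> \<subseteq> I" by (auto simp: N1_def)
  have finN: "finite (N1 \<sigma>)" using finite_subset[OF sub fin(5)] .
  have 1: "inj_on src (N1 \<sigma>)"
    by (rule inj_onI) (meson EL_I_inj N1_props)
  have 2: "inj_on (\<lambda>i. dst (\<sigma> i)) (N1 \<sigma>)"
    by (rule inj_onI) (meson EL_J_inj N1_props)
  show ?thesis
    using sum_fibers_le[OF finN fin(5) 1, of src] sum_fibers_le[OF finN fin(5) 1, of "\<lambda>i. dst (\<sigma> i)"]
      sum_fibers_le[OF finN fin(5) 2, of src] sum_fibers_le[OF finN fin(5) 2, of "\<lambda>i. dst (\<sigma> i)"]
    unfolding sum.distrib by linarith
qed

text \<open>A join whose link at \<open>u\<close> was pending takes over the place of that link.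
  Beyond these, only the one simple link from \<open>u\<close> to \<open>v\<close> and the one from
  \<open>v\<close> to \<open>u\<close> can make a join pending at \<open>u\<close>.\<close>

lemma pending_new_le:
  "card {q\<in>P1. src q = u} + card {q\<in>P1. dst q = u} \<le> pending u + 2"
proof -
  have NI: "N \<sigma> \<subseteq> I" by (auto simp: N_def)
  have s: "card {q\<in>P1. src q = u} \<le> card {q\<in>PL. src q = u} + 1"
  proof (cases "u = v")
    case True
    have "{q\<in>P1. src q = u} = {}" using f_facts(5) True by (auto simp: state_def)
    then show ?thesis by (simp only: card.empty zero_le)
  next
    case False
    have c1: "card {i\<in>I. src i = u \<and> i \<in> EL} \<le> Suc 0"
    proof (subst card_le_Suc0_iff_eq)
      show "finite {i\<in>I. src i = u \<and> i \<in> EL}" using fin(5) by simp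
      show "\<forall>x\<in>{i\<in>I. src i = u \<and> i \<in> EL}. \<forall>y\<in>{i\<in>I. src i = u \<and> i \<in> EL}. x = y"
        using EL_I_inj by blast
    qed
    have c2: "card {q\<in>P1. src q = u} \<le> card {q\<in>PL - I - J. src q = u} + card {i\<in>I. src i = u \<and> i \<in> PL} + card {i\<in>I. src i = u \<and> i \<in> EL}"
    proof (rule card_le_cover[where f = f])
      fix q assume q: "q \<in> {q\<in>P1. src q = u}"
      show "q \<in> {q\<in>PL - I - J. src q = u} \<or> (\<exists>i\<in>{i\<in>I. src i = u \<and> i \<in> PL}. q = f i) \<or> (\<exists>i\<in>{i\<in>I. src i = u \<and> i \<in> EL}. q = f i)"
      proof (cases "q \<in> PL - I - J")
        case True then show ?thesis using q by simp
      next
        case False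
        then have "q \<in> f ` N \<sigma>" using q unfolding PL1_def by blast
        then obtain i where i: "i \<in> I" "q = f i" using NI by blast
        have "src i = u" using q i f_facts(3) by simp
        moreover have "i \<in> EL \<or> i \<in> PL" using i IJ(2) by blast
        ultimately show ?thesis using i by blast
      qed
    qed (use fin in simp_all)
    have "card {q\<in>PL - I - J. src q = u} + card {i\<in>I. src i = u \<and> i \<in> PL} = card ({q\<in>PL - I - J. src q = u} \<union> {i\<in>I. src i = u \<and> i \<in> PL})"
      using fin by (intro card_Un_disjoint[symmetric]) auto
    also have "\<dots> \<le> card {q\<in>PL. src q = u}" using fin by (intro card_mono) auto
    finally show ?thesis using c1 c2 by linarith
  qed
  have t: "card {q\<in>P1. dst q = u} \<le> card {q\<in>PL. dst q = u} + 1"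
  proof (cases "u = v")
    case True
    have "{q\<in>P1. dst q = u} = {}" using f_facts(5) True by (auto simp: state_def)
    then show ?thesis by (simp only: card.empty zero_le)
  next
    case False
    have c1: "card {i\<in>I. dst (\<sigma> i) = u \<and> \<sigma> i \<in> EL} \<le> Suc 0"
    proof (subst card_le_Suc0_iff_eq)
      show "finite {i\<in>I. dst (\<sigma> i) = u \<and> \<sigma> i \<in> EL}" using fin(5) by simp
      show "\<forall>x\<in>{i\<in>I. dst (\<sigma> i) = u \<and> \<sigma> i \<in> EL}. \<forall>y\<in>{i\<in>I. dst (\<sigma> i) = u \<and> \<sigma> i \<in> EL}. x = y"
        using EL_J_inj by blast
    qed
    have c2: "card {q\<in>P1. dst q = u} \<le> card {q\<in>PL - I - J. dst q = u} + card {i\<in>I. dst (\<sigma> i) = u \<and> \<sigma> i \<in> PL} + card {i\<in>I. dst (\<sigma> i) = u \<and> \<sigma> i \<in> EL}"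
    proof (rule card_le_cover[where f = f])
      fix q assume q: "q \<in> {q\<in>P1. dst q = u}"
      show "q \<in> {q\<in>PL - I - J. dst q = u} \<or> (\<exists>i\<in>{i\<in>I. dst (\<sigma> i) = u \<and> \<sigma> i \<in> PL}. q = f i) \<or> (\<exists>i\<in>{i\<in>I. dst (\<sigma> i) = u \<and> \<sigma> i \<in> EL}. q = f i)"
      proof (cases "q \<in> PL - I - J")
        case True then show ?thesis using q by simp
      next
        case False
        then have "q \<in> f ` N \<sigma>" using q unfolding PL1_def by blast
        then obtain i where i: "i \<in> I" "q = f i" using NI by blast
        have "dst (\<sigma> i) = u" using q i f_facts(4) by simp
        moreover have "\<sigma> i \<in> EL \<or> \<sigma> i \<in> PL" using \<sigma>_J[OF i(1)] IJ(3) by blast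
        ultimately show ?thesis using i by blast
      qed
    qed (use fin in simp_all)
    have c3: "card {i\<in>I. dst (\<sigma> i) = u \<and> \<sigma> i \<in> PL} = card (\<sigma> ` {i\<in>I. dst (\<sigma> i) = u \<and> \<sigma> i \<in> PL})"
      using \<sigma>_inj by (intro card_image[symmetric] inj_onI) blast
    have "card {q\<in>PL - I - J. dst q = u} + card (\<sigma> ` {i\<in>I. dst (\<sigma> i) = u \<and> \<sigma> i \<in> PL}) =
        card ({q\<in>PL - I - J. dst q = u} \<union> \<sigma> ` {i\<in>I. dst (\<sigma> i) = u \<and> \<sigma> i \<in> PL})"
      using fin \<sigma>_J by (intro card_Un_disjoint[symmetric]) auto
    also have "\<dots> \<le> card {q\<in>PL. dst q = u}" using fin by (intro card_mono) auto
    finally show ?thesis using c1 c2 c3 by linarith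
  qed
  show ?thesis using s t by (simp add: pending_def)
qed

text \<open>Two parallel promoted joins would share a simple in-link or a simple out-link at
  \<open>v\<close>, as simple links there are determined by their other end; mixed pairs are
  excluded by \<open>admissible\<close>.\<close>

lemma inj_promote2:
  assumes prom: "admissible prom"
  shows "inj_on pr ((EL1 \<union> f ` N1 \<sigma>) \<union> f ` N2 prom \<sigma>)" "N1 \<sigma> \<inter> N2 prom \<sigma> = {}"
    "f ` N2 prom \<sigma> \<subseteq> P1 - f ` N1 \<sigma>"
proof -
  have p: "src i \<noteq> dst (\<sigma> i) \<and> (src i, dst (\<sigma> i)) \<notin> E \<and> (i \<in> PL \<and> \<sigma> i \<in> EL \<or> i \<in> EL \<and> \<sigma> i \<in> PL) \<and> i \<in> I"
    if "i \<in> N2 prom \<sigma>" for i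
    using prom that unfolding admissible_def N2_def by blast
  show dis: "N1 \<sigma> \<inter> N2 prom \<sigma> = {}" using p N1_props EL_PL by blast
  have "f ` N2 prom \<sigma> \<subseteq> P1" using p by (auto simp: PL1_def N_def)
  moreover have "f ` N2 prom \<sigma> \<inter> f ` N1 \<sigma> = {}"
  proof -
    have "N1 \<sigma> \<subseteq> I" "N2 prom \<sigma> \<subseteq> I" by (auto simp: N1_def N2_def)
    then show ?thesis using dis inj_on_image_Int[OF f_facts(1), of "N2 prom \<sigma>" "N1 \<sigma>"] by (simp add: Int_commute)
  qed
  ultimately show "f ` N2 prom \<sigma> \<subseteq> P1 - f ` N1 \<sigma>" by blast
  have "inj_on pr (f ` N2 prom \<sigma>)"
  proof (rule inj_onI)
    fix x y assume "x \<in> f ` N2 prom \<sigma>" "y \<in> f ` N2 prom \<sigma>" and xy: "pr x = pr y"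
    then obtain i i' where i: "x = f i" "y = f i'" "i \<in> N2 prom \<sigma>" "i' \<in> N2 prom \<sigma>" by blast
    have eq: "src i = src i'" "dst (\<sigma> i) = dst (\<sigma> i')" using xy i p pr_f by auto
    have ne: "src l \<noteq> src l'" if "l \<in> PL" "l' \<in> EL" "l \<in> N2 prom \<sigma>" "l' \<in> N2 prom \<sigma>" for l l'
      using prom that unfolding admissible_def N2_def by blast
    have "i = i'"
    proof (cases "i \<in> PL")
      case True
      then have "i' \<in> PL" using ne[of i i'] eq p[OF i(4)] i by blast
      then have "\<sigma> i \<in> EL" "\<sigma> i' \<in> EL" using True p[OF i(3)] p[OF i(4)] EL_PL by auto
      then show ?thesis using EL_J_inj[of i i'] p[OF i(3)] p[OF i(4)] eq by blast
    next
      case False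
      then have "i \<in> EL" using p[OF i(3)] by blast
      then have "i' \<in> EL" using ne[of i' i] eq p[OF i(4)] i by metis
      then show ?thesis using EL_I_inj[of i i'] \<open>i \<in> EL\<close> p[OF i(3)] p[OF i(4)] eq by blast
    qed
    then show "x = y" using i by simp
  qed
  moreover have "pr (f i) \<notin> pr ` (EL1 \<union> f ` N1 \<sigma>)" if i: "i \<in> N2 prom \<sigma>" for i
  proof
    assume "pr (f i) \<in> pr ` (EL1 \<union> f ` N1 \<sigma>)"
    then consider "pr (f i) \<in> pr ` EL1" | i' where "i' \<in> N1 \<sigma>" "pr (f i) = pr (f i')" by blast
    then show False
    proof cases
      case 1
      then have "(src i, dst (\<sigma> i)) \<in> E" using p[OF i] pr_f[of i] by (auto simp: EL1_def)
      then show False using p[OF i] by blast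
    next
      case 2
      then have eq: "src i = src i'" "dst (\<sigma> i) = dst (\<sigma> i')"
        using p[OF i] N1_props[OF 2(1)] pr_f[of i] pr_f[of i'] by auto
      have "i = i'"
      proof (cases "i \<in> EL")
        case True
        then show ?thesis using EL_I_inj[of i i'] p[OF i] N1_props[OF 2(1)] eq by blast
      next
        case False
        then have "\<sigma> i \<in> EL" using p[OF i] by blast
        then show ?thesis using EL_J_inj[of i i'] p[OF i] N1_props[OF 2(1)] eq by blast
      qed
      then show False using dis i 2(1) by blast
    qed
  qed
  then have "pr ` (EL1 \<union> f ` N1 \<sigma>) \<inter> pr ` (f ` N2 prom \<sigma>) = {}"
    by (rule disjoint_imageI)
  ultimately show "inj_on pr ((EL1 \<union> f ` N1 \<sigma>) \<union> f ` N2 prom \<sigma>)"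
    using inj_promote1 unfolding inj_on_Un[of pr "EL1 \<union> f ` N1 \<sigma>"] by blast
qed

end

end

lemma real_divide_le_add:
  fixes D w :: real
  assumes "n \<le> m + p" "0 < D"
  shows "real n / D - w \<le> real m / D - w + real p / D"
proof -
  have "real n / D \<le> (real m + real p) / D"
    using assms by (intro divide_right_mono) linarith+
  then show ?thesis by (simp add: add_divide_distrib)
qed

lemma sum_add_scaled:
  fixes D :: real
  shows "(\<Sum>i\<in>N. g i + real (m i) / D) = (\<Sum>i\<in>N. g i) + real (\<Sum>i\<in>N. m i) / D"
  by (simp add: sum.distrib sum_divide_distrib)

context links begin

lemma weight_mono: "finite E \<Longrightarrow> E1 \<subseteq> E \<Longrightarrow> weight E1 a b \<le> weight E a b"
  unfolding weight_def by (intro add_mono divide_right_mono) (auto intro: codegree_mono)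

end

context elimination
begin

text \<open>Splice with all joins pending, then promote \<open>N1\<close> and afterwards
  \<open>N2\<close>. The joins in \<open>N1\<close> keep only their bumps, up to
  \<open>4 / 3\<close> in total. A promotion in \<open>N2\<close> frees a weight of at least 1 and
  causes a bump of at most \<open>xm + 2\<close> per end, hence the bound on the saving
  \<open>lam\<close>.\<close>

lemma eliminate:
  assumes \<sigma>: "bij_betw \<sigma> I J" and prom: "admissible prom"
    and lam: "\<And>i j. prom i j \<Longrightarrow> lam \<le> 1 - (2 * real xm + 4) / (3 * real d)"
    and xm: "\<And>u. pending u \<le> xm"
  shows "\<exists>EL' PL'. state (V - {v}) EL' PL' \<and>
    potential (V - {v}) EL' PL' \<le> potential V EL PL
      - (\<Sum>q\<in>PL \<inter> I. weight E (src q) (dst q)) - (\<Sum>q\<in>PL \<inter> J. weight E (src q) (dst q))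
      - (\<Sum>q\<in>PL. real (codegree_via E v (src q) (dst q))) / (3 * real d)
      - (real d - real (card J)) - real k / 5 * of_bool (card J < d)
      + real k / 5 * real (card (src ` (I - N \<sigma>))) + 4 / 3 + (\<Sum>i\<in>I. cost prom lam i (\<sigma> i))"
proof -
  obtain f where f: "spliced \<sigma> f" using exists_spliced[OF \<sigma>] by blast
  note ff = f_facts[OF \<sigma> f]
  let ?E1 = "pr ` EL1" and ?F1 = "f ` N1 \<sigma>" and ?F2 = "f ` N2 prom \<sigma>"
  let ?P1 = "PL1 \<sigma> f" and ?V = "V - {v}"
  let ?E2 = "pr ` (EL1 \<union> ?F1)" and ?P2 = "?P1 - ?F1"
  let ?E3 = "pr ` (EL1 \<union> ?F1 \<union> ?F2)" and ?P3 = "?P1 - ?F1 - ?F2"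
  note prom1 = promote[OF ff(5) fN1_PL1[OF \<sigma> f] inj_promote1[OF \<sigma> f]]
  note prom2 = promote[OF prom1(1) inj_promote2(3)[OF \<sigma> f prom] inj_promote2(1)[OF \<sigma> f prom]]
  have E1E: "?E1 \<subseteq> E" by (auto simp: EL1_def)
  have sub: "N1 \<sigma> \<subseteq> I" "N2 prom \<sigma> \<subseteq> I" "N \<sigma> \<subseteq> I" "N1 \<sigma> \<subseteq> N \<sigma>"
    by (auto simp: N1_def N2_def N_def)
  have inj: "inj_on f (N1 \<sigma>)" "inj_on f (N2 prom \<sigma>)"
    using ff(1) sub inj_on_subset by blast+
  have finP1: "finite ?P1" using fin finite_subset[OF sub(3)] unfolding PL1_def by auto
  have d0: "real d > 0" using d_pos by simp
  have s1: "(\<Sum>e\<in>?F1. real (bump src dst ?E2 ?P2 (src e) (dst e)) / (3 * real d) - weight ?E1 (src e) (dst e))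
    \<le> (\<Sum>i\<in>N1 \<sigma>. real (bump src dst E PL (src i) (dst (\<sigma> i))) / (3 * real d) - weight ?E1 (src i) (dst (\<sigma> i))) + 4 / 3"
  proof -
    let ?m = "\<lambda>i. (card {i'\<in>I. src i' = src i} + card {i'\<in>I. dst (\<sigma> i') = src i})
      + (card {i'\<in>I. src i' = dst (\<sigma> i)} + card {i'\<in>I. dst (\<sigma> i') = dst (\<sigma> i)})"
    have "(\<Sum>e\<in>?F1. real (bump src dst ?E2 ?P2 (src e) (dst e)) / (3 * real d) - weight ?E1 (src e) (dst e))
      = (\<Sum>i\<in>N1 \<sigma>. real (bump src dst ?E2 ?P2 (src i) (dst (\<sigma> i))) / (3 * real d) - weight ?E1 (src i) (dst (\<sigma> i)))"
      unfolding sum.reindex[OF inj(1)] o_def using ff(3,4) sub(1) by (intro sum.cong) auto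
    also have "\<dots> \<le> (\<Sum>i\<in>N1 \<sigma>. real (bump src dst E PL (src i) (dst (\<sigma> i))) / (3 * real d) - weight ?E1 (src i) (dst (\<sigma> i)) + real (?m i) / (3 * real d))"
    proof (rule sum_mono)
      fix i assume "i \<in> N1 \<sigma>"
      from bump_promote1[OF \<sigma> f this]
      have "bump src dst ?E2 ?P2 (src i) (dst (\<sigma> i)) \<le> bump src dst E PL (src i) (dst (\<sigma> i)) + ?m i" by linarith
      then show "real (bump src dst ?E2 ?P2 (src i) (dst (\<sigma> i))) / (3 * real d) - weight ?E1 (src i) (dst (\<sigma> i))
        \<le> real (bump src dst E PL (src i) (dst (\<sigma> i))) / (3 * real d) - weight ?E1 (src i) (dst (\<sigma> i)) + real (?m i) / (3 * real d)"
        using d0 by (intro real_divide_le_add) simp_all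
    qed
    also have "\<dots> = (\<Sum>i\<in>N1 \<sigma>. real (bump src dst E PL (src i) (dst (\<sigma> i))) / (3 * real d) - weight ?E1 (src i) (dst (\<sigma> i)))
      + real (\<Sum>i\<in>N1 \<sigma>. ?m i) / (3 * real d)"
      by (rule sum_add_scaled)
    also have "real (\<Sum>i\<in>N1 \<sigma>. ?m i) / (3 * real d) \<le> 4 / 3"
    proof -
      have "real (\<Sum>i\<in>N1 \<sigma>. ?m i) \<le> real (4 * d)"
        unfolding of_nat_le_iff using sum_new_stubs[OF \<sigma> f] card_I_J by linarith
      then show ?thesis using d0 by (simp only: divide_le_eq) simp
    qed
    finally show ?thesis by simp
  qed
  have s2: "(\<Sum>e\<in>?F2. real (bump src dst ?E3 ?P3 (src e) (dst e)) / (3 * real d) - weight ?E2 (src e) (dst e))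
    \<le> (\<Sum>i\<in>N2 prom \<sigma>. - lam)"
  proof -
    have "(\<Sum>e\<in>?F2. real (bump src dst ?E3 ?P3 (src e) (dst e)) / (3 * real d) - weight ?E2 (src e) (dst e))
      \<le> (\<Sum>e\<in>?F2. - lam)"
    proof (rule sum_mono)
      fix e assume "e \<in> ?F2"
      then obtain i where "prom i (\<sigma> i)" by (auto simp: N2_def)
      then have l: "lam \<le> 1 - (2 * real xm + 4) / (3 * real d)" by (rule lam)
      have finP3: "finite ?P3" using finP1 by simp
      have pe: "card {q\<in>?P3. src q = u} + card {q\<in>?P3. dst q = u} \<le> xm + 2" for u
      proof -
        have "card {q\<in>?P3. src q = u} \<le> card {q\<in>?P1. src q = u}"
          "card {q\<in>?P3. dst q = u} \<le> card {q\<in>?P1. dst q = u}"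
          using finP1 by (auto intro!: card_mono)
        then show ?thesis using pending_new_le[OF \<sigma> f, of u] xm[of u] by linarith
      qed
      have "bump src dst ?E3 ?P3 (src e) (dst e) \<le> 2 * xm + 4"
        using bump_le_stubs[OF finP3, of src dst ?E3 "src e" "dst e"] pe[of "src e"] pe[of "dst e"] by linarith
      then have "real (bump src dst ?E3 ?P3 (src e) (dst e)) \<le> real (2 * xm + 4)" by (simp only: of_nat_le_iff)
      then have "real (bump src dst ?E3 ?P3 (src e) (dst e)) / (3 * real d) \<le> (2 * real xm + 4) / (3 * real d)"
        using d0 by (intro divide_right_mono) auto
      then show "real (bump src dst ?E3 ?P3 (src e) (dst e)) / (3 * real d) - weight ?E2 (src e) (dst e) \<le> - lam"
        using l weight_ge_1[of ?E2 "src e" "dst e"] by linarith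
    qed
    then show ?thesis unfolding sum.reindex[OF inj(2)] o_def .
  qed
  have X1: "potential ?V EL1 ?P1 \<le> potential V EL PL
      - (\<Sum>q\<in>PL \<inter> I. weight E (src q) (dst q)) - (\<Sum>q\<in>PL \<inter> J. weight E (src q) (dst q))
      - (\<Sum>q\<in>PL. real (codegree_via E v (src q) (dst q))) / (3 * real d)
      - (real d - real (card J)) - real k / 5 * of_bool (card J < d)
      + real k / 5 * real (card (src ` (I - N \<sigma>))) + (\<Sum>i\<in>N \<sigma>. weight ?E1 (src i) (dst (\<sigma> i))) + real (card (I - N \<sigma>))"
    using pending_weight_spliced[OF \<sigma> f] defect_spliced[OF f] unfolding potential_def EL1_def PL1_def by linarith
  have "(\<Sum>i\<in>N \<sigma>. weight ?E1 (src i) (dst (\<sigma> i))) + real (card (I - N \<sigma>))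
      + (\<Sum>i\<in>N1 \<sigma>. real (bump src dst E PL (src i) (dst (\<sigma> i))) / (3 * real d) - weight ?E1 (src i) (dst (\<sigma> i)))
      + (\<Sum>i\<in>N2 prom \<sigma>. - lam) \<le> (\<Sum>i\<in>I. cost prom lam i (\<sigma> i))"
  proof -
    have ind: "(\<Sum>i\<in>S. g i) = (\<Sum>i\<in>I. if i \<in> S then g i else 0)" if "S \<subseteq> I" for S and g :: "'l \<Rightarrow> real"
      using sum.inter_restrict[OF fin(5), of g S] that by (simp only: Int_absorb1)
    have c: "real (card (I - N \<sigma>)) = (\<Sum>i\<in>I - N \<sigma>. 1)" by simp
    have ps: "(if i \<in> N \<sigma> then weight ?E1 (src i) (dst (\<sigma> i)) else 0) + (if i \<in> I - N \<sigma> then 1 else 0)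
        + (if i \<in> N1 \<sigma> then real (bump src dst E PL (src i) (dst (\<sigma> i))) / (3 * real d) - weight ?E1 (src i) (dst (\<sigma> i)) else 0)
        + (if i \<in> N2 prom \<sigma> then - lam else 0) \<le> cost prom lam i (\<sigma> i)" if i: "i \<in> I" for i
    proof -
      have n2: "i \<in> N2 prom \<sigma> \<longleftrightarrow> prom i (\<sigma> i)" using i by (simp only: N2_def mem_Collect_eq simp_thms)
      have n: "i \<in> N \<sigma> \<longleftrightarrow> src i \<noteq> dst (\<sigma> i)" using i by (simp only: N_def mem_Collect_eq simp_thms)
      have n1: "i \<in> N1 \<sigma> \<longleftrightarrow> src i \<noteq> dst (\<sigma> i) \<and> i \<in> EL \<and> \<sigma> i \<in> EL \<and> (src i, dst (\<sigma> i)) \<notin> E"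
        using i by (simp only: N1_def mem_Collect_eq simp_thms)
      have p: "prom i (\<sigma> i) \<Longrightarrow> src i \<noteq> dst (\<sigma> i) \<and> \<not> (i \<in> EL \<and> \<sigma> i \<in> EL)"
        using prom EL_PL unfolding admissible_def by blast
      have m: "weight ?E1 (src i) (dst (\<sigma> i)) \<le> weight E (src i) (dst (\<sigma> i))"
        by (rule weight_mono[OF fin(7) E1E])
      show ?thesis
        using m p i unfolding n2 n1 cost_def Diff_iff n
        by (auto split: if_splits)
    qed
    show ?thesis
      unfolding c ind[OF sub(1)] ind[OF sub(2)] ind[OF sub(3)] ind[of "I - N \<sigma>", OF Diff_subset] sum.distrib[symmetric]
      by (rule sum_mono) (rule ps)
  qed
  then have "potential ?V (EL1 \<union> ?F1 \<union> ?F2) ?P3 \<le> potential V EL PL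
      - (\<Sum>q\<in>PL \<inter> I. weight E (src q) (dst q)) - (\<Sum>q\<in>PL \<inter> J. weight E (src q) (dst q))
      - (\<Sum>q\<in>PL. real (codegree_via E v (src q) (dst q))) / (3 * real d)
      - (real d - real (card J)) - real k / 5 * of_bool (card J < d)
      + real k / 5 * real (card (src ` (I - N \<sigma>))) + 4 / 3 + (\<Sum>i\<in>I. cost prom lam i (\<sigma> i))"
    using prom1(2) prom2(2) s1 s2 X1 by linarith
  then show ?thesis using prom2(1) by blast
qed

end

section \<open>The averaged cost of an elimination\<close>

lemma codegree_commute: "codegree E a b = codegree E b a"
  by (simp add: codegree_def common_out_def Int_commute)

context links begin

lemma weight_commute: "weight E a b = weight E b a"
  by (simp add: weight_def codegree_commute)

text \<open>The codegrees of \<open>a\<close> with the elements of \<open>B\<close> total at most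
  \<open>k^2\<close>; over \<open>3 * d\<close> this is \<open>k / 300\<close>.\<close>

lemma row_sum_le:
  assumes E: "sparse_rel E k d" and B: "finite B" "card B \<le> d" and R: "R \<subseteq> B" "a \<notin> R" and L: "0 \<le> L"
  shows "(\<Sum>b\<in>B. if b = a then L else weight E a b - (if b \<in> R then lam else 0))
    \<le> L + real (card B) + real k / 300 - lam * real (card R)"
proof -
  have "(\<Sum>b\<in>B. if b = a then L else weight E a b - (if b \<in> R then lam else 0))
    \<le> (\<Sum>b\<in>B. (if b = a then L else 0) + weight E a b - (if b \<in> R then lam else 0))"
    by (intro sum_mono) (use weight_ge_1[of E a] R L in \<open>auto intro: order_trans[OF zero_le_one]\<close>)
  also have "\<dots> = (\<Sum>b\<in>B. if b = a then L else 0) + (\<Sum>b\<in>B. weight E a b) - (\<Sum>b\<in>B. if b \<in> R then lam else 0)"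
    by (simp add: sum.distrib sum_subtractf)
  also have "(\<Sum>b\<in>B. if b \<in> R then lam else 0) = lam * real (card R)"
    using sum.inter_restrict[OF B(1), of "\<lambda>_. lam" R, symmetric] R by (simp add: Int_absorb1 mult.commute)
  also have "(\<Sum>b\<in>B. if b = a then L else 0) \<le> L"
    using B L by simp
  also have "(\<Sum>b\<in>B. weight E a b) \<le> real (card B) + real k / 300"
  proof -
    have "(\<Sum>b\<in>B. weight E a b) = real (card B) + real (\<Sum>b\<in>B. codegree E a b) / (3 * real d)"
      unfolding weight_def by (simp add: sum.distrib sum_divide_distrib)
    also have "real (\<Sum>b\<in>B. codegree E a b) / (3 * real d) \<le> (real k)\<^sup>2 / (3 * real d)"
      using sparse_rel.sum_codegree_le[OF E B] by (intro divide_right_mono) auto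
    also have "(real k)\<^sup>2 / (3 * real d) = real k / 300"
      using k d by (simp add: power2_eq_square)
    finally show ?thesis by simp
  qed
  finally show ?thesis by simp
qed

end

context elimination
begin

lemma Adm_EL: "Adm EL"
  using w Adm_mono[of Q EL] by (auto simp: state_def)

lemma card_Image_le:
  "card (E `` {a}) \<le> d" "card (E\<inverse> `` {a}) \<le> d"
proof -
  have finQ: "finite (outs Q a)" "finite (ins Q a)" using fin by (auto simp: ins_def outs_def)
  have b: "card (outs Q a) \<le> d \<and> card (ins Q a) \<le> d"
  proof (cases "a \<in> V")
    case True then show ?thesis using w by (auto simp: state_def)
  next
    case False
    then have "outs Q a = {}" "ins Q a = {}" using ends by (auto simp: ins_def outs_def)
    then show ?thesis by simp
  qed
  have "E `` {a} \<subseteq> dst ` outs Q a" "E\<inverse> `` {a} \<subseteq> src ` ins Q a"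
    by (auto simp: pr_def outs_def ins_def)
  then have "card (E `` {a}) \<le> card (outs Q a)" "card (E\<inverse> `` {a}) \<le> card (ins Q a)"
    using finQ by (meson card_image_le card_mono finite_imageI order_trans)+
  then show "card (E `` {a}) \<le> d" "card (E\<inverse> `` {a}) \<le> d" using b by auto
qed

lemma sparse_E: "sparse_rel E k d"
proof
  fix S :: "'a set" assume "finite S" "card S \<le> 200 * k"
  moreover have "inj_on (\<lambda>q. (src q, dst q)) EL" using w by (simp add: state_def pr_def[abs_def])
  ultimately show "real (card (E \<inter> S \<times> S)) \<le> (real k)\<^sup>2 / 2"
    using Adm_sparse[OF Adm_EL] ends(3) unfolding pr_def[abs_def] by blast
qed (use d k fin card_Image_le in auto)

definition "A = E\<inverse> `` {v}"
definition "B = E `` {v}"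

lemma A_B: "finite A" "finite B" "A = src ` (I \<inter> EL)" "B = dst ` (J \<inter> EL)"
  "inj_on src (I \<inter> EL)" "inj_on dst (J \<inter> EL)" "card A = card (I \<inter> EL)" "card B = card (J \<inter> EL)"
proof -
  show "finite A" "finite B" using fin(7) finite_Image_finite unfolding A_def B_def by auto
  show A: "A = src ` (I \<inter> EL)" and B: "B = dst ` (J \<inter> EL)"
    by (auto simp: A_def B_def ins_def outs_def pr_def image_iff)
  show i: "inj_on src (I \<inter> EL)" "inj_on dst (J \<inter> EL)"
    using inj_pr IJ(4,5) by (auto intro!: inj_onI)
  show "card A = card (I \<inter> EL)" "card B = card (J \<inter> EL)"
    unfolding A B using i by (auto simp: card_image)
qed

lemma card_split: "card I = card (I \<inter> EL) + card (I \<inter> PL)" "card J = card (J \<inter> EL) + card (J \<inter> PL)"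
proof -
  have "I = (I \<inter> EL) \<union> (I \<inter> PL)" "J = (J \<inter> EL) \<union> (J \<inter> PL)" using IJ(2,3) by blast+
  moreover have "card ((I \<inter> EL) \<union> (I \<inter> PL)) = card (I \<inter> EL) + card (I \<inter> PL)"
    "card ((J \<inter> EL) \<union> (J \<inter> PL)) = card (J \<inter> EL) + card (J \<inter> PL)"
    using fin EL_PL by (auto intro!: card_Un_disjoint)
  ultimately show "card I = card (I \<inter> EL) + card (I \<inter> PL)" "card J = card (J \<inter> EL) + card (J \<inter> PL)" by metis+
qed

lemma weight_le: "weight E a b \<le> 5 / 3"
proof -
  have "real (codegree E a b) \<le> real (2 * d)" using sparse_rel.codegree_le[OF sparse_E] by (simp only: of_nat_le_iff)
  then show ?thesis using d_pos by (simp add: weight_def divide_le_eq)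
qed

lemma pending_le: "pending u \<le> 2 * d"
proof (cases "u \<in> V")
  case True
  have "card {q\<in>PL. src q = u} \<le> card (outs Q u)" "card {q\<in>PL. dst q = u} \<le> card (ins Q u)"
    using fin by (auto intro!: card_mono simp: ins_def outs_def)
  then show ?thesis using w True unfolding pending_def state_def by fastforce
next
  case False
  then have "{q\<in>PL. src q = u} = {}" "{q\<in>PL. dst q = u} = {}" using ends by auto
  then show ?thesis unfolding pending_def by (metis card.empty add_0 le0)
qed

lemma cost_bounds:
  assumes "src i \<noteq> dst j" "0 \<le> lam" "lam \<le> 1"
  shows "cost prom lam i j \<le> 5 / 3" "0 \<le> cost prom lam i j"
proof -
  have "bump src dst E PL (src i) (dst j) \<le> 4 * d"
    using bump_le_stubs[OF fin(3), of src dst E "src i" "dst j"] pending_le[of "src i"] pending_le[of "dst j"]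
    unfolding pending_def by linarith
  then have "real (bump src dst E PL (src i) (dst j)) \<le> real (4 * d)" by (simp only: of_nat_le_iff)
  then have b: "real (bump src dst E PL (src i) (dst j)) / (3 * real d) \<le> 5 / 3"
    using d_pos by (simp add: divide_le_eq)
  show "cost prom lam i j \<le> 5 / 3"
    using assms b weight_le[of "src i" "dst j"] unfolding cost_def by auto
  show "0 \<le> cost prom lam i j"
    using assms weight_ge_1[of E "src i" "dst j"] unfolding cost_def by auto
qed

text \<open>
  The flags select on which sides of the vertex pending links may be promoted. If both are
  used, an out-side promotion must avoid the tails of pending in-links, as otherwise two promotions
  could yield parallel links.
\<close>

definition promotable :: "bool \<Rightarrow> bool \<Rightarrow> 'l \<Rightarrow> 'l \<Rightarrow> bool" where
  "promotable s t i j \<longleftrightarrow> src i \<noteq> dst j \<and> (src i, dst j) \<notin> E \<and>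
     (s \<and> i \<in> PL \<and> j \<in> EL \<or> t \<and> i \<in> EL \<and> j \<in> PL \<and> (s \<longrightarrow> src i \<notin> src ` (I \<inter> PL)))"

lemma admissible_promotable_on: "admissible (\<lambda>i j. i \<in> I \<and> promotable s t i j)"
  unfolding admissible_def
proof (intro conjI allI impI)
  fix i j i' j'
  assume a: "(i \<in> I \<and> promotable s t i j) \<and> i \<in> PL \<and> (i' \<in> I \<and> promotable s t i' j') \<and> i' \<in> EL"
  then have "s" using EL_PL unfolding promotable_def by blast
  moreover have "i' \<notin> PL" using a EL_PL by blast
  ultimately have "src i' \<notin> src ` (I \<inter> PL)" using a unfolding promotable_def by blast
  moreover have "src i \<in> src ` (I \<inter> PL)" using a by blast
  ultimately show "src i \<noteq> src i'" by metis
qed (auto simp: promotable_def)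

text \<open>An artificially raised price \<open>L\<close> for loops makes the swap lemmas
  applicable. No other join costs more than \<open>5 / 3\<close>, so \<open>L = 5 / 3\<close>
  gathers the loops at one vertex and \<open>L = 10 / 3\<close> can remove them all.\<close>

definition pair_cost :: "real \<Rightarrow> ('l \<Rightarrow> 'l \<Rightarrow> bool) \<Rightarrow> real \<Rightarrow> 'l \<Rightarrow> 'l \<Rightarrow> real" where
  "pair_cost L prom lam i j = (if src i = dst j then L else cost prom lam i j)"

text \<open>Blocked pairs are elements of \<open>E\<close> between \<open>A\<close> and
  \<open>B\<close>: at most \<open>k^2 / 2\<close>, each of weight at most \<open>5 / 3\<close>. The
  bumps sum to at most \<open>3 * k * xm * card I\<close>, to be divided by \<open>3 * d\<close>.
  Each tail equals at most one head, which bounds the loops.\<close>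

lemma sum_EE:
  assumes L: "0 \<le> L" and xm: "\<And>u. pending u \<le> xm"
  shows "(\<Sum>i\<in>I \<inter> EL. \<Sum>j\<in>J \<inter> EL. pair_cost L prom lam i j)
    \<le> L * real (card I) + 5 * (real k)\<^sup>2 / 6 + real xm * real (card I) / 100"
proof -
  let ?c = "\<lambda>a b. (if b = a then L else 0) + 5 / 3 * of_bool ((a, b) \<in> E) + real (bump src dst E PL a b) / (3 * real d)"
  have "pair_cost L prom lam i j \<le> ?c (src i) (dst j)" if "i \<in> I \<inter> EL" "j \<in> J \<inter> EL" for i j
  proof -
    have nn: "0 \<le> real (bump src dst E PL (src i) (dst j)) / (3 * real d)" by simp
    have "i \<in> EL" "j \<in> EL" using that by auto
    then show ?thesis using weight_le[of "src i" "dst j"] L nn unfolding pair_cost_def cost_def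
      by (cases "src i = dst j"; cases "(src i, dst j) \<in> E") (simp_all add: add_increasing2)
  qed
  then have "(\<Sum>i\<in>I \<inter> EL. \<Sum>j\<in>J \<inter> EL. pair_cost L prom lam i j) \<le> (\<Sum>i\<in>I \<inter> EL. \<Sum>j\<in>J \<inter> EL. ?c (src i) (dst j))"
    by (intro sum_mono)
  also have "\<dots> = (\<Sum>a\<in>A. \<Sum>b\<in>B. ?c a b)"
    unfolding A_B(3,4) sum.reindex[OF A_B(5)] sum.reindex[OF A_B(6)] o_def ..
  also have "\<dots> = (\<Sum>a\<in>A. \<Sum>b\<in>B. if b = a then L else 0) + 5 / 3 * (\<Sum>a\<in>A. \<Sum>b\<in>B. of_bool ((a, b) \<in> E))
      + real (\<Sum>a\<in>A. \<Sum>b\<in>B. bump src dst E PL a b) / (3 * real d)"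
    by (simp add: sum.distrib sum_distrib_left sum_divide_distrib)
  also have "(\<Sum>a\<in>A. \<Sum>b\<in>B. if b = a then L else 0) \<le> (\<Sum>a\<in>A. L)"
    using A_B(2) L by (intro sum_mono) simp
  also have "(\<Sum>a\<in>A. L) \<le> L * real (card I)"
    using L A_B(7) card_split(1) by (simp add: mult.commute mult_left_mono)
  also have "(\<Sum>a\<in>A. \<Sum>b\<in>B. of_bool ((a, b) \<in> E)) = real (card (E \<inter> A \<times> B))"
  proof -
    have "(\<Sum>a\<in>A. \<Sum>b\<in>B. of_bool ((a, b) \<in> E)) = (\<Sum>p\<in>A \<times> B. of_bool (p \<in> E) :: real)"
      by (simp add: sum.cartesian_product case_prod_unfold)
    also have "\<dots> = real (card (A \<times> B \<inter> {p. p \<in> E}))"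
      by (rule sum_of_bool_eq) (rule finite_cartesian_product[OF A_B(1,2)])+
    finally show ?thesis by (simp add: Int_commute)
  qed
  also have "real (card (E \<inter> A \<times> B)) \<le> (real k)\<^sup>2 / 2"
    using A_B card_split card_I_J by (intro sparse_rel.sparse_bip[OF sparse_E]) auto
  also have "real (\<Sum>a\<in>A. \<Sum>b\<in>B. bump src dst E PL a b) / (3 * real d) \<le> real xm * real (card I) / 100"
  proof -
    have "(\<Sum>a\<in>A. \<Sum>b\<in>B. bump src dst E PL a b) \<le> 3 * k * xm * card I"
      using A_B card_split card_I_J fin(3) xm unfolding pending_def
      by (intro sparse_rel.sum_bump_le[OF sparse_E]) auto
    then have "real (\<Sum>a\<in>A. \<Sum>b\<in>B. bump src dst E PL a b) \<le> real (3 * k * xm * card I)"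
      by (simp only: of_nat_le_iff)
    then have "real (\<Sum>a\<in>A. \<Sum>b\<in>B. bump src dst E PL a b) / (3 * real d) \<le> real (3 * k * xm * card I) / (3 * real d)"
      by (rule divide_right_mono) simp
    also have "\<dots> = real xm * real (card I) / 100" using k d by (simp add: field_simps)
    finally show ?thesis .
  qed
  finally show ?thesis by simp
qed

text \<open>For a fixed pending in-link the promotion fails at most for the head equal to its tail
  and for the blocking heads, which are common out-neighbours of \<open>src i\<close> and
  \<open>v\<close>.\<close>

lemma sum_PE:
  assumes L: "0 \<le> L" and i: "i \<in> I \<inter> PL" and lam: "0 \<le> lam"
  shows "(\<Sum>j\<in>J \<inter> EL. pair_cost L (\<lambda>i j. i \<in> I \<and> promotable s t i j) lam i j)
    \<le> L + real (card B) + real k / 300 - lam * of_bool s * (real (card B) - 1 - real (common_out E (src i) v))"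
proof -
  let ?a = "src i"
  define R where "R = {b\<in>B. s \<and> b \<noteq> ?a \<and> (?a, b) \<notin> E}"
  have i': "i \<in> I" "i \<in> PL" "i \<notin> EL" using i EL_PL by auto
  have "pair_cost L (\<lambda>i j. i \<in> I \<and> promotable s t i j) lam i j = (if dst j = ?a then L else weight E ?a (dst j) - (if dst j \<in> R then lam else 0))"
    if j: "j \<in> J \<inter> EL" for j
  proof -
    have "dst j \<in> B" using j A_B(4) by simp
    then show ?thesis using i' j EL_PL unfolding pair_cost_def cost_def promotable_def R_def by auto
  qed
  then have "(\<Sum>j\<in>J \<inter> EL. pair_cost L (\<lambda>i j. i \<in> I \<and> promotable s t i j) lam i j) =
      (\<Sum>j\<in>J \<inter> EL. if dst j = ?a then L else weight E ?a (dst j) - (if dst j \<in> R then lam else 0))"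
    by (intro sum.cong) auto
  also have "\<dots> = (\<Sum>b\<in>B. if b = ?a then L else weight E ?a b - (if b \<in> R then lam else 0))"
    unfolding A_B(4) sum.reindex[OF A_B(6)] o_def ..
  also have "\<dots> \<le> L + real (card B) + real k / 300 - lam * real (card R)"
    using A_B card_split card_I_J L by (intro row_sum_le[OF sparse_E]) (auto simp: R_def)
  finally have up: "(\<Sum>j\<in>J \<inter> EL. pair_cost L (\<lambda>i j. i \<in> I \<and> promotable s t i j) lam i j) \<le> L + real (card B) + real k / 300 - lam * real (card R)" .
  have "lam * real (card R) \<ge> lam * of_bool s * (real (card B) - 1 - real (common_out E ?a v))"
  proof (cases s)
    case True
    have "B \<subseteq> R \<union> {?a} \<union> (E `` {?a} \<inter> E `` {v})" using True by (auto simp: R_def B_def)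
    then have "card B \<le> card (R \<union> {?a} \<union> (E `` {?a} \<inter> E `` {v}))"
      using A_B(2) finite_Image_finite[OF fin(7)] by (intro card_mono) (auto simp: R_def)
    also have "\<dots> \<le> card R + card {?a} + card (E `` {?a} \<inter> E `` {v})"
      by (meson card_Un_le add_le_mono le_refl order_trans)
    finally have "card B \<le> card R + 1 + common_out E ?a v" by (simp add: common_out_def)
    then have "real (card B) - 1 - real (common_out E ?a v) \<le> real (card R)" by linarith
    then show ?thesis using True lam by (simp add: mult_left_mono)
  qed (use lam in simp)
  with up show ?thesis by linarith
qed

text \<open>The mirror image of the previous count, except that tails of pending in-links must also
  be avoided if both sides are promoted.\<close>

lemma sum_EP:
  assumes L: "0 \<le> L" and j: "j \<in> J \<inter> PL" and lam: "0 \<le> lam"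
  shows "(\<Sum>i\<in>I \<inter> EL. pair_cost L (\<lambda>i j. i \<in> I \<and> promotable s t i j) lam i j)
    \<le> L + real (card A) + real k / 300
      - lam * of_bool t * (real (card A) - 1 - of_bool s * real (card (I \<inter> PL)) - real (common_out (E\<inverse>) (dst j) v))"
proof -
  let ?b = "dst j"
  define R where "R = {a\<in>A. t \<and> a \<noteq> ?b \<and> (a, ?b) \<notin> E \<and> (s \<longrightarrow> a \<notin> src ` (I \<inter> PL))}"
  have j': "j \<in> J" "j \<in> PL" "j \<notin> EL" using j EL_PL by auto
  have "pair_cost L (\<lambda>i j. i \<in> I \<and> promotable s t i j) lam i j = (if src i = ?b then L else weight E ?b (src i) - (if src i \<in> R then lam else 0))"
    if i: "i \<in> I \<inter> EL" for i
  proof -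
    have "src i \<in> A" using i A_B(3) by simp
    moreover have "i \<notin> PL" using i EL_PL by auto
    ultimately show ?thesis using j' i unfolding pair_cost_def cost_def promotable_def R_def weight_commute[of E ?b]
      by (simp only: Int_iff) auto
  qed
  then have "(\<Sum>i\<in>I \<inter> EL. pair_cost L (\<lambda>i j. i \<in> I \<and> promotable s t i j) lam i j) =
      (\<Sum>i\<in>I \<inter> EL. if src i = ?b then L else weight E ?b (src i) - (if src i \<in> R then lam else 0))"
    by (intro sum.cong) auto
  also have "\<dots> = (\<Sum>a\<in>A. if a = ?b then L else weight E ?b a - (if a \<in> R then lam else 0))"
    unfolding A_B(3) sum.reindex[OF A_B(5)] o_def ..
  also have "\<dots> \<le> L + real (card A) + real k / 300 - lam * real (card R)"
    using A_B card_split card_I_J L by (intro row_sum_le[OF sparse_E]) (auto simp: R_def)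
  finally have up: "(\<Sum>i\<in>I \<inter> EL. pair_cost L (\<lambda>i j. i \<in> I \<and> promotable s t i j) lam i j) \<le> L + real (card A) + real k / 300 - lam * real (card R)" .
  have "lam * real (card R) \<ge> lam * of_bool t * (real (card A) - 1 - of_bool s * real (card (I \<inter> PL)) - real (common_out (E\<inverse>) ?b v))"
  proof (cases t)
    case True
    let ?S = "if s then src ` (I \<inter> PL) else {}"
    have "A \<subseteq> R \<union> {?b} \<union> (E\<inverse> `` {?b} \<inter> E\<inverse> `` {v}) \<union> ?S" using True unfolding R_def A_def by auto
    then have "card A \<le> card (R \<union> {?b} \<union> (E\<inverse> `` {?b} \<inter> E\<inverse> `` {v}) \<union> ?S)"
      using A_B(1) fin finite_Image_finite[of "E\<inverse>"] by (intro card_mono) (auto simp: R_def)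
    also have "\<dots> \<le> card R + card {?b} + card (E\<inverse> `` {?b} \<inter> E\<inverse> `` {v}) + card ?S"
      by (meson card_Un_le add_le_mono le_refl order_trans)
    also have "card ?S \<le> of_bool s * card (I \<inter> PL)"
      using card_image_le[of "I \<inter> PL" src] fin by simp
    finally have "card A \<le> card R + 1 + common_out (E\<inverse>) ?b v + of_bool s * card (I \<inter> PL)" by (simp add: common_out_def)
    then have "real (card A) \<le> real (card R + 1 + common_out (E\<inverse>) ?b v + of_bool s * card (I \<inter> PL))" by (simp only: of_nat_le_iff)
    then have "real (card A) - 1 - of_bool s * real (card (I \<inter> PL)) - real (common_out (E\<inverse>) ?b v) \<le> real (card R)" by simp
    then show ?thesis using True lam by (simp add: mult_left_mono)
  qed (use lam in simp)
  with up show ?thesis by linarith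
qed

definition "Cin = (\<Sum>i\<in>I \<inter> PL. real (common_out E (src i) v))"
definition "Cout = (\<Sum>j\<in>J \<inter> PL. real (common_out (E\<inverse>) (dst j) v))"

text \<open>Bounds the pair costs summed over all of \<open>I\<close> and \<open>J\<close>: first
  the pairs of simple links, then pending with simple, simple with pending, and finally two pending
  links at price \<open>L\<close> each.\<close>

definition total :: "real \<Rightarrow> bool \<Rightarrow> bool \<Rightarrow> real \<Rightarrow> real \<Rightarrow> real" where
  "total L s t lam xm = L * real (card I) + 5 * (real k)\<^sup>2 / 6 + xm * real (card I) / 100
    + real (card (I \<inter> PL)) * (L + real (card B) + real k / 300)
    - lam * of_bool s * (real (card (I \<inter> PL)) * (real (card B) - 1) - Cin)
    + real (card (J \<inter> PL)) * (L + real (card A) + real k / 300)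
    - lam * of_bool t * (real (card (J \<inter> PL)) * (real (card A) - 1 - of_bool s * real (card (I \<inter> PL))) - Cout)
    + L * real (card (I \<inter> PL)) * real (card (J \<inter> PL))"

lemma sum_pair_cost_le:
  assumes L: "5 / 3 \<le> L" and lam: "0 \<le> lam" "lam \<le> 1" and xm: "\<And>u. pending u \<le> xm"
  shows "(\<Sum>i\<in>I. \<Sum>j\<in>J. pair_cost L (\<lambda>i j. i \<in> I \<and> promotable s t i j) lam i j) \<le> total L s t lam (real xm)"
proof -
  let ?c = "pair_cost L (\<lambda>i j. i \<in> I \<and> promotable s t i j) lam"
  have L0: "0 \<le> L" using L by simp
  have splitI: "(\<Sum>i\<in>I. g i) = (\<Sum>i\<in>I \<inter> EL. g i) + (\<Sum>i\<in>I \<inter> PL. g i)" for g :: "'l \<Rightarrow> real"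
  proof -
    have "sum g ((I \<inter> EL) \<union> (I \<inter> PL)) = sum g (I \<inter> EL) + sum g (I \<inter> PL)"
      using fin EL_PL by (intro sum.union_disjoint) auto
    moreover have "(I \<inter> EL) \<union> (I \<inter> PL) = I" using IJ(2) by blast
    ultimately show ?thesis by metis
  qed
  have splitJ: "(\<Sum>i\<in>J. g i) = (\<Sum>i\<in>J \<inter> EL. g i) + (\<Sum>i\<in>J \<inter> PL. g i)" for g :: "'l \<Rightarrow> real"
  proof -
    have "sum g ((J \<inter> EL) \<union> (J \<inter> PL)) = sum g (J \<inter> EL) + sum g (J \<inter> PL)"
      using fin EL_PL by (intro sum.union_disjoint) auto
    moreover have "(J \<inter> EL) \<union> (J \<inter> PL) = J" using IJ(3) by blast
    ultimately show ?thesis by metis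
  qed
  have "(\<Sum>i\<in>I \<inter> PL. \<Sum>j\<in>J \<inter> EL. ?c i j) \<le>
      (\<Sum>i\<in>I \<inter> PL. L + real (card B) + real k / 300 - lam * of_bool s * (real (card B) - 1 - real (common_out E (src i) v)))"
    by (intro sum_mono sum_PE L0 lam)
  also have "\<dots> = real (card (I \<inter> PL)) * (L + real (card B) + real k / 300)
    - lam * of_bool s * (real (card (I \<inter> PL)) * (real (card B) - 1) - Cin)"
    by (simp add: sum_subtractf sum_distrib_left[symmetric] Cin_def)
  finally have PE: "(\<Sum>i\<in>I \<inter> PL. \<Sum>j\<in>J \<inter> EL. ?c i j) \<le> real (card (I \<inter> PL)) * (L + real (card B) + real k / 300)
    - lam * of_bool s * (real (card (I \<inter> PL)) * (real (card B) - 1) - Cin)" .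
  have "(\<Sum>i\<in>I \<inter> EL. \<Sum>j\<in>J \<inter> PL. ?c i j) = (\<Sum>j\<in>J \<inter> PL. \<Sum>i\<in>I \<inter> EL. ?c i j)"
    by (rule sum.swap)
  also have "\<dots> \<le> (\<Sum>j\<in>J \<inter> PL. L + real (card A) + real k / 300
      - lam * of_bool t * (real (card A) - 1 - of_bool s * real (card (I \<inter> PL)) - real (common_out (E\<inverse>) (dst j) v)))"
    by (intro sum_mono sum_EP L0 lam)
  also have "\<dots> = real (card (J \<inter> PL)) * (L + real (card A) + real k / 300)
    - lam * of_bool t * (real (card (J \<inter> PL)) * (real (card A) - 1 - of_bool s * real (card (I \<inter> PL))) - Cout)"
    by (simp add: sum_subtractf sum_distrib_left[symmetric] Cout_def)
  finally have EP: "(\<Sum>i\<in>I \<inter> EL. \<Sum>j\<in>J \<inter> PL. ?c i j) \<le> real (card (J \<inter> PL)) * (L + real (card A) + real k / 300)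
    - lam * of_bool t * (real (card (J \<inter> PL)) * (real (card A) - 1 - of_bool s * real (card (I \<inter> PL))) - Cout)" .
  have "?c i j \<le> L" for i j
  proof (cases "src i = dst j")
    case False
    have "cost (\<lambda>i j. i \<in> I \<and> promotable s t i j) lam i j \<le> 5 / 3" by (rule cost_bounds(1)[OF False lam])
    then show ?thesis using L False by (simp add: pair_cost_def)
  qed (simp add: pair_cost_def)
  then have "(\<Sum>i\<in>I \<inter> PL. \<Sum>j\<in>J \<inter> PL. ?c i j) \<le> (\<Sum>i\<in>I \<inter> PL. \<Sum>j\<in>J \<inter> PL. L)"
    by (intro sum_mono)
  then have PP: "(\<Sum>i\<in>I \<inter> PL. \<Sum>j\<in>J \<inter> PL. ?c i j) \<le> L * real (card (I \<inter> PL)) * real (card (J \<inter> PL))"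
    by (simp add: mult_ac)
  show ?thesis
    using PE EP PP sum_EE[OF L0 xm, of "\<lambda>i j. i \<in> I \<and> promotable s t i j" lam]
    unfolding total_def splitI splitJ sum.distrib by linarith
qed

text \<open>\<open>Dv\<close> and \<open>Kv\<close> are the two refunds of codegree weight: from the
  pending links that end at \<open>v\<close> and are used up, and from all others, for which
  \<open>v\<close> ceases to be a common neighbour.\<close>

definition "Dv = (\<Sum>q\<in>PL \<inter> I. real (codegree E (src q) (dst q))) + (\<Sum>q\<in>PL \<inter> J. real (codegree E (src q) (dst q)))"
definition "Kv = (\<Sum>q\<in>PL. real (codegree_via E v (src q) (dst q)))"
definition "xi = real (card (I \<inter> PL))"
definition "xo = real (card (J \<inter> PL))"
definition "T = real (card I)"
definition "base = potential V EL PL - (xi + xo) - Dv / (3 * real d) - Kv / (3 * real d)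
  - (real d - T) - real k / 5 * of_bool (card I < d) + 4 / 3"

definition reaches :: "real \<Rightarrow> bool" where
  "reaches c \<longleftrightarrow> (\<exists>EL' PL'. state (V - {v}) EL' PL' \<and> potential (V - {v}) EL' PL' \<le> c)"

lemma reaches_mono: "reaches c \<Longrightarrow> c \<le> c' \<Longrightarrow> reaches c'"
  unfolding reaches_def by force

lemma xi_xo: "0 \<le> xi" "0 \<le> xo" "xi \<le> T" "xo \<le> T" "T \<le> real d" "real (pending v) = xi + xo"
  "real (card A) = T - xi" "real (card B) = T - xo" "T = real (card J)"
proof -
  have "{q\<in>PL. dst q = v} = I \<inter> PL" "{q\<in>PL. src q = v} = J \<inter> PL" by (auto simp: ins_def outs_def)
  then show "real (pending v) = xi + xo" by (simp add: pending_def xi_def xo_def)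
  show "0 \<le> xi" "0 \<le> xo" "xi \<le> T" "xo \<le> T" "T \<le> real d" "T = real (card J)"
    using card_split card_I_J by (auto simp: xi_def xo_def T_def)
  show "real (card A) = T - xi" "real (card B) = T - xo"
    using card_split card_I_J A_B by (auto simp: xi_def xo_def T_def)
qed

text \<open>The vertices blocking the promotion of a pending link at \<open>v\<close> are common
  neighbours of its own two ends, so the refund \<open>Dv\<close> accounts for them.\<close>

lemma Cin_Cout_le: "Cin \<ge> 0" "Cout \<ge> 0" "Cin + Cout \<le> Dv"
proof -
  show "Cin \<ge> 0" "Cout \<ge> 0" unfolding Cin_def Cout_def by (auto intro: sum_nonneg)
  have "Cin \<le> (\<Sum>q\<in>I \<inter> PL. real (codegree E (src q) (dst q)))"
    unfolding Cin_def using IJ(4) by (intro sum_mono) (auto simp: codegree_def)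
  moreover have "Cout \<le> (\<Sum>q\<in>J \<inter> PL. real (codegree E (src q) (dst q)))"
  proof -
    have "common_out (E\<inverse>) (dst q) v \<le> codegree E (src q) (dst q)" if "q \<in> J" for q
      using IJ(5)[OF that] unfolding codegree_def common_out_def by (simp add: Int_commute)
    then show ?thesis unfolding Cout_def by (intro sum_mono) auto
  qed
  ultimately show "Cin + Cout \<le> Dv" by (simp add: Dv_def Int_commute)
qed

section \<open>From a pairing at the vertex to the potential after its elimination\<close>

lemma reaches_from_pairing:
  assumes \<sigma>: "bij_betw \<sigma> I J"
    and lam: "s \<or> t \<Longrightarrow> lam \<le> 1 - (2 * real xm + 4) / (3 * real d)"
    and xm: "\<And>u. pending u \<le> xm" and L: "1 \<le> L"
    and c: "(\<Sum>i\<in>I. pair_cost L (\<lambda>i j. i \<in> I \<and> promotable s t i j) lam i (\<sigma> i)) \<le> c"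
    and nd: "card (src ` (I - N \<sigma>)) \<le> nd"
  shows "reaches (base + real k / 5 * real nd + c)"
proof -
  let ?p = "\<lambda>i j. i \<in> I \<and> promotable s t i j"
  have l: "lam \<le> 1 - (2 * real xm + 4) / (3 * real d)" if "?p i j" for i j
    using that by (intro lam) (auto simp: promotable_def)
  have "\<exists>EL' PL'. state (V - {v}) EL' PL' \<and> potential (V - {v}) EL' PL' \<le> potential V EL PL
      - (\<Sum>q\<in>PL \<inter> I. weight E (src q) (dst q)) - (\<Sum>q\<in>PL \<inter> J. weight E (src q) (dst q))
      - (\<Sum>q\<in>PL. real (codegree_via E v (src q) (dst q))) / (3 * real d)
      - (real d - real (card J)) - real k / 5 * of_bool (card J < d)
      + real k / 5 * real (card (src ` (I - N \<sigma>))) + 4 / 3 + (\<Sum>i\<in>I. cost ?p lam i (\<sigma> i))"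
    by (rule eliminate[OF \<sigma> admissible_promotable_on _ xm]) (rule l)
  then obtain EL' PL' where w': "state (V - {v}) EL' PL'" and le: "potential (V - {v}) EL' PL' \<le> potential V EL PL
      - (\<Sum>q\<in>PL \<inter> I. weight E (src q) (dst q)) - (\<Sum>q\<in>PL \<inter> J. weight E (src q) (dst q))
      - (\<Sum>q\<in>PL. real (codegree_via E v (src q) (dst q))) / (3 * real d)
      - (real d - real (card J)) - real k / 5 * of_bool (card J < d)
      + real k / 5 * real (card (src ` (I - N \<sigma>))) + 4 / 3 + (\<Sum>i\<in>I. cost ?p lam i (\<sigma> i))"
    by blast
  have "(\<Sum>i\<in>I. cost ?p lam i (\<sigma> i)) \<le> (\<Sum>i\<in>I. pair_cost L ?p lam i (\<sigma> i))"
    using L by (intro sum_mono) (auto simp: pair_cost_def cost_def)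
  moreover have "(\<Sum>q\<in>PL \<inter> I. weight E (src q) (dst q)) + (\<Sum>q\<in>PL \<inter> J. weight E (src q) (dst q)) = xi + xo + Dv / (3 * real d)"
    unfolding weight_def Dv_def xi_def xo_def by (simp add: sum.distrib sum_divide_distrib add_divide_distrib Int_commute)
  moreover have "real k / 5 * real (card (src ` (I - N \<sigma>))) \<le> real k / 5 * real nd"
    using nd by (intro mult_left_mono) auto
  ultimately have "potential (V - {v}) EL' PL' \<le> base + real k / 5 * real nd + c"
    using le c card_I_J unfolding base_def Kv_def T_def by simp
  then show ?thesis using w' unfolding reaches_def by blast
qed

lemma loops_eq: "loops src dst I \<sigma> = I - N \<sigma>"
  by (auto simp: loops_def N_def)

lemma pair_cost_bounds:
  assumes "0 \<le> lam" "lam \<le> 1" "5 / 3 \<le> L"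
  shows "src i \<noteq> dst j \<Longrightarrow> pair_cost L prom lam i j \<le> 5 / 3" "0 \<le> pair_cost L prom lam i j"
  using cost_bounds[OF _ assms(1,2)] assms(3) by (auto simp: pair_cost_def)

lemma exists_one_loop_vertex:
  assumes \<sigma>0: "bij_betw \<sigma>0 I J" and lam: "0 \<le> lam" "lam \<le> 1"
  shows "\<exists>\<sigma>. bij_betw \<sigma> I J \<and> (\<Sum>i\<in>I. pair_cost (5/3) prom lam i (\<sigma> i)) \<le> (\<Sum>i\<in>I. pair_cost (5/3) prom lam i (\<sigma>0 i))
    \<and> card (src ` (I - N \<sigma>)) \<le> 1"
proof -
  have b: "src i \<noteq> dst j \<Longrightarrow> pair_cost (5/3) prom lam i j \<le> 5/3" "src i = dst j \<Longrightarrow> 5/3 \<le> pair_cost (5/3) prom lam i j" for i j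
    using pair_cost_bounds(1)[OF lam, where L = "5/3" and i = i and j = j and prom = prom] by (auto simp: pair_cost_def)
  have "\<exists>\<sigma>. bij_betw \<sigma> I J \<and> (\<Sum>i\<in>I. pair_cost (5/3) prom lam i (\<sigma> i)) \<le> (\<Sum>i\<in>I. pair_cost (5/3) prom lam i (\<sigma>0 i))
    \<and> (\<forall>i\<in>loops src dst I \<sigma>. \<forall>i'\<in>loops src dst I \<sigma>. src i = src i')"
    by (rule loops_at_one_vertex[OF fin(5) \<sigma>0, where M = "5/3"]) (use b in auto)
  then obtain \<sigma> where \<sigma>: "bij_betw \<sigma> I J"
    "(\<Sum>i\<in>I. pair_cost (5/3) prom lam i (\<sigma> i)) \<le> (\<Sum>i\<in>I. pair_cost (5/3) prom lam i (\<sigma>0 i))"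
    "\<forall>i\<in>I - N \<sigma>. \<forall>i'\<in>I - N \<sigma>. src i = src i'" unfolding loops_eq by blast
  have "card (src ` (I - N \<sigma>)) \<le> Suc 0"
  proof (subst card_le_Suc0_iff_eq)
    show "finite (src ` (I - N \<sigma>))" using fin(5) by simp
    show "\<forall>x\<in>src ` (I - N \<sigma>). \<forall>y\<in>src ` (I - N \<sigma>). x = y" using \<sigma>(3) by blast
  qed
  then show ?thesis using \<sigma>(1,2) unfolding One_nat_def by blast
qed

lemma reaches_average_one_loop:
  assumes T: "T > 0" and lam: "0 \<le> lam" "lam \<le> 1" "s \<or> t \<Longrightarrow> lam \<le> 1 - (2 * real xm + 4) / (3 * real d)"
    and xm: "\<And>u. pending u \<le> xm"
  shows "reaches (base + real k / 5 + total (5/3) s t lam (real xm) / T)"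
proof -
  let ?c = "pair_cost (5/3) (\<lambda>i j. i \<in> I \<and> promotable s t i j) lam"
  have "I \<noteq> {}" using T by (auto simp: T_def)
  then obtain \<sigma>0 where \<sigma>0: "bij_betw \<sigma>0 I J" "real (card I) * (\<Sum>i\<in>I. ?c i (\<sigma>0 i)) \<le> (\<Sum>i\<in>I. \<Sum>j\<in>J. ?c i j)"
    using exists_bij_le_average[OF fin(5,6) card_I_J(1)] by blast
  have "(\<Sum>i\<in>I. ?c i (\<sigma>0 i)) \<le> total (5/3) s t lam (real xm) / T"
    using \<sigma>0(2) sum_pair_cost_le[OF _ lam(1,2) xm, of "5/3" s t] T by (simp add: T_def le_divide_eq mult.commute)
  moreover obtain \<sigma> where "bij_betw \<sigma> I J" "(\<Sum>i\<in>I. ?c i (\<sigma> i)) \<le> (\<Sum>i\<in>I. ?c i (\<sigma>0 i))" "card (src ` (I - N \<sigma>)) \<le> 1"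
    using exists_one_loop_vertex[OF \<sigma>0(1) lam(1,2)] by blast
  ultimately show ?thesis
    using reaches_from_pairing[OF _ lam(3) xm, of \<sigma> s t "5/3" "total (5/3) s t lam (real xm) / T" 1] by auto
qed

lemma reaches_average_loop_free:
  assumes T: "T > 0" and lam: "0 \<le> lam" "lam \<le> 1" "s \<or> t \<Longrightarrow> lam \<le> 1 - (2 * real xm + 4) / (3 * real d)"
    and xm: "\<And>u. pending u \<le> xm" "xm + 2 \<le> card I"
  shows "reaches (base + total (10/3) s t lam (real xm) / T)"
proof -
  let ?c = "pair_cost (10/3) (\<lambda>i j. i \<in> I \<and> promotable s t i j) lam"
  have "I \<noteq> {}" using T by (auto simp: T_def)
  then obtain \<sigma>0 where \<sigma>0: "bij_betw \<sigma>0 I J" "real (card I) * (\<Sum>i\<in>I. ?c i (\<sigma>0 i)) \<le> (\<Sum>i\<in>I. \<Sum>j\<in>J. ?c i j)"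
    using exists_bij_le_average[OF fin(5,6) card_I_J(1)] by blast
  have S: "(\<Sum>i\<in>I. ?c i (\<sigma>0 i)) \<le> total (10/3) s t lam (real xm) / T"
    using \<sigma>0(2) sum_pair_cost_le[OF _ lam(1,2) xm(1), of "10/3" s t] T by (simp add: T_def le_divide_eq mult.commute)
  \<comment> \<open>At most one simple link on either side joins \<open>a\<close> and
    \<open>v\<close>; all other stubs at \<open>a\<close> are pending. Hence the requirement
    \<open>xm + 2 \<le> card I\<close>.\<close>
  have few: "card {i\<in>I. src i = a} + card {j\<in>J. dst j = a} \<le> card I" for a
  proof -
    have "card {i\<in>I \<inter> EL. src i = a} \<le> Suc 0"
      using fin A_B(5) by (subst card_le_Suc0_iff_eq) (auto simp: inj_on_def)
    moreover have "card {j\<in>J \<inter> EL. dst j = a} \<le> Suc 0"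
      using fin A_B(6) by (subst card_le_Suc0_iff_eq) (auto simp: inj_on_def)
    moreover have "card {i\<in>I. src i = a} \<le> card {i\<in>I \<inter> EL. src i = a} + card {q\<in>PL. src q = a}"
    proof -
      have "{i\<in>I. src i = a} \<subseteq> {i\<in>I \<inter> EL. src i = a} \<union> {q\<in>PL. src q = a}" using IJ(2) by blast
      then have "card {i\<in>I. src i = a} \<le> card ({i\<in>I \<inter> EL. src i = a} \<union> {q\<in>PL. src q = a})"
        using fin by (intro card_mono) auto
      then show ?thesis using card_Un_le order_trans by blast
    qed
    moreover have "card {j\<in>J. dst j = a} \<le> card {j\<in>J \<inter> EL. dst j = a} + card {q\<in>PL. dst q = a}"
    proof -
      have "{j\<in>J. dst j = a} \<subseteq> {j\<in>J \<inter> EL. dst j = a} \<union> {q\<in>PL. dst q = a}" using IJ(3) by blast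
      then have "card {j\<in>J. dst j = a} \<le> card ({j\<in>J \<inter> EL. dst j = a} \<union> {q\<in>PL. dst q = a})"
        using fin by (intro card_mono) auto
      then show ?thesis using card_Un_le order_trans by blast
    qed
    ultimately show ?thesis using xm(1)[of a] xm(2) unfolding pending_def by linarith
  qed
  have b: "src i \<noteq> dst j \<Longrightarrow> ?c i j \<le> 5/3" "src i = dst j \<Longrightarrow> 2 * (5/3) \<le> ?c i j" "0 \<le> ?c i j" for i j
    using pair_cost_bounds[OF lam(1,2), where L = "10/3" and i = i and j = j and prom = "\<lambda>i j. i \<in> I \<and> promotable s t i j"] by (auto simp: pair_cost_def)
  have "\<exists>\<sigma>. bij_betw \<sigma> I J \<and> (\<Sum>i\<in>I. ?c i (\<sigma> i)) \<le> (\<Sum>i\<in>I. ?c i (\<sigma>0 i)) \<and> loops src dst I \<sigma> = {}"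
    by (rule loop_free_pairing[OF fin(5) \<sigma>0(1) fin(6), where M = "5/3"])
      (use b few in auto)
  then obtain \<sigma> where \<sigma>: "bij_betw \<sigma> I J" "(\<Sum>i\<in>I. ?c i (\<sigma> i)) \<le> (\<Sum>i\<in>I. ?c i (\<sigma>0 i))" "I - N \<sigma> = {}"
    unfolding loops_eq by blast
  have "card (src ` (I - N \<sigma>)) \<le> 0" by (simp only: \<sigma>(3) image_empty card.empty)
  then have "reaches (base + real k / 5 * real 0 + total (10/3) s t lam (real xm) / T)"
    using S \<sigma>(2) by (intro reaches_from_pairing[where L = "10/3", OF \<sigma>(1) lam(3) xm(1)]) auto
  then show ?thesis by simp
qed

text \<open>The missing degree pays for everything: \<open>d - T\<close> exceeds the crude pairing
  cost \<open>5 / 3 * T\<close> by at least \<open>d / 9\<close>, about \<open>11 * k\<close>, so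
  neither averaging nor promotion is required.\<close>

lemma reaches_small_degree:
  assumes T: "3 * card I \<le> d" and k: "k \<ge> 10000"
  shows "reaches (potential V EL PL - 3 / 25 * real k)"
proof -
  let ?c = "pair_cost (5/3) (\<lambda>i j. i \<in> I \<and> promotable False False i j) 0"
  obtain \<sigma>0 where \<sigma>0: "bij_betw \<sigma>0 I J"
    using fin card_I_J(1) finite_same_card_bij by blast
  obtain \<sigma> where \<sigma>: "bij_betw \<sigma> I J" "card (src ` (I - N \<sigma>)) \<le> 1"
    using exists_one_loop_vertex[OF \<sigma>0, of 0] by auto
  have "?c i j \<le> 5 / 3" for i j
    using pair_cost_bounds(1)[of 0 "5/3" i j] by (cases "src i = dst j") (auto simp: pair_cost_def)
  then have "(\<Sum>i\<in>I. ?c i (\<sigma> i)) \<le> (\<Sum>i\<in>I. 5 / 3)" by (intro sum_mono)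
  then have "(\<Sum>i\<in>I. ?c i (\<sigma> i)) \<le> 5 / 3 * T" by (simp add: T_def)
  moreover have "pending u \<le> 2 * d" for u by (rule pending_le)
  ultimately have "reaches (base + real k / 5 * real 1 + 5 / 3 * T)"
    using \<sigma> by (intro reaches_from_pairing[where s = False and t = False and lam = 0 and L = "5/3" and xm = "2 * d" and \<sigma> = \<sigma>]) auto
  then show ?thesis
  proof (rule reaches_mono)
    have "3 * T \<le> real d" using T unfolding T_def by linarith
    moreover have "card I < d" using T d_pos by linarith
    moreover have "Dv / (3 * real d) \<ge> 0" "Kv / (3 * real d) \<ge> 0"
      unfolding Dv_def Kv_def by (auto intro!: divide_nonneg_nonneg add_nonneg_nonneg sum_nonneg)
    moreover have "real d = 100 * real k" "real k \<ge> 10000" using d k by simp_all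
    ultimately show "base + real k / 5 * real 1 + 5 / 3 * T \<le> potential V EL PL - 3 / 25 * real k"
      using xi_xo unfolding base_def by simp
  qed
qed

end

section \<open>Choosing the vertex to eliminate\<close>

context elimination
begin

text \<open>The average cost of blocked joins between simple links, per elimination.\<close>

definition "quad = 5 * (real k)\<^sup>2 / 6 / T"
definition "slope L = (xi + xo) * ((L + real k / 300) / T)"
definition "Dn = Dv / (3 * real d)"
definition "Kn = Kv / (3 * real d)"

lemma base_eq: "base = potential V EL PL - (xi + xo) - Dn - Kn - (real d - T) - real k / 5 * of_bool (card I < d) + 4 / 3"
  by (simp add: base_def Dn_def Kn_def)

lemma card_le_T: "c \<le> 3 * card I \<Longrightarrow> real c \<le> 3 * T"
  unfolding T_def by linarith

lemma square_div_T_le: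
  assumes "d \<le> 3 * card I"
  shows "quad \<le> real k / 40"
proof -
  have "100 * real k \<le> 3 * T" using card_le_T[OF assms] d by simp
  then have "T > 0" using k by linarith
  have "5 * (real k)\<^sup>2 / 6 = real k / 120 * (100 * real k)" by (simp add: power2_eq_square)
  also have "\<dots> \<le> real k / 120 * (3 * T)"
    using \<open>100 * real k \<le> 3 * T\<close> by (intro mult_left_mono) auto
  finally show ?thesis using \<open>T > 0\<close> by (simp add: divide_le_eq quad_def)
qed

lemma small_slope:
  assumes "d \<le> 3 * card I" "k \<ge> 10000" "L \<le> 10 / 3"
  shows "slope L \<le> 2 / 10000 * (xi + xo)"
proof -
  have T: "100 * real k \<le> 3 * T" using card_le_T[OF assms(1)] d by simp
  then have "T > 0" using k by linarith
  have "L + real k / 300 \<le> 2 / 10000 * T" using T assms by simp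
  then have "(L + real k / 300) / T \<le> 2 / 10000" using \<open>T > 0\<close> by (simp add: divide_le_eq)
  then show ?thesis
    using mult_left_mono[of "(L + real k / 300) / T" "2 / 10000" "xi + xo"] xi_xo unfolding slope_def by simp
qed

text \<open>The average number of joins between two pending links; each turns two pending links into
  one.\<close>

definition "y = xi * xo / T"

lemma y_facts:
  assumes "T > 0"
  shows "0 \<le> y" "xi + xo - T \<le> y" "y * T = xi * xo" "y \<le> xi" "y \<le> xo"
proof -
  show "0 \<le> y" using xi_xo assms by (simp add: y_def)
  show yT: "y * T = xi * xo" using assms by (simp add: y_def)
  have "0 \<le> (T - xi) * (T - xo)" using xi_xo by simp
  then have "(xi + xo - T) * T \<le> y * T" unfolding yT by (simp add: algebra_simps)
  then show "xi + xo - T \<le> y" using assms by simp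
  have "xi * xo \<le> xi * T" "xi * xo \<le> xo * T"
    using mult_left_mono[OF xi_xo(4,1)] mult_right_mono[OF xi_xo(3,2)] by (simp_all add: mult.commute)
  then show "y \<le> xi" "y \<le> xo" using assms unfolding y_def by (simp_all add: divide_le_eq)
qed

text \<open>The coefficient \<open>L - 2\<close> arises because
  \<open>xi * (T - xo) + xo * (T - xi)\<close> falls short of \<open>(xi + xo) * T\<close> by twice
  \<open>xi * xo\<close>, while the joins of two pending links add \<open>L\<close> each.\<close>

lemma total_div_eq:
  assumes T: "T > 0"
  shows "total L s t lam xm / T = L + quad + xm / 100 + slope L
    + (xi + xo) + (L - 2) * y
    - lam * of_bool s * (xi - y - xi / T - Cin / T)
    - lam * of_bool t * (xo - y - xo / T - of_bool s * y - Cout / T)"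
  unfolding total_def xi_xo(7,8) T_def[symmetric] xi_def[symmetric] xo_def[symmetric] y_def quad_def slope_def
  using T by (simp add: field_simps)

text \<open>Only the side with more pending links is promoted, with a saving so modest that blocked
  promotions lose at most \<open>Dn\<close>. The refund at \<open>v\<close> alone then absorbs them,
  and no averaging over vertices is required.\<close>

lemma total_one_sided:
  assumes T: "T > 0" and lam: "0 \<le> lam" "lam \<le> 1" "lam * (3 * real d) \<le> T" and m: "m = (if xo \<le> xi then xi else xo)"
    and c: "c = L - 2"
  shows "total L (xo \<le> xi) (\<not> xo \<le> xi) lam xm / T \<le> L + quad + xm / 100
    + slope L + (xi + xo) + c * y + lam * y - lam * m + 1 + Dn"
proof -
  have d0: "real d > 0" using d_pos by simp
  have C: "lam * (C / T) \<le> Dn" if "0 \<le> C" "C \<le> Dv" for C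
  proof -
    have "lam * (C / T) = (lam * (3 * real d)) * C / (3 * real d * T)" using d0 T by simp
    also have "\<dots> \<le> T * C / (3 * real d * T)" using that lam d0 T by (intro divide_right_mono mult_right_mono) auto
    also have "\<dots> = C / (3 * real d)" using T by simp
    also have "\<dots> \<le> Dn" unfolding Dn_def using that d0 by (intro divide_right_mono) auto
    finally show ?thesis .
  qed
  have one: "lam * (x / T) \<le> 1" if "0 \<le> x" "x \<le> T" for x
  proof -
    have "x / T \<le> 1" "0 \<le> x / T" using that T by auto
    then show ?thesis using lam mult_mono[of lam 1 "x / T" 1] by simp
  qed
  have "Cin \<le> Dv" "Cout \<le> Dv" using Cin_Cout_le by linarith+
  then have cc: "lam * (Cin / T) \<le> Dn" "lam * (Cout / T) \<le> Dn"
    using C Cin_Cout_le by auto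
  have o: "lam * (xi / T) \<le> 1" "lam * (xo / T) \<le> 1" using one xi_xo by auto
  show ?thesis
  proof (cases "xo \<le> xi")
    case True
    have "lam * (xi - y - xi / T - Cin / T) = lam * xi - lam * y - lam * (xi / T) - lam * (Cin / T)"
      by (simp add: algebra_simps)
    then show ?thesis unfolding total_div_eq[OF T] m c using True cc(1) o(1) by (simp add: algebra_simps)
  next
    case False
    have "lam * (xo - y - xo / T - Cout / T) = lam * xo - lam * y - lam * (xo / T) - lam * (Cout / T)"
      by (simp add: algebra_simps)
    then show ?thesis unfolding total_div_eq[OF T] m c using False cc(2) o(2) by (simp add: algebra_simps)
  qed
qed

lemma Kv_nonneg: "Kn \<ge> 0"
  unfolding Kv_def Kn_def by (auto intro!: divide_nonneg_nonneg sum_nonneg)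

lemma Dv_nonneg: "Dn \<ge> 0"
  unfolding Dn_def using Cin_Cout_le by (auto intro!: divide_nonneg_nonneg)

text \<open>At a vertex with the most pending links, the gain is a fixed fraction of their number:
  through promotions, or, beyond \<open>6 / 5 * d\<close>, through forced joins of two pending
  links.\<close>

lemma reaches_many_pending:
  assumes T3: "d \<le> 3 * card I" and k: "k \<ge> 10000"
    and v_max: "\<And>u. pending u \<le> pending v" and many: "5 * k \<le> pending v"
  shows "reaches (potential V EL PL - 3 / 25 * real k)"
proof -
  let ?x = "xi + xo"
  have T0: "100 * real k \<le> 3 * T" using card_le_T[OF T3] d by simp
  then have T: "T > 0" using k by linarith
  have d': "real d = 100 * real k" using d by simp
  have k': "real k \<ge> 10000" using k by simp
  have x: "5 * real k \<le> ?x" using many xi_xo(6) by linarith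
  have sl: "slope (5/3) \<le> 2 / 10000 * (xi + xo)" by (rule small_slope[OF T3 k]) simp
  have sq: "quad \<le> real k / 40" by (rule square_div_T_le[OF T3])
  note y = y_facts[OF T]
  show ?thesis
  proof (cases "5 * pending v \<le> 6 * d")
    case True
    then have "real (5 * pending v) \<le> real (6 * d)" by (simp only: of_nat_le_iff)
    then have x2: "5 * ?x \<le> 6 * real d" using xi_xo(6) by simp
    \<comment> \<open>\<open>19 / 100\<close> is what remains of 1 after bumps of up to
      \<open>81 / 100\<close>. For a deficient vertex only \<open>T \<ge> d / 3\<close> is known,
      and \<open>1 / 9\<close> is then the largest value with \<open>lam * (3 * d) \<le> T\<close>;
      the surcharge \<open>k / 5\<close> makes up for the smaller saving.\<close>
    define lam :: real where "lam = (if card I = d then 19 / 100 else 1 / 9)"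
    have lam: "0 \<le> lam" "lam \<le> 19 / 100" "lam * (3 * real d) \<le> T"
      using T3 T0 d' unfolding lam_def T_def by auto
    have lam1: "lam \<le> 1" using lam(2) by simp
    have lam': "lam \<le> 1 - (2 * real (pending v) + 4) / (3 * real d)"
    proof -
      have "(2 * real (pending v) + 4) / (3 * real d) \<le> 81 / 100"
        using x2 d' k' xi_xo(6) by (simp add: divide_le_eq)
      then show ?thesis using lam by linarith
    qed
    define m where "m = (if xo \<le> xi then xi else xo)"
    have m: "?x / 2 \<le> m" by (simp add: m_def)
    have r: "reaches (base + real k / 5 + total (5/3) (xo \<le> xi) (\<not> xo \<le> xi) lam (real (pending v)) / T)"
      using lam lam' v_max by (intro reaches_average_one_loop[OF T]) auto
    have t: "total (5/3) (xo \<le> xi) (\<not> xo \<le> xi) lam (real (pending v)) / T \<le> 5/3 + real k / 40 + ?x / 100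
      + 2 / 10000 * ?x + ?x + (- 1/3) * y + lam * y - lam * m + 1 + Dn"
      using total_one_sided[OF T lam(1) lam1 lam(3) m_def, of "- 1/3" "5/3" "real (pending v)"] sl sq xi_xo(6) by argo
    have yy: "lam * y \<le> 19 / 100 * y" using lam y by (intro mult_right_mono) auto
    show ?thesis
    proof (cases "card I = d")
      case True
      then have l: "lam = 19 / 100" by (simp add: lam_def)
      have lx: "19 / 200 * ?x \<le> lam * m" unfolding l using m by simp
      have sq': "total (5/3) (xo \<le> xi) (\<not> xo \<le> xi) lam (real (pending v)) / T \<le> 5/3 + real k / 40 + ?x / 100
        + 2 / 10000 * ?x + ?x - 19 / 200 * ?x + 1 + Dn"
        using t yy lx y(1) by linarith
      show ?thesis
      proof (rule reaches_mono[OF r])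
        have "base = potential V EL PL - ?x - Dn - Kn + 4 / 3" using True by (simp add: base_eq T_def)
        then show "base + real k / 5 + total (5/3) (xo \<le> xi) (\<not> xo \<le> xi) lam (real (pending v)) / T
          \<le> potential V EL PL - 3 / 25 * real k"
          using sq' Kv_nonneg x k' by argo
      qed
    next
      case False
      then have less: "card I < d" using card_I_J by simp
      from False have l: "lam = 1 / 9" by (simp add: lam_def)
      have lx: "1 / 18 * ?x \<le> lam * m" unfolding l using m by simp
      have sq': "total (5/3) (xo \<le> xi) (\<not> xo \<le> xi) lam (real (pending v)) / T \<le> 5/3 + real k / 40 + ?x / 100
        + 2 / 10000 * ?x + ?x - 1 / 18 * ?x + 1 + Dn"
        using t yy lx y(1) by linarith
      show ?thesis
      proof (rule reaches_mono[OF r])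
        have "base = potential V EL PL - ?x - Dn - Kn - (real d - T) - real k / 5 + 4 / 3" using less by (simp add: base_eq)
        then show "base + real k / 5 + total (5/3) (xo \<le> xi) (\<not> xo \<le> xi) lam (real (pending v)) / T
          \<le> potential V EL PL - 3 / 25 * real k"
          using sq' Kv_nonneg x k' xi_xo(5) by argo
      qed
    qed
  next
    case False
    then have "real (6 * d) \<le> real (5 * pending v)" by (simp only: of_nat_le_iff)
    then have x2: "6 * real d \<le> 5 * ?x" using xi_xo(6) by simp
    \<comment> \<open>Here bumps might outweigh promotions, so there are none. On average at least
      \<open>xi + xo - d\<close> joins merge two pending links, and each saves
      \<open>2 - 5 / 3\<close>.\<close>
    have r: "reaches (base + real k / 5 + total (5/3) False False 0 (real (pending v)) / T)"
      using v_max by (intro reaches_average_one_loop[OF T]) auto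
    have t: "total (5/3) False False 0 (real (pending v)) / T \<le> 5/3 + real k / 40 + ?x / 100
      + 2 / 10000 * ?x + ?x - 1 / 3 * y"
    proof -
      have "total (5/3) False False 0 (real (pending v)) / T = 5/3 + quad + ?x / 100 + slope (5/3) + ?x - 1/3 * y"
        using total_div_eq[OF T, of "5/3" False False 0 "real (pending v)"] xi_xo(6) by simp
      then show ?thesis using sl sq by argo
    qed
    have "?x \<le> 2 * real d" "?x - real d \<le> y" using xi_xo y(2) by linarith+
    moreover define z where "z = real k / 5 * of_bool (card I < d)"
    moreover have "z \<ge> 0" by (simp add: z_def)
    moreover have "base = potential V EL PL - ?x - Dn - Kn - (real d - T) - z + 4 / 3"
      by (simp add: base_eq z_def)
    ultimately show ?thesis
      using t Kv_nonneg Dv_nonneg x2 k' d' xi_xo(5) by (intro reaches_mono[OF r]) argo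
  qed
qed

text \<open>With at most \<open>5 * k\<close> pending links per vertex all loops can be avoided, so
  no surcharge \<open>k / 5\<close> is incurred. The price is the positive coefficient
  \<open>4 / 3\<close> of \<open>y\<close>, which is harmless as \<open>y\<close> is now
  small.\<close>

lemma reaches_few_pending:
  assumes T3: "d \<le> 3 * card I" and k: "k \<ge> 10000"
    and xm: "\<And>u. pending u \<le> xm" "xm \<le> 5 * k"
    and lam: "0 \<le> lam" "lam \<le> 1 / 3" "lam * (3 * real d) \<le> T"
  shows "reaches (base + 10 / 3 + quad + real xm / 100 + 2 / 10000 * (xi + xo) + (xi + xo)
    + 4 / 3 * y + lam * y - lam * (if xo \<le> xi then xi else xo) + 1 + Dn)"
proof -
  have T0: "100 * real k \<le> 3 * T" using card_le_T[OF T3] d by simp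
  then have T: "T > 0" using k by linarith
  have d': "real d = 100 * real k" using d by simp
  have k': "real k \<ge> 10000" using k by simp
  have sl: "slope (10/3) \<le> 2 / 10000 * (xi + xo)" by (rule small_slope[OF T3 k]) simp
  have xm': "real xm \<le> 5 * real k" using xm(2) by linarith
  have lam': "lam \<le> 1 - (2 * real xm + 4) / (3 * real d)"
  proof -
    have "(2 * real xm + 4) / (3 * real d) \<le> 1 / 2"
      using xm' d' k' by (simp add: divide_le_eq)
    then show ?thesis using lam by linarith
  qed
  have lam1: "lam \<le> 1" using lam(2) by simp
  have "real xm + 2 \<le> real (card I)" using xm' k' T0 unfolding T_def by linarith
  then have "xm + 2 \<le> card I" by linarith
  then have r: "reaches (base + total (10/3) (xo \<le> xi) (\<not> xo \<le> xi) lam (real xm) / T)"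
    using lam lam' xm(1) by (intro reaches_average_loop_free[OF T]) auto
  show ?thesis
    by (rule reaches_mono[OF r])
      (use total_one_sided[OF T lam(1) lam1 lam(3) refl, of "4/3" "10/3" "real xm"] sl in argo)
qed

text \<open>The smaller of \<open>xi\<close> and \<open>xo\<close> is at most half their sum, hence
  at most \<open>c * T\<close>.\<close>

lemma y_le_max:
  assumes T: "T > 0" and x: "xi + xo \<le> 2 * c * T"
  shows "y \<le> c * (if xo \<le> xi then xi else xo)"
proof -
  define m where "m = (if xo \<le> xi then xi else xo)"
  define n where "n = (if xo \<le> xi then xo else xi)"
  have mn: "xi * xo = m * n" "n \<le> c * T" "0 \<le> m" using x xi_xo by (auto simp: m_def n_def)
  have "y = m * n / T" using mn by (simp add: y_def)
  also have "\<dots> \<le> m * (c * T) / T"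
    using mn T by (intro divide_right_mono mult_left_mono) auto
  also have "\<dots> = c * m" using T by simp
  finally show ?thesis by (simp add: m_def)
qed

text \<open>The collected surcharge \<open>k / 5\<close> covers the required
  \<open>3 * k / 25\<close> and the overhead \<open>k / 40 + k / 20 + k / 1000\<close>, together
  \<open>0.196 * k\<close>. The promotions only offset the terms in \<open>y\<close>.\<close>

lemma reaches_deficient:
  assumes T3: "d \<le> 3 * card I" and k: "k \<ge> 10000" and less: "card I < d"
    and xm: "\<And>u. pending u \<le> 5 * k"
  shows "reaches (potential V EL PL - 3 / 25 * real k)"
proof -
  have T0: "100 * real k \<le> 3 * T" using card_le_T[OF T3] d by simp
  then have T: "T > 0" using k by linarith
  have k': "real k \<ge> 10000" using k by simp
  have "1 / 9 * (3 * real d) \<le> T" using T0 d by simp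
  from reaches_few_pending[OF T3 k xm _ _ _ this]
  have r: "reaches (base + 10 / 3 + quad + real (5 * k) / 100 + 2 / 10000 * (xi + xo) + (xi + xo)
    + 4 / 3 * y + 1 / 9 * y - 1 / 9 * (if xo \<le> xi then xi else xo) + 1 + Dn)" by simp
  have sq: "quad \<le> real k / 40" by (rule square_div_T_le[OF T3])
  have x: "xi + xo \<le> 5 * real k" using xm[of v] xi_xo(6) by linarith
  define m where "m = (if xo \<le> xi then xi else xo)"
  have "y \<le> 3 / 40 * m"
    unfolding m_def using T0 x by (intro y_le_max[OF T]) simp
  moreover have "0 \<le> m" using xi_xo by (simp add: m_def)
  moreover have "base = potential V EL PL - (xi + xo) - Dn - Kn - (real d - T) - real k / 5 + 4 / 3"
    using less by (simp add: base_eq)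
  moreover have "real (5 * k) / 100 = real k / 20" by simp
  ultimately show ?thesis
    using sq Kv_nonneg x k' xi_xo(5) by (intro reaches_mono[OF r[folded m_def]]) argo
qed

text \<open>There is no surcharge to collect, but full degree permits the saving
  \<open>1 / 3\<close>. The net gain is over \<open>0.135\<close> per pending link at
  \<open>v\<close>, and \<open>k\<close> such links cover
  \<open>3 * k / 25 + k / 120\<close>.\<close>

lemma reaches_medium_pending:
  assumes full: "card I = d" and k: "k \<ge> 10000"
    and v_max: "\<And>u. pending u \<le> pending v" and x1: "k \<le> pending v" and x5: "pending v \<le> 5 * k"
  shows "reaches (potential V EL PL - 3 / 25 * real k)"
proof -
  have T3: "d \<le> 3 * card I" using full by simp
  have Td: "T = 100 * real k" using full d by (simp add: T_def)
  then have T: "T > 0" using k by simp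
  have k': "real k \<ge> 10000" using k by simp
  have "1 / 3 * (3 * real d) \<le> T" using Td d by simp
  from reaches_few_pending[OF T3 k v_max x5 _ _ this]
  have r: "reaches (base + 10 / 3 + quad + real (pending v) / 100 + 2 / 10000 * (xi + xo) + (xi + xo)
    + 4 / 3 * y + 1 / 3 * y - 1 / 3 * (if xo \<le> xi then xi else xo) + 1 + Dn)" by simp
  have sq: "quad = real k / 120" using Td k' by (simp add: power2_eq_square quad_def)
  have x: "xi + xo \<le> 5 * real k" "real k \<le> xi + xo" "real (pending v) = xi + xo" using x1 x5 xi_xo(6) by linarith+
  define m where "m = (if xo \<le> xi then xi else xo)"
  have "y \<le> 1 / 40 * m"
    unfolding m_def using Td x by (intro y_le_max[OF T]) simp
  moreover have "(xi + xo) / 2 \<le> m" by (simp add: m_def)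
  moreover have "base = potential V EL PL - (xi + xo) - Dn - Kn + 4 / 3"
    using full by (simp add: base_eq T_def)
  ultimately show ?thesis
    using sq Kv_nonneg x k' by (intro reaches_mono[OF r[folded m_def]]) argo
qed

text \<open>Bumps are now so small that a promotion saves almost 1, and both sides are promoted:
  \<open>1 - (2 * k + 4) / (300 * k)\<close> is slightly above \<open>993 / 1000\<close>. Blocking
  may exceed the refunds at this particular vertex, so \<open>Cin + Cout\<close> is kept for the
  averaging. The constant \<open>3 / 160\<close> exceeds \<open>1 / 120 + 1 / 100\<close>.\<close>

lemma reaches_average_vertex:
  assumes full: "card I = d" and k: "k \<ge> 10000" and xm: "\<And>u. pending u \<le> k"
  shows "reaches (potential V EL PL - Dn - Kn + (Cin + Cout) / real d
    + 3 / 160 * real k + 5 - 97 / 100 * (xi + xo))"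
proof -
  have T3: "d \<le> 3 * card I" using full by simp
  have Td: "T = 100 * real k" "T = real d" using full d by (auto simp: T_def)
  then have T: "T > 0" using k by simp
  have k': "real k \<ge> 10000" using k by simp
  define lam :: real where "lam = 993 / 1000"
  have lam': "lam \<le> 1 - (2 * real k + 4) / (3 * real d)"
    using Td k' by (simp add: lam_def divide_le_eq)
  have "real k + 2 \<le> real (card I)" using k' Td unfolding T_def by linarith
  then have "k + 2 \<le> card I" by linarith
  then have r: "reaches (base + total (10/3) True True lam (real k) / T)"
    using lam' xm by (intro reaches_average_loop_free[OF T]) (auto simp: lam_def)
  have sl: "slope (10/3) \<le> 2 / 10000 * (xi + xo)" by (rule small_slope[OF T3 k]) simp
  have sq: "quad = real k / 120" using Td k' by (simp add: power2_eq_square quad_def)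
  have x: "xi + xo \<le> real k" using xm[of v] xi_xo(6) by linarith
  have "y \<le> 1 / 200 * (if xo \<le> xi then xi else xo)"
    using Td x by (intro y_le_max[OF T]) simp
  then have y: "y \<le> 1 / 200 * (xi + xo)" using xi_xo by (simp split: if_splits)
  have "xi / T \<le> 1 / 1000000 * xi" "xo / T \<le> 1 / 1000000 * xo"
  proof -
    have "1 / T \<le> 1 / 1000000" using Td k' by (simp add: divide_le_eq)
    from mult_right_mono[OF this xi_xo(1)] mult_right_mono[OF this xi_xo(2)]
    show "xi / T \<le> 1 / 1000000 * xi" "xo / T \<le> 1 / 1000000 * xo" by simp_all
  qed
  moreover have "lam * (Cin / T + Cout / T) \<le> (Cin + Cout) / real d"
  proof -
    have "0 \<le> (Cin + Cout) / real d" using Cin_Cout_le by simp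
    moreover have "993 / 1000 * z \<le> z" if "0 \<le> z" for z :: real using that by simp
    ultimately show ?thesis unfolding Td(2) lam_def add_divide_distrib[symmetric] by blast
  qed
  moreover have "total (10/3) True True lam (real k) / T = 10/3 + quad + real k / 100 + slope (10/3) + (xi + xo) + 4/3 * y
    - 993/1000 * (xi - y - xi / T) - 993/1000 * (xo - 2 * y - xo / T) + lam * (Cin / T + Cout / T)"
    unfolding total_div_eq[OF T] lam_def by (simp add: algebra_simps add_divide_distrib diff_divide_distrib)
  moreover have "base = potential V EL PL - (xi + xo) - Dn - Kn + 4 / 3"
    using full by (simp add: base_eq T_def)
  ultimately show ?thesis
    using sl sq y k' x xi_xo(1,2) y_facts(1)[OF T] by (intro reaches_mono[OF r]) argo
qed

end

section \<open>Averaging over all vertices, and the descent\<close>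

context links
begin

definition invariant :: "'a set \<Rightarrow> 'l set \<Rightarrow> 'l set \<Rightarrow> bool" where
  "invariant V EL PL \<longleftrightarrow> state V EL PL \<and> potential V EL PL \<le> 3 / 25 * real k * real (card V)"

text \<open>
  Summed over all vertices, the codegree terms of the target cancel: each pending link is counted
  twice by the first of them, once by the second, and three times with the opposite sign by the third.
\<close>

definition target :: "'a set \<Rightarrow> 'l set \<Rightarrow> 'l set \<Rightarrow> 'a \<Rightarrow> real" where
  "target V EL PL v = potential V EL PL
    - ((\<Sum>q | q \<in> PL \<and> dst q = v. real (codegree (pr ` EL) (src q) (dst q)))
      + (\<Sum>q | q \<in> PL \<and> src q = v. real (codegree (pr ` EL) (src q) (dst q)))) / (3 * real d)
    - (\<Sum>q\<in>PL. real (codegree_via (pr ` EL) v (src q) (dst q))) / (3 * real d)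
    + ((\<Sum>q | q \<in> PL \<and> dst q = v. real (common_out (pr ` EL) (src q) (dst q)))
      + (\<Sum>q | q \<in> PL \<and> src q = v. real (common_out ((pr ` EL)\<inverse>) (src q) (dst q)))) / real d
    + 3 / 160 * real k + 5 - 97 / 100 * (real (card {q\<in>PL. dst q = v}) + real (card {q\<in>PL. src q = v}))"

lemma sum_over_ends:
  assumes w: "state V EL PL"
  shows "(\<Sum>v\<in>V. \<Sum>q | q \<in> PL \<and> dst q = v. g q) = (\<Sum>q\<in>PL. g q)"
    "(\<Sum>v\<in>V. \<Sum>q | q \<in> PL \<and> src q = v. g q) = (\<Sum>q\<in>PL. g q :: real)"
proof -
  have "finite PL" "finite V" "dst ` PL \<subseteq> V" "src ` PL \<subseteq> V"
    using w Adm_finite[of "EL \<union> PL"] unfolding state_def by auto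
  then show "(\<Sum>v\<in>V. \<Sum>q | q \<in> PL \<and> dst q = v. g q) = (\<Sum>q\<in>PL. g q)"
    "(\<Sum>v\<in>V. \<Sum>q | q \<in> PL \<and> src q = v. g q) = (\<Sum>q\<in>PL. g q)"
    using sum.group[of PL V dst g] sum.group[of PL V src g] by auto
qed

lemma sum_codegree_via:
  assumes w: "state V EL PL"
  shows "(\<Sum>v\<in>V. real (codegree_via (pr ` EL) v a b)) = real (codegree (pr ` EL) a b)"
proof -
  let ?E = "pr ` EL"
  have V: "finite V" using w by (simp add: state_def)
  have sub: "?E `` {a} \<subseteq> V" "?E\<inverse> `` {a} \<subseteq> V" using w by (auto simp: state_def pr_def)
  have "(\<Sum>v\<in>V. codegree_via ?E v a b) = card (V \<inter> {v. (a, v) \<in> ?E \<and> (b, v) \<in> ?E}) + card (V \<inter> {v. (v, a) \<in> ?E \<and> (v, b) \<in> ?E})"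
    unfolding codegree_via_def sum.distrib using V by (simp only: sum_of_bool_eq of_nat_id)
  also have "V \<inter> {v. (a, v) \<in> ?E \<and> (b, v) \<in> ?E} = ?E `` {a} \<inter> ?E `` {b}" using sub by auto
  also have "V \<inter> {v. (v, a) \<in> ?E \<and> (v, b) \<in> ?E} = ?E\<inverse> `` {a} \<inter> ?E\<inverse> `` {b}" using sub by auto
  finally have "(\<Sum>v\<in>V. codegree_via ?E v a b) = codegree ?E a b" by (simp add: codegree_def common_out_def)
  then show ?thesis by (metis of_nat_sum)
qed

text \<open>After the cancellation only the savings remain, \<open>97 / 100\<close> at each of the
  two ends of every pending link.\<close>

lemma sum_target:
  assumes w: "state V EL PL"
  shows "(\<Sum>v\<in>V. target V EL PL v) =
    real (card V) * (potential V EL PL + 3 / 160 * real k + 5) - 194 / 100 * real (card PL)"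
proof -
  let ?E = "pr ` EL"
  define S where "S = (\<Sum>q\<in>PL. real (codegree ?E (src q) (dst q)))"
  have fPL: "finite PL" using w Adm_finite[of "EL \<union> PL"] unfolding state_def by auto
  have K: "(\<Sum>v\<in>V. \<Sum>q\<in>PL. real (codegree_via ?E v (src q) (dst q))) = S"
    unfolding S_def by (subst sum.swap) (simp only: sum_codegree_via[OF w])
  have N: "(\<Sum>q\<in>PL. real (common_out ?E (src q) (dst q))) + (\<Sum>q\<in>PL. real (common_out (?E\<inverse>) (src q) (dst q))) = S"
    unfolding S_def codegree_def by (simp add: sum.distrib)
  have c: "(\<Sum>v\<in>V. real (card {q\<in>PL. dst q = v})) = real (card PL)"
    "(\<Sum>v\<in>V. real (card {q\<in>PL. src q = v})) = real (card PL)"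
    using sum_over_ends[OF w, of "\<lambda>_. 1"] by simp_all
  have "(\<Sum>v\<in>V. target V EL PL v) = real (card V) * potential V EL PL - (S + S) / (3 * real d) - S / (3 * real d)
     + ((\<Sum>q\<in>PL. real (common_out ?E (src q) (dst q))) + (\<Sum>q\<in>PL. real (common_out (?E\<inverse>) (src q) (dst q)))) / real d
     + real (card V) * (3 / 160 * real k + 5) - 97 / 100 * (real (card PL) + real (card PL))"
    unfolding target_def sum.distrib sum_subtractf sum_divide_distrib[symmetric] sum_over_ends[OF w] K
      sum_distrib_left[symmetric] c S_def[symmetric]
    by (simp add: algebra_simps)
  also have "\<dots> = real (card V) * (potential V EL PL + 3 / 160 * real k + 5) - 194 / 100 * real (card PL)"
    unfolding N using d_pos by (simp add: field_simps)
  finally show ?thesis .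
qed

lemma pending_weight_le:
  assumes w: "state V EL PL"
  shows "pending_weight (pr ` EL) PL \<le> 5 / 3 * real (card PL)"
proof (cases "PL = {}")
  case False
  then obtain v where "v \<in> V" using w unfolding state_def by blast
  then interpret elimination src dst Adm k d V EL PL v using w by unfold_locales
  have "pending_weight E PL \<le> (\<Sum>q\<in>PL. 5 / 3)" unfolding pending_weight_def by (intro sum_mono weight_le)
  then show ?thesis by simp
qed (simp add: pending_weight_def)

end

context elimination
begin

lemma reachesD:
  assumes "reaches c" "c \<le> 3 / 25 * real k * (real (card V) - 1)"
  shows "\<exists>V' EL' PL'. invariant V' EL' PL' \<and> Suc (card V') = card V"
proof -
  obtain EL' PL' where "state (V - {v}) EL' PL'" "potential (V - {v}) EL' PL' \<le> c"
    using assms(1) unfolding reaches_def by blast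
  moreover have c: "Suc (card (V - {v})) = card V" using fin v by (simp only: card_Suc_Diff1)
  then have "real (card (V - {v})) = real (card V) - 1" by linarith
  ultimately have "invariant (V - {v}) EL' PL'" using assms(2) unfolding invariant_def by simp
  then show ?thesis using c by blast
qed

lemma reaches_invariant:
  assumes "invariant V EL PL" "reaches (potential V EL PL - 3 / 25 * real k)"
  shows "\<exists>V' EL' PL'. invariant V' EL' PL' \<and> Suc (card V') = card V"
  by (rule reachesD[OF assms(2)]) (use assms(1) in \<open>simp add: invariant_def algebra_simps\<close>)

lemma reaches_target:
  assumes "card I = d" "k \<ge> 10000" "\<And>u. pending u \<le> k"
  shows "reaches (target V EL PL v)"
proof -
  have s: "PL \<inter> I = {q\<in>PL. dst q = v}" "PL \<inter> J = {q\<in>PL. src q = v}" by (auto simp: ins_def outs_def)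
  have s': "I \<inter> PL = {q\<in>PL. dst q = v}" "J \<inter> PL = {q\<in>PL. src q = v}" by (auto simp: ins_def outs_def)
  have "Cin = (\<Sum>q | q \<in> PL \<and> dst q = v. real (common_out E (src q) (dst q)))"
    unfolding Cin_def s' by (intro sum.cong) auto
  moreover have "Cout = (\<Sum>q | q \<in> PL \<and> src q = v. real (common_out (E\<inverse>) (src q) (dst q)))"
    unfolding Cout_def s' by (intro sum.cong) (auto simp: common_out_def Int_commute)
  ultimately have "target V EL PL v = potential V EL PL - Dn - Kn + (Cin + Cout) / real d
    + 3 / 160 * real k + 5 - 97 / 100 * (xi + xo)"
    unfolding target_def Dn_def Kn_def Dv_def Kv_def xi_def xo_def s s' by simp
  then show ?thesis using reaches_average_vertex[OF assms] by simp
qed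

end

context links
begin

text \<open>The cases are ordered so that each inherits the failure of the previous ones: all
  degrees above \<open>d / 3\<close>, then fewer than \<open>5 * k\<close> pending links everywhere,
  then all degrees equal to \<open>d\<close>, and finally fewer than \<open>k\<close> pending
  links.\<close>

lemma descend:
  assumes invariant: "invariant V EL PL" and n: "card V \<ge> 2" and k: "k \<ge> 10000"
  shows "\<exists>V' EL' PL'. invariant V' EL' PL' \<and> Suc (card V') = card V"
proof -
  have w: "state V EL PL" using invariant by (simp add: invariant_def)
  have el: "elimination src dst Adm k d V EL PL v" if "v \<in> V" for v
    using w that by unfold_locales
  define pe where "pe u = card {q\<in>PL. src q = u} + card {q\<in>PL. dst q = u}" for u
  have pending: "elimination.pending src dst PL u = pe u" if "v \<in> V" for u v
    using elimination.pending_def[OF el[OF that]] by (simp add: pe_def)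
  note reach = elimination.reaches_invariant[OF el invariant]
  have V: "finite V" "V \<noteq> {}" using w n by (auto simp: state_def)
  have "Max (pe ` V) \<in> pe ` V" using V by (intro Max_in) auto
  then obtain m where m: "m \<in> V" "Max (pe ` V) = pe m" by (rule imageE)
  have m_ge: "pe u \<le> pe m" if "u \<in> V" for u
    using Max_ge[of "pe ` V" "pe u"] V(1) that by (simp add: m(2))
  have mmax: "pe u \<le> pe m" for u
  proof (cases "u \<in> V")
    case False
    then have "{q\<in>PL. src q = u} = {}" "{q\<in>PL. dst q = u} = {}" using w by (auto simp: state_def)
    then have "pe u = 0" unfolding pe_def by (simp only: card.empty)
    then show ?thesis by simp
  qed (rule m_ge)
  let ?deg = "\<lambda>v. card (ins (EL \<union> PL) v)"
  have deg: "?deg v \<le> d" "?deg v = card (outs (EL \<union> PL) v)" if "v \<in> V" for v using w that by (auto simp: state_def)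
  show ?thesis
  proof (cases "\<exists>v\<in>V. 3 * ?deg v \<le> d")
    case True
    then obtain v where v: "v \<in> V" "3 * ?deg v \<le> d" by blast
    show ?thesis by (rule reach[OF v(1)]) (rule elimination.reaches_small_degree[OF el[OF v(1)] v(2) k])
  next
    case False
    then have big: "d \<le> 3 * ?deg v" if "v \<in> V" for v using that by force
    show ?thesis
    proof (cases "5 * k \<le> pe m")
      case True
      show ?thesis
        by (rule reach[OF m(1)], rule elimination.reaches_many_pending[OF el[OF m(1)] big[OF m(1)] k])
          (use mmax True pending[OF m(1)] in auto)
    next
      case few: False
      then have pe5: "pe u \<le> 5 * k" for u using mmax[of u] by linarith
      show ?thesis
      proof (cases "\<exists>v\<in>V. ?deg v < d")
        case True
        then obtain v where v: "v \<in> V" "?deg v < d" by blast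
        show ?thesis
          by (rule reach[OF v(1)], rule elimination.reaches_deficient[OF el[OF v(1)] big[OF v(1)] k v(2)])
            (use pe5 pending[OF v(1)] in auto)
      next
        case False
        then have full: "?deg v = d" if "v \<in> V" for v using deg that by (meson le_neq_implies_less)
        show ?thesis
        proof (cases "k \<le> pe m")
          case True
          show ?thesis
            by (rule reach[OF m(1)], rule elimination.reaches_medium_pending[OF el[OF m(1)] full[OF m(1)] k])
              (use mmax True pending[OF m(1)] pe5 in auto)
        next
          case False
          then have pe1: "pe u \<le> k" for u using mmax[of u] by linarith
          obtain v where v: "v \<in> V" "real (card V) * target V EL PL v \<le> (\<Sum>v\<in>V. target V EL PL v)"
            using exists_le_average[OF V] by blast
          have "defect V (EL \<union> PL) = 0"
          proof -
            have "card (outs (EL \<union> PL) u) = d" if "u \<in> V" for u using full[OF that] deg(2)[OF that] by simp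
            then show ?thesis unfolding defect_def by (simp add: sum.neutral cong: conj_cong)
          qed
          then have "potential V EL PL \<le> 5 / 3 * real (card PL)" using pending_weight_le[OF w] by (simp add: potential_def)
          \<comment> \<open>A pending link weighs at most \<open>5 / 3\<close>, and
            \<open>194 / 100 * 3 / 5\<close> is \<open>1164 / 1000\<close>. That this exceeds 1 is
            the core of the argument.\<close>
          then have "real (card V) * target V EL PL v \<le> real (card V) * (potential V EL PL + 3 / 160 * real k + 5) - 1164 / 1000 * potential V EL PL"
            using v(2) unfolding sum_target[OF w] by simp
          also have "\<dots> = (real (card V) - 1164 / 1000) * potential V EL PL + real (card V) * (3 / 160 * real k + 5)"
            by (simp add: algebra_simps)
          \<comment> \<open>Monotonicity requires a nonnegative factor, hence
            \<open>card V \<ge> 2\<close>.\<close>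
          also have "\<dots> \<le> (real (card V) - 1164 / 1000) * (3 / 25 * real k * real (card V)) + real (card V) * (3 / 160 * real k + 5)"
            using invariant n unfolding invariant_def by (intro add_right_mono mult_left_mono) auto
          also have "\<dots> = real (card V) * ((real (card V) - 1164 / 1000) * (3 / 25 * real k) + (3 / 160 * real k + 5))"
            by (simp add: algebra_simps)
          \<comment> \<open>The surplus \<open>164 / 1000 * 3 / 25\<close>, which is
            \<open>0.01968\<close>, must beat \<open>3 / 160\<close>, which is
            \<open>0.01875\<close>, by enough to absorb the constant 5; \<open>k \<ge> 10000\<close>
            suffices.\<close>
          also have "\<dots> \<le> real (card V) * (3 / 25 * real k * (real (card V) - 1))"
            using k by (intro mult_left_mono) (auto simp: algebra_simps)
          finally have "target V EL PL v \<le> 3 / 25 * real k * (real (card V) - 1)"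
            using n by simp
          then show ?thesis
            by (intro elimination.reachesD[OF el[OF v(1)] elimination.reaches_target[OF el[OF v(1)] full[OF v(1)] k]])
              (use pe1 pending[OF v(1)] in auto)
        qed
      qed
    qed
  qed
qed

text \<open>The out-degrees sum to the number of all links, and pending links weigh at least 1, so
  the potential is at least \<open>d * card V - card EL\<close>.\<close>

lemma many_simple_links:
  assumes invariant: "invariant V EL PL"
  shows "99 * real k * real (card V) \<le> real (card EL)"
proof -
  let ?Q = "EL \<union> PL"
  have w: "state V EL PL" using invariant by (simp add: invariant_def)
  have fin: "finite ?Q" "finite V" "finite EL" "finite PL" using w Adm_finite[of ?Q] unfolding state_def by auto
  have "(\<Sum>v\<in>V. card (outs ?Q v)) = card {q\<in>?Q. src q \<in> V}"
    unfolding outs_def by (rule sum_card_fibers[OF fin(2,1)])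
  also have "{q\<in>?Q. src q \<in> V} = ?Q" using w unfolding state_def by blast
  also have "card ?Q = card EL + card PL" using w fin by (intro card_Un_disjoint) (auto simp: state_def)
  finally have "real (\<Sum>v\<in>V. card (outs ?Q v)) = real (card EL + card PL)" by simp
  then have s: "(\<Sum>v\<in>V. real d - real (card (outs ?Q v))) = real d * real (card V) - real (card EL) - real (card PL)"
    by (simp add: sum_subtractf)
  have "real (card PL) \<le> pending_weight (pr ` EL) PL"
    unfolding pending_weight_def using sum_mono[of PL "\<lambda>_. 1" "\<lambda>q. weight (pr ` EL) (src q) (dst q)"] weight_ge_1 by simp
  moreover have "0 \<le> real k / 5 * real (card {u\<in>V. card (outs ?Q u) < d})" by simp
  ultimately have "real d * real (card V) - real (card EL) \<le> potential V EL PL"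
    unfolding potential_def defect_def s by linarith
  also have "\<dots> \<le> 3 / 25 * real k * real (card V)" using invariant by (simp add: invariant_def)
  finally have "real d * real (card V) - 3 / 25 * real k * real (card V) \<le> real (card EL)" by simp
  moreover have "99 * real k * real (card V) \<le> real d * real (card V) - 3 / 25 * real k * real (card V)"
    using d by (simp add: algebra_simps mult_right_mono)
  ultimately show ?thesis by linarith
qed

text \<open>The descent stops as soon as at most \<open>200 * k\<close> vertices remain, so
  \<open>k \<le> card V\<close> persists. There sparsity would give
  \<open>99 * k^2 \<le> k^2 / 2\<close>.\<close>

lemma invariant_False:
  assumes "invariant V EL PL" "k \<le> card V" and k: "k \<ge> 10000"
  shows False
  using assms(1,2)
proof (induction "card V" arbitrary: V EL PL rule: less_induct)
  case less
  show False
  proof (cases "card V \<le> 200 * k")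
    case True
    have w: "state V EL PL" using less.prems by (simp add: invariant_def)
    then have "Adm EL" using Adm_mono[of "EL \<union> PL" EL] by (auto simp: state_def)
    moreover have "inj_on (\<lambda>q. (src q, dst q)) EL" using w by (simp add: state_def pr_def[abs_def])
    moreover have "\<And>q. q \<in> EL \<Longrightarrow> src q \<noteq> dst q" "finite V" using w by (auto simp: state_def)
    ultimately have "real (card ((\<lambda>q. (src q, dst q)) ` EL \<inter> V \<times> V)) \<le> (real k)\<^sup>2 / 2"
      using Adm_sparse True by blast
    moreover have "(\<lambda>q. (src q, dst q)) ` EL \<inter> V \<times> V = (\<lambda>q. (src q, dst q)) ` EL"
      using w by (auto simp: state_def)
    moreover have "card ((\<lambda>q. (src q, dst q)) ` EL) = card EL"
      using \<open>inj_on (\<lambda>q. (src q, dst q)) EL\<close> by (rule card_image)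
    ultimately have "99 * real k * real (card V) \<le> (real k)\<^sup>2 / 2" using many_simple_links[OF less.prems(1)] by simp
    moreover have "99 * real k * real k \<le> 99 * real k * real (card V)" using less.prems(2) by (intro mult_left_mono) auto
    ultimately have "99 * (real k)\<^sup>2 \<le> (real k)\<^sup>2 / 2" by (simp add: power2_eq_square)
    then show False using k by simp
  next
    case False
    then have "card V \<ge> 2" using k by linarith
    then obtain V' EL' PL' where "invariant V' EL' PL'" "Suc (card V') = card V"
      using descend[OF less.prems(1) _ k] by blast
    then show False using less.hyps[of V' EL' PL'] False by simp
  qed
qed

end

section \<open>Regularisation\<close>

context links
begin

definition regular_candidate :: "'a set \<Rightarrow> 'l set \<Rightarrow> bool" where
  "regular_candidate V Q \<longleftrightarrow> Adm Q \<and> inj_on pr Q \<and>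
    (\<forall>q\<in>Q. src q \<in> V \<and> dst q \<in> V \<and> src q \<noteq> dst q) \<and>
    (\<forall>v\<in>V. card (ins Q v) = card (outs Q v) \<and> d \<le> card (outs Q v))"

text \<open>At most \<open>d\<close> of the \<open>d^2\<close> pairs are diagonal, and
  \<open>d^2 - d\<close> exceeds \<open>k^2 / 2\<close>.\<close>

lemma complete_bipartite_sparse:
  assumes Q: "Adm Q" "inj_on pr Q" "\<And>q. q \<in> Q \<Longrightarrow> src q \<noteq> dst q"
    and A: "finite A" "card A = d" and B: "finite B" "card B = d"
    and all: "\<And>a b. a \<in> A \<Longrightarrow> b \<in> B \<Longrightarrow> a = b \<or> (a, b) \<in> pr ` Q"
  shows False
proof -
  have "card (A \<union> B) \<le> 200 * k" using card_Un_le[of A B] A B d by simp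
  moreover have "inj_on (\<lambda>q. (src q, dst q)) Q" using Q(2) by (simp add: pr_def[abs_def])
  ultimately have "real (card ((\<lambda>q. (src q, dst q)) ` Q \<inter> (A \<union> B) \<times> (A \<union> B))) \<le> (real k)\<^sup>2 / 2"
    using Adm_sparse[OF Q(1)] Q(3) A B by blast
  then have le: "real (card (pr ` Q \<inter> (A \<union> B) \<times> (A \<union> B))) \<le> (real k)\<^sup>2 / 2" by (simp add: pr_def[abs_def])
  let ?D = "(\<lambda>a. (a, a)) ` A"
  have finQ: "finite (pr ` Q)" using Adm_finite[OF Q(1)] by simp
  have "A \<times> B \<subseteq> ?D \<union> (pr ` Q \<inter> (A \<union> B) \<times> (A \<union> B))" using all by auto
  then have "card (A \<times> B) \<le> card (?D \<union> (pr ` Q \<inter> (A \<union> B) \<times> (A \<union> B)))"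
    using A finQ by (intro card_mono) auto
  also have "\<dots> \<le> card ?D + card (pr ` Q \<inter> (A \<union> B) \<times> (A \<union> B))" by (rule card_Un_le)
  also have "card ?D \<le> d" using A card_image_le[OF A(1)] by metis
  finally have "d * d \<le> d + card (pr ` Q \<inter> (A \<union> B) \<times> (A \<union> B))" using A B by simp
  then have "real (d * d) \<le> real (d + card (pr ` Q \<inter> (A \<union> B) \<times> (A \<union> B)))" by (simp only: of_nat_le_iff)
  then have "real d * real d \<le> real d + (real k)\<^sup>2 / 2" using le by simp
  then have "10000 * (real k * real k) \<le> 100 * real k + real k * real k / 2" by (simp add: d power2_eq_square)
  moreover have "real k * 1 \<le> real k * real k" using k by (intro mult_left_mono) auto
  moreover have "real k > 0" using k by simp
  ultimately show False by argo
qed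

text \<open>The splice lowers only the two degrees of \<open>v\<close>, by one each, and these
  exceeded \<open>d\<close>; the new link is neither a loop nor parallel to another.\<close>

lemma splice_candidate:
  assumes c: "regular_candidate V Q" and V: "finite V" and v: "v \<in> V" "d < card (outs Q v)"
    and i: "i \<in> Q" "dst i = v" and j: "j \<in> Q" "src j = v"
    and ne: "src i \<noteq> dst j" "(src i, dst j) \<notin> pr ` Q"
  shows "\<exists>Q'. regular_candidate V Q' \<and> card Q' < card Q"
proof -
  have A: "Adm Q" and inj: "inj_on pr Q" and fin: "finite Q"
    and ends: "\<And>q. q \<in> Q \<Longrightarrow> src q \<in> V \<and> dst q \<in> V \<and> src q \<noteq> dst q"
    using c Adm_finite unfolding regular_candidate_def by auto
  have ij: "i \<noteq> j" using ends[OF i(1)] i j by auto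
  obtain f where f: "f i \<notin> Q - {i} - {j}" "Adm ((Q - {i} - {j}) \<union> {f i})" "src (f i) = src i" "dst (f i) = dst j"
    using Adm_splice[OF A, of "{i}" "{j}" "\<lambda>_. j"] i j ij by (auto simp: bij_betw_def)
  define R where "R = Q - {i} - {j}"
  define Q' where "Q' = insert (f i) R"
  have fR: "finite R" "f i \<notin> R" using fin f by (auto simp: R_def)
  have Q: "Q = insert i (insert j R)" "i \<notin> R" "j \<notin> R" using i j by (auto simp: R_def)
  have srcs: "src i \<in> V" "dst j \<in> V" "src i \<noteq> v" "dst j \<noteq> v" using ends[OF i(1)] ends[OF j(1)] i j by auto
  have outs_ins: "card {q \<in> insert x S. p q = u} = card {q\<in>S. p q = u} + of_bool (p x = u)"
    if "finite S" "x \<notin> S" for x u and S :: "'l set" and p :: "'l \<Rightarrow> 'a"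
  proof -
    have "{q \<in> insert x S. p q = u} = (if p x = u then insert x {q\<in>S. p q = u} else {q\<in>S. p q = u})" by auto
    then show ?thesis using that by simp
  qed
  have o: "card (outs Q u) = card (outs R u) + of_bool (src i = u) + of_bool (v = u)" for u
    unfolding outs_def Q(1) using outs_ins[of "insert j R" i src u] outs_ins[of R j src u] fR Q(2,3) ij j by simp
  have o': "card (outs Q' u) = card (outs R u) + of_bool (src i = u)" for u
    unfolding outs_def Q'_def using outs_ins[OF fR, of src u] f(3) by simp
  have n: "card (ins Q u) = card (ins R u) + of_bool (v = u) + of_bool (dst j = u)" for u
    unfolding ins_def Q(1) using outs_ins[of "insert j R" i dst u] outs_ins[of R j dst u] fR Q(2,3) ij i by simp
  have n': "card (ins Q' u) = card (ins R u) + of_bool (dst j = u)" for u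
    unfolding ins_def Q'_def using outs_ins[OF fR, of dst u] f(4) by simp
  have "card (ins Q' u) = card (outs Q' u) \<and> d \<le> card (outs Q' u)" if "u \<in> V" for u
  proof -
    have "card (ins Q u) = card (outs Q u)" "d \<le> card (outs Q u)"
      using c that by (auto simp: regular_candidate_def)
    then show ?thesis using o[of u] o'[of u] n[of u] n'[of u] v(2) srcs by (cases "v = u") auto
  qed
  moreover have "inj_on pr Q'"
  proof -
    have "pr (f i) \<notin> pr ` R" using ne(2) f(3,4) by (auto simp: pr_def R_def)
    then show ?thesis unfolding Q'_def using inj_on_subset[OF inj, of R] by (auto simp: R_def)
  qed
  moreover have "Adm Q'" using f(2) by (simp add: Q'_def R_def insert_commute)
  moreover have "\<forall>q\<in>Q'. src q \<in> V \<and> dst q \<in> V \<and> src q \<noteq> dst q"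
    using ends srcs ne(1) f(3,4) by (auto simp: Q'_def R_def)
  ultimately have "regular_candidate V Q'" unfolding regular_candidate_def by blast
  moreover have "card Q' < card Q" unfolding Q(1) Q'_def using fR Q(2,3) ij by simp
  ultimately show ?thesis by blast
qed

text \<open>In a candidate with fewest links, a vertex of excess degree allows no splice. Then its
  in-neighbours are linked to all its out-neighbours except themselves, which sparsity
  forbids.\<close>

lemma exists_regular:
  assumes "regular_candidate V Q" and V: "finite V"
  shows "\<exists>Q. regular_candidate V Q \<and> (\<forall>v\<in>V. card (outs Q v) = d)"
proof -
  obtain Q where c: "regular_candidate V Q" and min: "\<And>Q'. regular_candidate V Q' \<Longrightarrow> card Q \<le> card Q'"
    using ex_has_least_nat[of "regular_candidate V" Q card] assms by blast
  have A: "Adm Q" and inj: "inj_on pr Q" and fin: "finite Q"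
    and ends: "\<And>q. q \<in> Q \<Longrightarrow> src q \<in> V \<and> dst q \<in> V \<and> src q \<noteq> dst q"
    using c Adm_finite unfolding regular_candidate_def by auto
  have "card (outs Q v) = d" if v: "v \<in> V" for v
  proof (rule ccontr)
    assume "card (outs Q v) \<noteq> d"
    then have big: "d < card (outs Q v)" "card (ins Q v) = card (outs Q v)"
      using c v unfolding regular_candidate_def by force+
    have pairs: "src i = dst j \<or> (src i, dst j) \<in> pr ` Q" if "i \<in> ins Q v" "j \<in> outs Q v" for i j
    proof (rule ccontr)
      assume n: "\<not> ?thesis"
      have "i \<in> Q" "dst i = v" "j \<in> Q" "src j = v" using that by (auto simp: ins_def outs_def)
      then obtain Q' where "regular_candidate V Q'" "card Q' < card Q"
        using splice_candidate[OF c V v big(1)] n by blast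
      then show False using min[of Q'] by simp
    qed
    have "inj_on src (ins Q v)" "inj_on dst (outs Q v)"
      using inj by (auto simp: inj_on_def pr_def ins_def outs_def)
    then have "card (src ` ins Q v) = card (outs Q v)" "card (dst ` outs Q v) = card (outs Q v)"
      using big(2) by (simp_all add: card_image)
    then have "d \<le> card (src ` ins Q v)" "d \<le> card (dst ` outs Q v)" using big(1) by simp_all
    then obtain A B where A': "A \<subseteq> src ` ins Q v" "card A = d" and B': "B \<subseteq> dst ` outs Q v" "card B = d"
      by (meson obtain_subset_with_card_n)
    have fAB: "finite A" "finite B" using A' B' d_pos card_ge_0_finite by metis+
    have "a = b \<or> (a, b) \<in> pr ` Q" if "a \<in> A" "b \<in> B" for a b
    proof -
      have "a \<in> src ` ins Q v" "b \<in> dst ` outs Q v" using that A'(1) B'(1) by blast+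
      then obtain i j where "i \<in> ins Q v" "a = src i" "j \<in> outs Q v" "b = dst j" by blast
      then show ?thesis using pairs by simp
    qed
    then show False
      using complete_bipartite_sparse[OF A inj _ fAB(1) A'(2) fAB(2) B'(2)] ends by blast
  qed
  then show ?thesis using c by blast
qed

theorem no_dense_balanced_family:
  assumes c: "regular_candidate V Q" and V: "finite V" "V \<noteq> {}" and k: "k \<ge> 10000"
  shows False
proof -
  obtain Q where c: "regular_candidate V Q" and deg: "\<And>v. v \<in> V \<Longrightarrow> card (outs Q v) = d"
    using exists_regular[OF c V(1)] by blast
  have w: "state V Q {}" using c deg V unfolding state_def regular_candidate_def by simp
  have "defect V (Q \<union> {}) = 0" using deg unfolding defect_def by (simp add: sum.neutral cong: conj_cong)
  then have "potential V Q {} = 0" by (simp add: potential_def pending_weight_def)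
  then have "invariant V Q {}" using w by (simp add: invariant_def)
  moreover have "k \<le> card V"
  proof -
    obtain v where v: "v \<in> V" using V by blast
    have "inj_on dst (outs Q v)" "dst ` outs Q v \<subseteq> V"
      using c by (auto simp: regular_candidate_def inj_on_def pr_def outs_def)
    then have "card (outs Q v) \<le> card V" using V card_inj_on_le by blast
    then show ?thesis using deg[OF v] d by simp
  qed
  ultimately show False using invariant_False k by blast
qed

end

section \<open>Links in a digraph\<close>

text \<open>A link is its list of arcs, and being nonempty it shows both of its ends. Walks are
  allowed instead of paths, so that concatenation stays inside the family; they are shortened only
  at the very end.\<close>

definition admissible_links :: "('a, 'b) pre_digraph \<Rightarrow> 'b list set \<Rightarrow> bool" where
  "admissible_links G Q \<longleftrightarrow> finite Q \<and>
    (\<forall>q\<in>Q. q \<noteq> [] \<and> pre_digraph.awalk G (tail G (hd q)) q (head G (last q))) \<and>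
    (\<forall>q\<in>Q. \<forall>q'\<in>Q. q \<noteq> q' \<longrightarrow> set q \<inter> set q' = {})"

lemma admissible_links_mono: "admissible_links G Q \<Longrightarrow> Q' \<subseteq> Q \<Longrightarrow> admissible_links G Q'"
  unfolding admissible_links_def by (meson finite_subset subsetD)

text \<open>Joining is concatenation. Since arc sets are disjoint and nonempty, the joins differ
  from each other and from all untouched links.\<close>

lemma admissible_links_splice:
  fixes G :: "('a, 'b) pre_digraph"
  assumes G: "wf_digraph G" and Q: "admissible_links G Q" and IJ: "I \<subseteq> Q" "J \<subseteq> Q" "I \<inter> J = {}"
    and \<sigma>: "bij_betw \<sigma> I J" and join: "\<And>i. i \<in> I \<Longrightarrow> head G (last i) = tail G (hd (\<sigma> i))"
  shows "\<exists>f. inj_on f I \<and> f ` I \<inter> (Q - I - J) = {} \<and> admissible_links G ((Q - I - J) \<union> f ` I) \<and>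
    (\<forall>i\<in>I. tail G (hd (f i)) = tail G (hd i) \<and> head G (last (f i)) = head G (last (\<sigma> i)))"
proof -
  interpret wf_digraph G by (rule G)
  define f where "f i = i @ \<sigma> i" for i
  have \<sigma>J: "\<sigma> i \<in> J" if "i \<in> I" for i using \<sigma> that by (rule bij_betwE[rule_format])
  have \<sigma>inj: "\<sigma> i \<noteq> \<sigma> i'" if "i \<in> I" "i' \<in> I" "i \<noteq> i'" for i i'
    using bij_betw_imp_inj_on[OF \<sigma>] that by (meson inj_onD)
  have ne: "q \<noteq> []" and aw: "awalk (tail G (hd q)) q (head G (last q))" if "q \<in> Q" for q
    using Q that by (auto simp: admissible_links_def)
  have dis: "set q \<inter> set q' = {}" if "q \<in> Q" "q' \<in> Q" "q \<noteq> q'" for q q'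
    using Q that by (auto simp: admissible_links_def)
  have QI: "i \<in> Q" "\<sigma> i \<in> Q" if "i \<in> I" for i using that \<sigma>J IJ by auto
  have ne_I: "i \<noteq> \<sigma> i'" if "i \<in> I" "i' \<in> I" for i i' using that \<sigma>J[of i'] IJ(3) by blast
  have sf: "set (f i) = set i \<union> set (\<sigma> i)" for i by (simp add: f_def)
  have dis_ff: "set (f i) \<inter> set (f i') = {}" if "i \<in> I" "i' \<in> I" "i \<noteq> i'" for i i'
    unfolding sf Int_Un_distrib Int_Un_distrib2
    using dis[OF QI(1)[OF that(1)] QI(1)[OF that(2)] that(3)]
      dis[OF QI(2)[OF that(1)] QI(2)[OF that(2)] \<sigma>inj[OF that]]
      dis[OF QI(1)[OF that(1)] QI(2)[OF that(2)] ne_I[OF that(1,2)]]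
      dis[OF QI(2)[OF that(1)] QI(1)[OF that(2)] ne_I[OF that(2,1), symmetric]]
    by simp
  have dis_fq: "set (f i) \<inter> set q = {}" if "i \<in> I" "q \<in> Q - I - J" for i q
  proof -
    have "q \<in> Q" "i \<noteq> q" "\<sigma> i \<noteq> q" using that \<sigma>J[OF that(1)] by auto
    then show ?thesis unfolding sf using dis QI[OF that(1)] by (simp add: Int_Un_distrib2)
  qed
  have fne: "f i \<noteq> []" if "i \<in> I" for i using ne QI that by (simp add: f_def)
  have ends: "tail G (hd (f i)) = tail G (hd i)" "head G (last (f i)) = head G (last (\<sigma> i))" if "i \<in> I" for i
    using ne QI[OF that] by (auto simp: f_def)
  have "inj_on f I"
  proof (rule inj_onI, rule ccontr)
    fix i i' assume a: "i \<in> I" "i' \<in> I" "f i = f i'" "i \<noteq> i'"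
    then have "set (f i) = {}" using dis_ff[of i i'] by simp
    then show False using fne[OF a(1)] by simp
  qed
  moreover have "f ` I \<inter> (Q - I - J) = {}"
  proof -
    have "f i \<notin> Q - I - J" if "i \<in> I" for i
    proof
      assume "f i \<in> Q - I - J"
      then have "set (f i) = {}" using dis_fq[OF that, of "f i"] by simp
      then show False using fne[OF that] by simp
    qed
    then show ?thesis by blast
  qed
  moreover have "admissible_links G ((Q - I - J) \<union> f ` I)"
    unfolding admissible_links_def
  proof (intro conjI ballI impI)
    have "finite Q" using Q by (simp add: admissible_links_def)
    then show "finite ((Q - I - J) \<union> f ` I)" using finite_subset[OF IJ(1)] by simp
    fix q assume q: "q \<in> (Q - I - J) \<union> f ` I"
    show "q \<noteq> []"
    proof (cases "q \<in> f ` I")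
      case True
      then obtain i where "q = f i" "i \<in> I" by (rule imageE)
      then show ?thesis using fne by simp
    next
      case False then show ?thesis using q ne by blast
    qed
    show "awalk (tail G (hd q)) q (head G (last q))"
    proof (cases "q \<in> f ` I")
      case True
      then obtain i where i: "i \<in> I" "q = f i" by blast
      have "awalk (tail G (hd i)) (i @ \<sigma> i) (head G (last (\<sigma> i)))"
        by (rule awalk_appendI[OF aw[OF QI(1)[OF i(1)]]]) (simp add: join[OF i(1)] aw[OF QI(2)[OF i(1)]])
      then show ?thesis using ends[OF i(1)] i(2) by (simp add: f_def)
    next
      case False
      then show ?thesis using q aw by blast
    qed
    fix q' assume q': "q' \<in> (Q - I - J) \<union> f ` I" and qq: "q \<noteq> q'"
    consider "q \<in> Q - I - J" "q' \<in> Q - I - J" | i where "i \<in> I" "q = f i" "q' \<in> Q - I - J"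
      | i where "i \<in> I" "q' = f i" "q \<in> Q - I - J" | i i' where "i \<in> I" "i' \<in> I" "q = f i" "q' = f i'"
      using q q' by blast
    then show "set q \<inter> set q' = {}"
    proof cases
      case 1 then show ?thesis using dis qq by blast
    next
      case 2 then show ?thesis using dis_fq by blast
    next
      case 3 then show ?thesis using dis_fq[of i q] by (simp add: Int_commute)
    next
      case 4 then show ?thesis using dis_ff[of i i'] qq by auto
    qed
  qed
  ultimately show ?thesis using ends by blast
qed

text \<open>One link is chosen for each pair in \<open>D\<close>, so parallel links collapse to one
  arc. Shortening a walk to a path uses only arcs of the walk, which preserves disjointness.\<close>

lemma immerses_of_links:
  fixes G :: "('a, 'b) pre_digraph"
  assumes G: "wf_digraph G" and Q: "admissible_links G Q"
    and nl: "\<And>q. q \<in> Q \<Longrightarrow> tail G (hd q) \<noteq> head G (last q)"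
    and S: "finite S"
  defines "D \<equiv> (\<lambda>q. (tail G (hd q), head G (last q))) ` Q \<inter> S \<times> S"
  shows "\<exists>H :: (nat, nat \<times> nat) pre_digraph.
    digraph H \<and> card (verts H) \<le> card S \<and> card (arcs H) = card D \<and> immerses G H"
proof -
  interpret wf_digraph G by (rule G)
  have aw: "awalk (tail G (hd q)) q (head G (last q))" if "q \<in> Q" for q
    using Q that by (auto simp: admissible_links_def)
  have dis: "set q \<inter> set q' = {}" if "q \<in> Q" "q' \<in> Q" "q \<noteq> q'" for q q'
    using Q that by (auto simp: admissible_links_def)
  \<comment> \<open>\<open>S\<close> may contain elements outside \<open>G\<close>, which cannot be
    images of vertices; no pair in \<open>D\<close> involves them.\<close>
  define S' where "S' = S \<inter> verts G"
  have S': "finite S'" "card S' \<le> card S" using S by (auto simp: S'_def intro: card_mono)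
  obtain g :: "'a \<Rightarrow> nat" where g: "inj_on g S'"
    using finite_imp_inj_to_nat_seg[OF S'(1)] by blast
  define f where "f = inv_into S' g"
  have fg: "f (g a) = a" if "a \<in> S'" for a using g that by (simp add: f_def)
  have DS: "fst p \<in> S'" "snd p \<in> S'" "fst p \<noteq> snd p" if "p \<in> D" for p
  proof -
    obtain q where q: "q \<in> Q" "p = (tail G (hd q), head G (last q))" using \<open>p \<in> D\<close> by (auto simp: D_def)
    have "fst p \<in> verts G" "snd p \<in> verts G"
      using awalk_hd_in_verts[OF aw[OF q(1)]] awalk_last_in_verts[OF aw[OF q(1)]] q(2) by simp_all
    then show "fst p \<in> S'" "snd p \<in> S'" using \<open>p \<in> D\<close> by (auto simp: S'_def D_def)
    show "fst p \<noteq> snd p" using nl[OF q(1)] q(2) by simp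
  qed
  have finD: "finite D" using Q by (simp add: D_def admissible_links_def)
  define lk where "lk p = (SOME q. q \<in> Q \<and> p = (tail G (hd q), head G (last q)))" for p
  have lk: "lk p \<in> Q" "p = (tail G (hd (lk p)), head G (last (lk p)))" if "p \<in> D" for p
  proof -
    have "\<exists>q. q \<in> Q \<and> p = (tail G (hd q), head G (last q))" using that by (auto simp: D_def)
    then have "lk p \<in> Q \<and> p = (tail G (hd (lk p)), head G (last (lk p)))" unfolding lk_def by (rule someI_ex)
    then show "lk p \<in> Q" "p = (tail G (hd (lk p)), head G (last (lk p)))" by blast+
  qed
  define H :: "(nat, nat \<times> nat) pre_digraph" where
    "H = \<lparr>verts = g ` S', arcs = map_prod g g ` D, tail = fst, head = snd\<rparr>"
  have arcs: "\<exists>p. p \<in> D \<and> e = (g (fst p), g (snd p))" if "e \<in> arcs H" for e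
    using that by (auto simp: H_def)
  have dec: "(f (fst e), f (snd e)) \<in> D" "e = (g (f (fst e)), g (f (snd e)))" if e: "e \<in> arcs H" for e
  proof -
    obtain p where p: "p \<in> D" "e = (g (fst p), g (snd p))" using arcs[OF e] by blast
    then have "f (fst e) = fst p" "f (snd e) = snd p" using fg DS by simp_all
    then show "(f (fst e), f (snd e)) \<in> D" "e = (g (f (fst e)), g (f (snd e)))" using p by simp_all
  qed
  have "digraph H"
  proof
    fix e assume e: "e \<in> arcs H"
    obtain p where p: "p \<in> D" "e = (g (fst p), g (snd p))" using arcs[OF e] by blast
    show "tail H e \<in> verts H" "head H e \<in> verts H" using p DS by (simp_all add: H_def)
    show "tail H e \<noteq> head H e" using p DS inj_onD[OF g] by (simp add: H_def) metis
  next
    show "finite (verts H)" "finite (arcs H)" using S' finD by (simp_all add: H_def)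
  next
    fix e1 e2 assume "arc_to_ends H e1 = arc_to_ends H e2"
    then show "e1 = e2" by (simp add: arc_to_ends_def H_def prod_eq_iff)
  qed
  moreover have "card (verts H) \<le> card S" using S' card_image_le[OF S'(1), of g] by (simp add: H_def)
  moreover have "card (arcs H) = card D"
  proof -
    have "inj_on (map_prod g g) D"
      using DS inj_onD[OF g] by (intro inj_onI) (auto simp: prod_eq_iff map_prod_def split_beta)
    then show ?thesis by (simp add: H_def card_image)
  qed
  moreover have "immerses G H"
    unfolding immerses_def
  proof (intro exI conjI ballI impI)
    let ?P = "\<lambda>e. awalk_to_apath (lk (f (fst e), f (snd e)))"
    show "inj_on f (verts H)" unfolding f_def H_def by (simp add: inj_on_inv_into)
    show "f ` verts H \<subseteq> verts G" using fg by (auto simp: H_def S'_def)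
    fix e assume e: "e \<in> arcs H"
    note p = lk[OF dec(1)[OF e]]
    have "awalk (f (fst e)) (lk (f (fst e), f (snd e))) (f (snd e))"
      using aw[OF p(1)] p(2) by simp
    then show "apath (f (tail H e)) (?P e) (f (head H e))"
      by (simp add: H_def apath_awalk_to_apath)
  next
    let ?P = "\<lambda>e. awalk_to_apath (lk (f (fst e), f (snd e)))"
    fix e1 e2 assume e: "e1 \<in> arcs H" "e2 \<in> arcs H" "e1 \<noteq> e2"
    let ?p1 = "(f (fst e1), f (snd e1))" and ?p2 = "(f (fst e2), f (snd e2))"
    note p1 = lk[OF dec(1)[OF e(1)]] and p2 = lk[OF dec(1)[OF e(2)]]
    have "?p1 \<noteq> ?p2" using dec(2)[OF e(1)] dec(2)[OF e(2)] e(3) by (metis prod.inject)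
    then have "lk ?p1 \<noteq> lk ?p2" using p1(2) p2(2) by metis
    then have "set (lk ?p1) \<inter> set (lk ?p2) = {}" by (rule dis[OF p1(1) p2(1)])
    moreover have "set (?P e1) \<subseteq> set (lk ?p1)" "set (?P e2) \<subseteq> set (lk ?p2)"
      using awalk_to_apath_subset aw[OF p1(1)] aw[OF p2(1)] by blast+
    ultimately show "set (?P e1) \<inter> set (?P e2) = {}" by blast
  qed
  ultimately show ?thesis by blast
qed

theorem theorem4p3:
  shows "\<exists>\<beta>::real. \<beta> > 0 \<and>
    (\<exists>k0::nat. \<forall>k\<ge>k0. \<forall>G :: ('a, 'b) pre_digraph.
       digraph G \<and> verts G \<noteq> {} \<and> eulerian G \<and>
       (\<forall>v\<in>verts G. in_degree G v \<ge> 100 * k \<and> out_degree G v \<ge> 100 * k) \<longrightarrow>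
       (\<exists>H :: (nat, nat \<times> nat) pre_digraph.
          digraph H \<and> real (card (verts H)) \<le> \<beta> * real k \<and>
          real (card (arcs H)) \<ge> (real k)\<^sup>2 / 2 \<and> immerses G H))"
proof (rule exI[of _ 200], intro conjI exI[of _ 10000] allI impI)
  \<comment> \<open>The witness 200 is the size \<open>200 * k\<close> of two neighbourhoods in the
    regularised family, and 10000 is large enough for all numerical estimates above.\<close>
  fix k :: nat and G :: "('a, 'b) pre_digraph"
  assume k_large: "10000 \<le> k" and G: "digraph G \<and> verts G \<noteq> {} \<and> eulerian G \<and>
       (\<forall>v\<in>verts G. in_degree G v \<ge> 100 * k \<and> out_degree G v \<ge> 100 * k)"
  then interpret digraph G by blast
  show "\<exists>H :: (nat, nat \<times> nat) pre_digraph. digraph H \<and> real (card (verts H)) \<le> 200 * real k \<and>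
          real (card (arcs H)) \<ge> (real k)\<^sup>2 / 2 \<and> immerses G H"
  proof (rule ccontr)
    assume no: "\<not> ?thesis"
    let ?src = "\<lambda>q. tail G (hd q)" and ?dst = "\<lambda>q. head G (last q)"
    interpret links ?src ?dst "admissible_links G" k "100 * k"
    proof
      fix Q I J :: "'b list set" and \<sigma>
      assume "admissible_links G Q" "I \<subseteq> Q" "J \<subseteq> Q" "I \<inter> J = {}" "bij_betw \<sigma> I J"
        "\<And>i. i \<in> I \<Longrightarrow> ?dst i = ?src (\<sigma> i)"
      then show "\<exists>f. inj_on f I \<and> f ` I \<inter> (Q - I - J) = {} \<and> admissible_links G ((Q - I - J) \<union> f ` I) \<and>
        (\<forall>i\<in>I. ?src (f i) = ?src i \<and> ?dst (f i) = ?dst (\<sigma> i))"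
        by (rule admissible_links_splice[OF wf_digraph_axioms])
    next
      fix Q and S :: "'a set"
      assume Q: "admissible_links G Q" "\<And>q. q \<in> Q \<Longrightarrow> ?src q \<noteq> ?dst q" and S: "finite S" "card S \<le> 200 * k"
      obtain H :: "(nat, nat \<times> nat) pre_digraph" where H: "digraph H" "card (verts H) \<le> card S"
        "card (arcs H) = card ((\<lambda>q. (?src q, ?dst q)) ` Q \<inter> S \<times> S)" "immerses G H"
        using immerses_of_links[OF wf_digraph_axioms Q S(1)] by blast
      have "card (verts H) \<le> 200 * k" using H(2) S(2) by linarith
      then have "real (card (verts H)) \<le> real (200 * k)" by (simp only: of_nat_le_iff)
      then have "real (card (verts H)) \<le> 200 * real k" by simp
      then have "\<not> (real k)\<^sup>2 / 2 \<le> real (card (arcs H))" using no H(1,4) by blast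
      then show "real (card ((\<lambda>q. (?src q, ?dst q)) ` Q \<inter> S \<times> S)) \<le> (real k)\<^sup>2 / 2" using H(3) by linarith
    next
      fix Q Q' :: "'b list set" assume "admissible_links G Q" "Q' \<subseteq> Q"
      then show "admissible_links G Q'" by (rule admissible_links_mono)
    qed (use k_large in \<open>auto simp: admissible_links_def\<close>)
    let ?Q = "(\<lambda>e. [e]) ` arcs G"
    have "admissible_links G ?Q"
      unfolding admissible_links_def by (auto simp: arc_implies_awalk)
    moreover have "inj_on pr ?Q"
      using no_multi_arcs by (auto simp: inj_on_def pr_def arc_to_ends_def)
    moreover have "\<forall>q\<in>?Q. ?src q \<in> verts G \<and> ?dst q \<in> verts G \<and> ?src q \<noteq> ?dst q"
      using no_loops by auto
    moreover have "card (ins ?Q v) = card (outs ?Q v) \<and> 100 * k \<le> card (outs ?Q v)" if "v \<in> verts G" for v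
    proof -
      have "ins ?Q v = (\<lambda>e. [e]) ` in_arcs G v" "outs ?Q v = (\<lambda>e. [e]) ` out_arcs G v"
        by (auto simp: ins_def outs_def)
      then have "card (ins ?Q v) = in_degree G v" "card (outs ?Q v) = out_degree G v"
        by (simp_all add: card_image inj_on_def in_degree_def out_degree_def)
      then show ?thesis using G that by (auto simp: eulerian_def)
    qed
    ultimately have "regular_candidate (verts G) ?Q" unfolding regular_candidate_def by blast
    then show False using no_dense_balanced_family[OF _ finite_verts _ k_large] G by blast
  qed
qed simp

end
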